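(* Second-order $\mathrm{ZF}$ and the second-order theory $\mathrm{FLT}_{\mathrm{ZF}}$ are synonymous. That is, there are interpretations $\iota:\mathrm{FLT}_{\mathrm{ZF}}\to\mathrm{ZF}$ and $\kappa:\mathrm{ZF}\to\mathrm{FLT}_{\mathrm{ZF}}$ such that: (1) if $\mathrm{FLT}_{\mathrm{ZF}}\vdash\varphi$ then $\mathrm{ZF}\vdash\varphi^{\iota}$, for every sentence $\varphi$ in the language of $\mathrm{FLT}_{\mathrm{ZF}}$; (2) if $\mathrm{ZF}\vdash\varphi$ then $\mathrm{FLT}_{\mathrm{ZF}}\vdash\varphi^{\kappa}$, for every sentence $\varphi$ in the language of $\mathrm{ZF}$; (3) $\mathrm{ZF}\vdash\varphi\leftrightarrow(\varphi^{\kappa})^{\iota}$, for every formula $\varphi$ in the language of $\mathrm{ZF}$; (4) $\mathrm{FLT}_{\mathrm{ZF}}\vdash\varphi\leftrightarrow(\varphi^{\iota})^{\kappa}$, for every formula $\varphi$ in the language of $\mathrm{FLT}_{\mathrm{ZF}}$.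
   Context: Logic. Both theories are formulated in classical second-order logic with full (impredicative) second-order Comprehension; $\vdash$ is deductive provability. $\mathrm{ZF}$ is the usual second-order theory of pure sets (Extensionality, Separation, Pairing, Union, Powersets, Infinity, Foundation, and Replacement, with Separation and Replacement stated as single second-order axioms), with the one non-logical primitive $\in$. A translation replaces each non-logical primitive of one language by a formula of the other and commutes with the logical vocabulary (possibly relativizing quantifiers); it is an interpretation when it takes theorems to theorems. In (3) and (4), formulas may contain free variables. Language of $\mathrm{FLT}_{\mathrm{ZF}}$. All first-order objects are (partial) functions, mapping functions to functions. The one non-logical primitive is a three-place predicate $\mathrm{Val}(f,x,y)$, abbreviated $f(x)=y$ ("$f$ applied to $x$ is $y$"), subject to the axiom $\forall f\forall x\forall y\forall z((\mathrm{Val}(f,x,y)\wedge \mathrm{Val}(f,x,z))\to y=z)$. A term $f(x)$ may be undefined; write $\tau\!\downarrow$ for "$\tau$ is defined", i.e. $\exists y\; y=\tau$; atomic formulas containing an undefined term are false. Write $\sigma\simeq\tau$ for "if either of $\sigma,\tau$ is defined then $\sigma=\tau$". A second-order function-variable $P$ ranges over second-order partial one-place maps on the objects. Write $\lambda x.\,\tau(x)$ for the (first-order) function $g$, if there is one, such that $g(v)\simeq\tau(v)$ for all $v$. Definitions. - $g\sqsubset f$ means: $f(g)\!\downarrow$ or $\exists y\, f(y)=g$ (that is, $g$ is in the domain or range of $f$). - $g\sqsubseteq f$ means: for all $x\sqsubset g$, $x\sqsubset f$. - $[x:\varphi(x)]$ denotes, if it exists, the function $e$ with $e(v)=v$ if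 $\varphi(v)$, and $e(v)$ undefined otherwise. $[x\sqsubset a:\varphi]$ means $[x: x\sqsubset a\wedge\varphi]$. - $\pi(f)=[x:(\exists g\sqsubset f)\,x\sqsubseteq g]$, if it exists. - $h$ is a functional-history, $\mathrm{Fist}(h)$, iff for all $x\sqsubset h$: $x=\pi([z\sqsubset h: z\sqsubset x])$. - $s$ is a fevel, $\mathrm{Fev}(s)$, iff $\exists h(\mathrm{Fist}(h)\wedge s=\pi(h))$. Axioms. $\mathrm{FLT}$ has the three axioms: - FunExt: $\forall f\forall g(\forall x\, f(x)\simeq g(x)\to f=g)$. - FunStrat: $\forall a\exists s(\mathrm{Fev}(s)\wedge a\sqsubseteq s)$. - FunComp: $\forall P(\exists f\forall x(P(x)\!\downarrow\;\to(x\sqsubset f\wedge P(x)\sqsubset f))\to\lambda x.P(x)\text{ exists})$. $\mathrm{FLT}_{\mathrm{ZF}}$ is $\mathrm{FLT}$ together with: - FunInfinity: $\exists s(\exists p\sqsubset s)(\forall q\sqsubset s)\exists r(q\sqsubset r\sqsubset s)$ (over $\mathrm{FLT}$: there is an $\omega$th fevel). - FunSupercomp: $\forall P(\exists f\forall x(P(x)\!\downarrow\;\to x\sqsubset f)\to\lambda x.P(x)\text{ exists})$. *)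

theory Defs
  imports Main
begin

section \<open>Second-order logic\<close>

text \<open>
  Variables come in sorts: object variables, \<open>n\<close>-place predicate variables for each \<open>n\<close>, and
  variables for one-place partial functions on the objects.  Binding is by de Bruijn indices, with a
  separate index space for each sort: \<open>All s\<close> binds index \<open>0\<close> of sort \<open>s\<close> and leaves the indices of
  all other sorts alone.

  The predicate variable in \<open>RelAt R ts\<close> has sort \<open>Pred (length ts)\<close>, and \<open>FunAt P x y\<close> says
  \<open>P(x) = y\<close>.  Terms with function variables may be undefined, so they are paraphrased by means of
  this atomic formula.  \<open>Prim ts\<close> is the non-logical primitive; its number of places is fixed by the
  predicate \<open>formula\<close> below.
\<close>

datatype sort = Obj | Pred nat | Func

datatype fm =
    Bot                       (\<open>\<^bold>\<bottom>\<close>)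
  | Prim "nat list"
  | Eq nat nat                (infix \<open>\<^bold>=\<close> 60)
  | RelAt nat "nat list"
  | FunAt nat nat nat
  | Imp fm fm                 (infixr \<open>\<^bold>\<rightarrow>\<close> 25)
  | All sort fm

abbreviation Neg (\<open>\<^bold>\<not> _\<close> [40] 40) where "\<^bold>\<not> p \<equiv> p \<^bold>\<rightarrow> \<^bold>\<bottom>"
abbreviation Con (infixr \<open>\<^bold>\<and>\<close> 35) where "p \<^bold>\<and> q \<equiv> \<^bold>\<not> (p \<^bold>\<rightarrow> \<^bold>\<not> q)"
abbreviation Dis (infixr \<open>\<^bold>\<or>\<close> 30) where "p \<^bold>\<or> q \<equiv> \<^bold>\<not> p \<^bold>\<rightarrow> q"
abbreviation Iff (infix \<open>\<^bold>\<leftrightarrow>\<close> 24) where "p \<^bold>\<leftrightarrow> q \<equiv> (p \<^bold>\<rightarrow> q) \<^bold>\<and> (q \<^bold>\<rightarrow> p)"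
abbreviation Ex where "Ex s p \<equiv> \<^bold>\<not> All s (\<^bold>\<not> p)"
abbreviation All1 (\<open>\<^bold>\<forall> _\<close> [20] 20) where "\<^bold>\<forall> p \<equiv> All Obj p"
abbreviation Ex1 (\<open>\<^bold>\<exists> _\<close> [20] 20) where "\<^bold>\<exists> p \<equiv> Ex Obj p"

text \<open>The formulas of the language whose one non-logical primitive has \<open>k\<close> places.\<close>

fun formula :: "nat \<Rightarrow> fm \<Rightarrow> bool" where
  "formula k (Prim ts) \<longleftrightarrow> length ts = k"
| "formula k (p \<^bold>\<rightarrow> q) \<longleftrightarrow> formula k p \<and> formula k q"
| "formula k (All s p) \<longleftrightarrow> formula k p"
| "formula k _ \<longleftrightarrow> True"

fun fv :: "fm \<Rightarrow> (sort \<times> nat) set" where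
  "fv \<^bold>\<bottom> = {}"
| "fv (Prim ts) = Pair Obj ` set ts"
| "fv (x \<^bold>= y) = {(Obj, x), (Obj, y)}"
| "fv (RelAt R ts) = insert (Pred (length ts), R) (Pair Obj ` set ts)"
| "fv (FunAt P x y) = {(Func, P), (Obj, x), (Obj, y)}"
| "fv (p \<^bold>\<rightarrow> q) = fv p \<union> fv q"
| "fv (All s p) = {(s', i). (s', if s' = s then Suc i else i) \<in> fv p}"

definition sentence :: "nat \<Rightarrow> fm \<Rightarrow> bool" where
  "sentence k p \<longleftrightarrow> formula k p \<and> fv p = {}"

text \<open>
  The only terms are variables, so capture-avoiding substitution is renaming of free variables.
\<close>

definition lift :: "sort \<Rightarrow> (sort \<Rightarrow> nat \<Rightarrow> nat) \<Rightarrow> sort \<Rightarrow> nat \<Rightarrow> nat" where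
  "lift s r = r(s := case_nat 0 (\<lambda>i. Suc (r s i)))"

fun ren :: "(sort \<Rightarrow> nat \<Rightarrow> nat) \<Rightarrow> fm \<Rightarrow> fm" where
  "ren r \<^bold>\<bottom> = \<^bold>\<bottom>"
| "ren r (Prim ts) = Prim (map (r Obj) ts)"
| "ren r (x \<^bold>= y) = (r Obj x \<^bold>= r Obj y)"
| "ren r (RelAt R ts) = RelAt (r (Pred (length ts)) R) (map (r Obj) ts)"
| "ren r (FunAt P x y) = FunAt (r Func P) (r Obj x) (r Obj y)"
| "ren r (p \<^bold>\<rightarrow> q) = (ren r p \<^bold>\<rightarrow> ren r q)"
| "ren r (All s p) = All s (ren (lift s r) p)"

definition shift :: "sort \<Rightarrow> fm \<Rightarrow> fm" where
  "shift s = ren ((\<lambda>_. id)(s := Suc))"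

text \<open>\<open>inst s t p\<close> instantiates index \<open>0\<close> of sort \<open>s\<close> by \<open>t\<close> and lowers the other indices of that sort.\<close>

definition inst :: "sort \<Rightarrow> nat \<Rightarrow> fm \<Rightarrow> fm" where
  "inst s t = ren ((\<lambda>_. id)(s := case_nat t id))"

text \<open>\<open>plug p ts\<close> is \<open>p(ts)\<close>, where the argument places of \<open>p\<close> are its object variables \<open>0, 1, \<dots>\<close>\<close>

definition plug :: "fm \<Rightarrow> nat list \<Rightarrow> fm" where
  "plug p ts = ren (\<lambda>s i. if s = Obj \<and> i < length ts then ts ! i else i) p"

text \<open>
  Natural deduction for classical second-order logic in the language whose primitive has \<open>k\<close> places;
  the premises \<open>formula k p\<close> keep derivations inside that language.  In \<open>PredComp\<close> the formula \<open>p\<close>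
  may have any free variables; its object variables \<open>0, \<dots>, n - 1\<close> are the argument places of the
  predicate.  In \<open>FuncComp\<close> the object variables \<open>1\<close> and \<open>0\<close> of \<open>p\<close> are the argument and the value,
  and the premise says \<open>\<forall>x y z. p(x,y) \<and> p(x,z) \<rightarrow> y = z\<close>.
\<close>

inductive proves :: "fm set \<Rightarrow> nat \<Rightarrow> fm \<Rightarrow> bool" (\<open>_ \<turnstile>\<^bsub>_\<^esub> _\<close> [19, 0, 19] 18) where
  Assm: "p \<in> A \<Longrightarrow> formula k p \<Longrightarrow> A \<turnstile>\<^bsub>k\<^esub> p"
| ImpI: "formula k p \<Longrightarrow> insert p A \<turnstile>\<^bsub>k\<^esub> q \<Longrightarrow> A \<turnstile>\<^bsub>k\<^esub> p \<^bold>\<rightarrow> q"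
| ImpE: "A \<turnstile>\<^bsub>k\<^esub> p \<^bold>\<rightarrow> q \<Longrightarrow> A \<turnstile>\<^bsub>k\<^esub> p \<Longrightarrow> A \<turnstile>\<^bsub>k\<^esub> q"
| Raa: "formula k p \<Longrightarrow> insert (\<^bold>\<not> p) A \<turnstile>\<^bsub>k\<^esub> \<^bold>\<bottom> \<Longrightarrow> A \<turnstile>\<^bsub>k\<^esub> p"
| AllI: "shift s ` A \<turnstile>\<^bsub>k\<^esub> p \<Longrightarrow> A \<turnstile>\<^bsub>k\<^esub> All s p"
| AllE: "A \<turnstile>\<^bsub>k\<^esub> All s p \<Longrightarrow> A \<turnstile>\<^bsub>k\<^esub> inst s t p"
| EqRefl: "A \<turnstile>\<^bsub>k\<^esub> x \<^bold>= x"
| EqSubst: "A \<turnstile>\<^bsub>k\<^esub> x \<^bold>= y \<Longrightarrow> A \<turnstile>\<^bsub>k\<^esub> inst Obj x p \<Longrightarrow> A \<turnstile>\<^bsub>k\<^esub> inst Obj y p"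
| FuncUnique: "A \<turnstile>\<^bsub>k\<^esub> FunAt P x y \<Longrightarrow> A \<turnstile>\<^bsub>k\<^esub> FunAt P x z \<Longrightarrow> A \<turnstile>\<^bsub>k\<^esub> y \<^bold>= z"
| PredComp: "formula k p \<Longrightarrow>
    A \<turnstile>\<^bsub>k\<^esub> Ex (Pred n) ((All Obj ^^ n) (RelAt 0 [0..<n] \<^bold>\<leftrightarrow> shift (Pred n) p))"
| FuncComp: "formula k p \<Longrightarrow>
    A \<turnstile>\<^bsub>k\<^esub> \<^bold>\<forall> \<^bold>\<forall> \<^bold>\<forall> (shift Obj p \<^bold>\<and> ren (lift Obj ((\<lambda>_. id)(Obj := Suc))) p \<^bold>\<rightarrow> 1 \<^bold>= 0) \<Longrightarrow>
    A \<turnstile>\<^bsub>k\<^esub> Ex Func (\<^bold>\<forall> \<^bold>\<forall> (FunAt 0 1 0 \<^bold>\<leftrightarrow> shift Func p))"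


section \<open>Translations\<close>

text \<open>
  A translation is given by a formula \<open>domain(x)\<close> to which quantifiers are relativized (this may be
  trivial) and a formula that replaces the primitive.  Second-order quantifiers are relativized to
  the predicates and partial functions on the domain.
\<close>

datatype trans = Trans (domain: fm) (primitive: fm)

definition translation :: "nat \<Rightarrow> nat \<Rightarrow> trans \<Rightarrow> bool" where
  "translation k l \<tau> \<longleftrightarrow>
     formula l (domain \<tau>) \<and> fv (domain \<tau>) \<subseteq> {(Obj, 0)} \<and>
     formula l (primitive \<tau>) \<and> fv (primitive \<tau>) \<subseteq> Pair Obj ` {..<k}"

definition inDom :: "trans \<Rightarrow> nat \<Rightarrow> fm" where
  "inDom \<tau> x = plug (domain \<tau>) [x]"

text \<open>\<open>inDom2 \<tau> s\<close> says that the value of index \<open>0\<close> of sort \<open>s\<close> belongs to the interpreted domain of that sort.\<close>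

fun inDom2 :: "trans \<Rightarrow> sort \<Rightarrow> fm" where
  "inDom2 \<tau> Obj = inDom \<tau> 0"
| "inDom2 \<tau> (Pred n) =
     (All Obj ^^ n) (RelAt 0 [0..<n] \<^bold>\<rightarrow> foldr (\<lambda>i p. inDom \<tau> i \<^bold>\<and> p) [0..<n] (\<^bold>\<not> \<^bold>\<bottom>))"
| "inDom2 \<tau> Func = (\<^bold>\<forall> \<^bold>\<forall> (FunAt 0 1 0 \<^bold>\<rightarrow> inDom \<tau> 1 \<^bold>\<and> inDom \<tau> 0))"

fun translate :: "trans \<Rightarrow> fm \<Rightarrow> fm" where
  "translate \<tau> \<^bold>\<bottom> = \<^bold>\<bottom>"
| "translate \<tau> (Prim ts) = plug (primitive \<tau>) ts"
| "translate \<tau> (x \<^bold>= y) = (x \<^bold>= y)"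
| "translate \<tau> (RelAt R ts) = RelAt R ts"
| "translate \<tau> (FunAt P x y) = FunAt P x y"
| "translate \<tau> (p \<^bold>\<rightarrow> q) = (translate \<tau> p \<^bold>\<rightarrow> translate \<tau> q)"
| "translate \<tau> (All s p) = All s (inDom2 \<tau> s \<^bold>\<rightarrow> translate \<tau> p)"


section \<open>Second-order ZF\<close>

abbreviation Mem (infix \<open>\<^bold>\<in>\<close> 60) where "x \<^bold>\<in> a \<equiv> Prim [x, a]"

definition Extensionality where
  "Extensionality = (\<^bold>\<forall> \<^bold>\<forall> ((\<^bold>\<forall> (0 \<^bold>\<in> 2 \<^bold>\<leftrightarrow> 0 \<^bold>\<in> 1)) \<^bold>\<rightarrow> 1 \<^bold>= 0))"

definition Separation where
  "Separation = All (Pred 1) (\<^bold>\<forall> \<^bold>\<exists> \<^bold>\<forall> (0 \<^bold>\<in> 1 \<^bold>\<leftrightarrow> 0 \<^bold>\<in> 2 \<^bold>\<and> RelAt 0 [0]))"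

definition Pairing where
  "Pairing = (\<^bold>\<forall> \<^bold>\<forall> \<^bold>\<exists> \<^bold>\<forall> (0 \<^bold>\<in> 1 \<^bold>\<leftrightarrow> 0 \<^bold>= 3 \<^bold>\<or> 0 \<^bold>= 2))"

definition Unions where
  "Unions = (\<^bold>\<forall> \<^bold>\<exists> \<^bold>\<forall> (0 \<^bold>\<in> 1 \<^bold>\<leftrightarrow> (\<^bold>\<exists> (0 \<^bold>\<in> 3 \<^bold>\<and> 1 \<^bold>\<in> 0))))"

definition Powersets where
  "Powersets = (\<^bold>\<forall> \<^bold>\<exists> \<^bold>\<forall> (0 \<^bold>\<in> 1 \<^bold>\<leftrightarrow> (\<^bold>\<forall> (0 \<^bold>\<in> 1 \<^bold>\<rightarrow> 0 \<^bold>\<in> 3))))"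

definition Infinity where
  "Infinity = (\<^bold>\<exists> ((\<^bold>\<exists> (0 \<^bold>\<in> 1 \<^bold>\<and> (\<^bold>\<forall> \<^bold>\<not> 0 \<^bold>\<in> 1))) \<^bold>\<and>
     (\<^bold>\<forall> (0 \<^bold>\<in> 1 \<^bold>\<rightarrow> (\<^bold>\<exists> (0 \<^bold>\<in> 2 \<^bold>\<and> (\<^bold>\<forall> (0 \<^bold>\<in> 1 \<^bold>\<leftrightarrow> 0 \<^bold>\<in> 2 \<^bold>\<or> 0 \<^bold>= 2))))))))"

definition Foundation where
  "Foundation = (\<^bold>\<forall> ((\<^bold>\<exists> 0 \<^bold>\<in> 1) \<^bold>\<rightarrow> (\<^bold>\<exists> (0 \<^bold>\<in> 1 \<^bold>\<and> \<^bold>\<not> (\<^bold>\<exists> (0 \<^bold>\<in> 1 \<^bold>\<and> 0 \<^bold>\<in> 2))))))"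

definition Replacement where
  "Replacement = All Func (\<^bold>\<forall> \<^bold>\<exists> \<^bold>\<forall> (0 \<^bold>\<in> 1 \<^bold>\<leftrightarrow> (\<^bold>\<exists> (0 \<^bold>\<in> 3 \<^bold>\<and> FunAt 0 0 1))))"

definition ZF :: "fm set" where
  "ZF = {Extensionality, Separation, Pairing, Unions, Powersets, Infinity, Foundation, Replacement}"


section \<open>Function level theory\<close>

abbreviation Val where "Val f x y \<equiv> Prim [f, x, y]"

definition Defined where  \<comment> \<open>\<open>f(x)\<down>\<close>\<close>
  "Defined f x = (\<^bold>\<exists> Val (Suc f) (Suc x) 0)"

definition DefinedF where  \<comment> \<open>\<open>P(x)\<down>\<close>\<close>
  "DefinedF P x = (\<^bold>\<exists> FunAt P (Suc x) 0)"

definition In (infix \<open>\<^bold>\<sqsubset>\<close> 60) where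
  "g \<^bold>\<sqsubset> f = (Defined f g \<^bold>\<or> (\<^bold>\<exists> Val (Suc f) 0 (Suc g)))"

definition Sub (infix \<open>\<^bold>\<sqsubseteq>\<close> 60) where
  "g \<^bold>\<sqsubseteq> f = (\<^bold>\<forall> (0 \<^bold>\<sqsubset> Suc g \<^bold>\<rightarrow> 0 \<^bold>\<sqsubset> Suc f))"

definition IsIdOn where  \<comment> \<open>\<open>e = [x : p(x)]\<close>, where \<open>p\<close> is under one binder, for \<open>x\<close>\<close>
  "IsIdOn e p = (\<^bold>\<forall> ((p \<^bold>\<rightarrow> Val (Suc e) 0 0) \<^bold>\<and> (\<^bold>\<not> p \<^bold>\<rightarrow> \<^bold>\<not> Defined (Suc e) 0)))"

definition IsPi where  \<comment> \<open>\<open>a = \<pi>(f)\<close>\<close>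
  "IsPi a f = IsIdOn a (\<^bold>\<exists> (0 \<^bold>\<sqsubset> f + 2 \<^bold>\<and> 1 \<^bold>\<sqsubseteq> 0))"

definition Fist where  \<comment> \<open>\<open>x = \<pi>([z \<sqsubset> h : z \<sqsubset> x])\<close> is false if one of its terms is undefined\<close>
  "Fist h = (\<^bold>\<forall> (0 \<^bold>\<sqsubset> h + 1 \<^bold>\<rightarrow> (\<^bold>\<exists> (IsIdOn 0 (0 \<^bold>\<sqsubset> h + 3 \<^bold>\<and> 0 \<^bold>\<sqsubset> 2) \<^bold>\<and> IsPi 1 0))))"

definition Fev where
  "Fev s = (\<^bold>\<exists> (Fist 0 \<^bold>\<and> IsPi (s + 1) 0))"

definition SameAt where  \<comment> \<open>\<open>f(x) \<simeq> g(x)\<close>\<close>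
  "SameAt f g x = (Defined f x \<^bold>\<or> Defined g x \<^bold>\<rightarrow>
     (\<^bold>\<exists> (Val (Suc f) (Suc x) 0 \<^bold>\<and> Val (Suc g) (Suc x) 0)))"

definition SameAtF where  \<comment> \<open>\<open>g(x) \<simeq> P(x)\<close>\<close>
  "SameAtF g P x = (Defined g x \<^bold>\<or> DefinedF P x \<^bold>\<rightarrow>
     (\<^bold>\<exists> (Val (Suc g) (Suc x) 0 \<^bold>\<and> FunAt P (Suc x) 0)))"

definition LambdaExists where  \<comment> \<open>\<open>\<lambda>x. P(x)\<close> exists\<close>
  "LambdaExists P = (\<^bold>\<exists> \<^bold>\<forall> SameAtF 1 P 0)"

definition ValFunctional where
  "ValFunctional = (\<^bold>\<forall> \<^bold>\<forall> \<^bold>\<forall> \<^bold>\<forall> (Val 3 2 1 \<^bold>\<and> Val 3 2 0 \<^bold>\<rightarrow> 1 \<^bold>= 0))"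

definition FunExt where
  "FunExt = (\<^bold>\<forall> \<^bold>\<forall> ((\<^bold>\<forall> SameAt 2 1 0) \<^bold>\<rightarrow> 1 \<^bold>= 0))"

definition FunStrat where
  "FunStrat = (\<^bold>\<forall> \<^bold>\<exists> (Fev 0 \<^bold>\<and> 1 \<^bold>\<sqsubseteq> 0))"

definition FunComp where
  "FunComp = All Func
     ((\<^bold>\<exists> \<^bold>\<forall> (DefinedF 0 0 \<^bold>\<rightarrow> 0 \<^bold>\<sqsubset> 1 \<^bold>\<and> (\<^bold>\<exists> (FunAt 0 1 0 \<^bold>\<and> 0 \<^bold>\<sqsubset> 2)))) \<^bold>\<rightarrow> LambdaExists 0)"

definition FunInfinity where
  "FunInfinity = (\<^bold>\<exists> \<^bold>\<exists> (0 \<^bold>\<sqsubset> 1 \<^bold>\<and> (\<^bold>\<forall> (0 \<^bold>\<sqsubset> 2 \<^bold>\<rightarrow> (\<^bold>\<exists> (1 \<^bold>\<sqsubset> 0 \<^bold>\<and> 0 \<^bold>\<sqsubset> 3))))))"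

definition FunSupercomp where
  "FunSupercomp = All Func ((\<^bold>\<exists> \<^bold>\<forall> (DefinedF 0 0 \<^bold>\<rightarrow> 0 \<^bold>\<sqsubset> 1)) \<^bold>\<rightarrow> LambdaExists 0)"

definition FLT :: "fm set" where
  "FLT = {ValFunctional, FunExt, FunStrat, FunComp}"

definition FLT_ZF :: "fm set" where
  "FLT_ZF = FLT \<union> {FunInfinity, FunSupercomp}"

lemmas ZF_axiom_defs = Extensionality_def Separation_def Pairing_def Unions_def Powersets_def
  Infinity_def Foundation_def Replacement_def

lemmas FLT_axiom_defs = ValFunctional_def FunExt_def FunStrat_def FunComp_def FunInfinity_def
  FunSupercomp_def

lemmas FLT_notion_defs = Defined_def DefinedF_def In_def Sub_def IsIdOn_def IsPi_def Fist_def
  Fev_def SameAt_def SameAtF_def LambdaExists_def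

lemma sentence_ZF: "p \<in> ZF \<Longrightarrow> sentence 2 p"
  by (auto simp: ZF_def ZF_axiom_defs sentence_def numeral_eq_Suc split: if_splits)

lemma sentence_FLT_ZF: "p \<in> FLT_ZF \<Longrightarrow> sentence 3 p"
  by (auto simp: FLT_ZF_def FLT_def FLT_axiom_defs FLT_notion_defs sentence_def numeral_eq_Suc
      split: if_splits)

end

theory Submission
  imports Defs "HOL-Library.Countable_Set"
begin

text \<open>
  Both translations leave the domain alone, so on each side one needs a definition of the other
  primitive, and the two definitions must undo each other.  A set can be coded by the identity
  function on it, and a partial function by its graph, but neither coding is onto.  They are
  amalgamated as in the proof of the Cantor-Bernstein theorem.  Call a set \<^emph>\<open>wild\<close> if it is not the
  graph of a function, and let the \<^emph>\<open>core\<close> be the least class that contains every wild set and, with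
  \<open>y\<close>, the set \<open>{(u, u) | u \<in> y}\<close>.  A set in the core acts as the identity function on itself; any other
  set is a graph and acts as the function with that graph (\<open>vapp\<close>).  Conversely, the members of a
  function in the core are its fixed points, and the members of any other function \<open>f\<close> are the pairs
  \<open>(u, v)\<close> with \<open>f(u) = v\<close> (\<open>memf\<close>).

  The two definitions undo each other because pairs and core mean the same on both sides.  The pairs
  are Kuratowski pairs made of sets \<open>{\<emptyset>, a, b}\<close>.  Such a set contains \<open>\<emptyset>\<close>, which is not a pair, so it is
  wild, lies in the core, and acts as the identity function on itself.  Hence it is the same object
  whether it is described as a set or as an identity function, and so is every pair built from such
  sets.  This is the content of the locale \<open>linked\<close> and of \<open>mem_vapp\<close> and \<open>app_memf\<close>.

  For the axioms, the key notion on the side of functions is well-foundedness of \<open>g \<sqsubset> f\<close>.  It follows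
  from the axioms of function level theory because the stages of a history are well-founded, by a
  Russell paradox (\<open>fist_wf\<close>); together with comparability of fevels (\<open>fev_linear\<close>) it gives the
  axioms of set theory (\<open>memf_zf\<close>).  In the other direction transitive closures, obtained by
  iterating unions along \<open>\<omega>\<close>, give well-foundedness for \<open>vapp\<close> (\<open>vapp_founded\<close>), and well-foundedness
  in turn gives stratification (\<open>strat\<close>).

  None of this is carried out inside the calculus.  The calculus is sound and complete for general
  models, in which second-order quantifiers range over any stock of predicates and functions that
  satisfies comprehension (\<open>sound\<close>, \<open>completeness\<close>), so it suffices to compare the models of the two
  theories.  In a model the second-order axioms speak only of the predicates in the stock; the locale
  \<open>definability\<close> isolates the closure properties that show the required ones to be there.
\<close>

section \<open>General models of second-order logic\<close>

text \<open>
  One type for the values of variables of all sorts, so that an assignment is a single function and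
  renaming can be treated uniformly in the sort.
\<close>

datatype 'a val = VO (ob: 'a) | VP (pr: "'a list \<Rightarrow> bool") | VF (fn: "'a \<Rightarrow> 'a \<Rightarrow> bool")

type_synonym 'a env = "sort \<Rightarrow> nat \<Rightarrow> 'a val"

text \<open>
  The domain is a subset of the type because the term model below lives on the classes of a congruence;
  later it is always the whole type.
\<close>

datatype 'a model = Model (dom: "'a set") (prim: "'a list \<Rightarrow> bool")
  (rels: "nat \<Rightarrow> ('a list \<Rightarrow> bool) set") (funs: "('a \<Rightarrow> 'a \<Rightarrow> bool) set")

fun vals :: "'a model \<Rightarrow> sort \<Rightarrow> 'a val set" where
  "vals M Obj = VO ` dom M"
| "vals M (Pred n) = VP ` rels M n"
| "vals M Func = VF ` funs M"

definition valid :: "'a model \<Rightarrow> 'a env \<Rightarrow> bool" where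
  "valid M e \<longleftrightarrow> (\<forall>s i. e s i \<in> vals M s)"

definition push :: "sort \<Rightarrow> 'a val \<Rightarrow> 'a env \<Rightarrow> 'a env" where
  "push s v e = e(s := case_nat v (e s))"

lemma push_simps [simp]:
  "push s v e s 0 = v"
  "push s v e s (Suc i) = e s i"
  "push s v e s (numeral n) = e s (pred_numeral n)"
  "s' \<noteq> s \<Longrightarrow> push s v e s' = e s'"
  by (auto simp: push_def numeral_eq_Suc)

lemma push_one [simp]: "push s v e s 1 = e s 0"
  by (simp add: push_def)

fun sat :: "'a model \<Rightarrow> 'a env \<Rightarrow> fm \<Rightarrow> bool" where
  "sat M e \<^bold>\<bottom> \<longleftrightarrow> False"
| "sat M e (Prim ts) \<longleftrightarrow> prim M (map (\<lambda>i. ob (e Obj i)) ts)"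
| "sat M e (x \<^bold>= y) \<longleftrightarrow> ob (e Obj x) = ob (e Obj y)"
| "sat M e (RelAt R ts) \<longleftrightarrow> pr (e (Pred (length ts)) R) (map (\<lambda>i. ob (e Obj i)) ts)"
| "sat M e (FunAt P x y) \<longleftrightarrow> fn (e Func P) (ob (e Obj x)) (ob (e Obj y))"
| "sat M e (p \<^bold>\<rightarrow> q) \<longleftrightarrow> (sat M e p \<longrightarrow> sat M e q)"
| "sat M e (All s p) \<longleftrightarrow> (\<forall>v \<in> vals M s. sat M (push s v e) p)"

lemma valid_push: "valid M e \<Longrightarrow> v \<in> vals M s \<Longrightarrow> valid M (push s v e)"
  by (auto simp: valid_def push_def split: nat.split)

subsection \<open>Renaming\<close>

lemma push_lift: "(\<lambda>s' i. push s v e s' (lift s r s' i)) = push s v (\<lambda>s i. e s (r s i))"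
  by (auto simp: push_def lift_def fun_eq_iff split: nat.split)

lemma sat_ren: "sat M e (ren r p) = sat M (\<lambda>s i. e s (r s i)) p"
proof (induction p arbitrary: e r)
  case (All s p)
  then show ?case by (simp only: ren.simps sat.simps push_lift)
qed (simp_all add: o_def)

lemma sat_shift: "sat M (push s v e) (shift s p) = sat M e p"
proof -
  have "(\<lambda>s' i. push s v e s' (((\<lambda>_. id)(s := Suc)) s' i)) = e"
    by (auto simp: push_def fun_eq_iff)
  then show ?thesis by (simp only: shift_def sat_ren)
qed

lemma sat_inst: "sat M e (inst s t p) = sat M (push s (e s t) e) p"
proof -
  have "(\<lambda>s' i. e s' (((\<lambda>_. id)(s := case_nat t id)) s' i)) = push s (e s t) e"
    by (auto simp: push_def fun_eq_iff split: nat.split)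
  then show ?thesis by (simp only: inst_def sat_ren)
qed

lemma lift_comp: "lift s (\<lambda>s i. r s (r' s i)) = (\<lambda>s' i. lift s r s' (lift s r' s' i))"
  by (auto simp: lift_def fun_eq_iff split: nat.split)

lemma ren_ren: "ren r (ren r' p) = ren (\<lambda>s i. r s (r' s i)) p"
  by (induction p arbitrary: r r') (simp_all add: lift_comp)

lemma ren_cong: "(\<And>s i. (s, i) \<in> fv p \<Longrightarrow> r s i = r' s i) \<Longrightarrow> ren r p = ren r' p"
proof (induction p arbitrary: r r')
  case (All s p)
  have "ren (lift s r) p = ren (lift s r') p"
  proof (rule All.IH)
    fix s' i assume "(s', i) \<in> fv p"
    then show "lift s r s' i = lift s r' s' i"
      using All.prems by (cases i) (auto simp: lift_def)
  qed
  then show ?case by simp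
next
  case (Imp p q)
  have "ren r p = ren r' p" by (rule Imp.IH) (simp add: Imp.prems)
  moreover have "ren r q = ren r' q" by (rule Imp.IH) (simp add: Imp.prems)
  ultimately show ?case by simp
qed auto

lemma lift_id: "lift s (\<lambda>_ i. i) = (\<lambda>_ i. i)"
  by (auto simp: lift_def fun_eq_iff split: nat.split)

lemma ren_id: "ren (\<lambda>_ i. i) p = p"
  by (induction p) (simp_all add: lift_id)

lemma ren_fix: "(\<And>s i. (s, i) \<in> fv p \<Longrightarrow> r s i = i) \<Longrightarrow> ren r p = p"
  using ren_cong[of p r "\<lambda>_ i. i"] by (simp add: ren_id)

lemma ren_closed: "fv p = {} \<Longrightarrow> ren r p = p"
  by (rule ren_fix) simp

lemma finite_fv: "finite (fv p)"
proof (induction p)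
  case (All s p)
  have "fv (All s p) \<subseteq> (\<lambda>(s', i). (s', if s' = s then i - 1 else i)) ` fv p"
  proof clarify
    fix s' i assume "(s', i) \<in> fv (All s p)"
    then have "(s', if s' = s then Suc i else i) \<in> fv p" by simp
    then show "(s', i) \<in> (\<lambda>(s', i). (s', if s' = s then i - 1 else i)) ` fv p"
      by (rule rev_image_eqI) auto
  qed
  then show ?case using All finite_surj by blast
qed auto

lemma formula_ren [simp]: "formula k (ren r p) = formula k p"
  by (induction p arbitrary: r) simp_all

lemma formula_shift [simp]: "formula k (shift s p) = formula k p"
  by (simp add: shift_def)

lemma formula_inst [simp]: "formula k (inst s t p) = formula k p"
  by (simp add: inst_def)

lemma formula_Alls [simp]: "formula k ((All s ^^ n) p) = formula k p"
  by (induction n) simp_all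

lemma proves_formula: "A \<turnstile>\<^bsub>k\<^esub> p \<Longrightarrow> formula k p"
  by (induction rule: proves.induct) simp_all

lemma ren_shift: "ren (lift s r) (shift s p) = shift s (ren r p)"
  unfolding shift_def ren_ren by (rule ren_cong) (auto simp: lift_def)

lemma ren_inst: "ren r (inst s t p) = inst s (r s t) (ren (lift s r) p)"
  unfolding inst_def ren_ren by (rule ren_cong) (auto simp: lift_def split: nat.split)

lemma ren_Alls: "ren r ((All s ^^ n) p) = (All s ^^ n) (ren ((lift s ^^ n) r) p)"
proof (induction n arbitrary: r)
  case (Suc n)
  have "(lift s ^^ Suc n) r = (lift s ^^ n) (lift s r)" by (metis comp_apply funpow_Suc_right)
  then show ?case using Suc by simp
qed simp

lemma lifts_other: "s' \<noteq> s \<Longrightarrow> (lift s ^^ n) r s' = r s'"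
  by (induction n) (simp_all add: lift_def)

lemma lifts_less: "i < n \<Longrightarrow> (lift s ^^ n) r s i = i"
  by (induction n arbitrary: i) (auto simp: lift_def split: nat.split)

lemma lift_commute: "s' \<noteq> s \<Longrightarrow> lift s (lift s' r) = lift s' (lift s r)"
  by (auto simp: lift_def fun_eq_iff)

lemma lifts_commute: "s' \<noteq> s \<Longrightarrow> (lift s ^^ n) (lift s' r) = lift s' ((lift s ^^ n) r)"
  by (induction n) (simp_all add: lift_commute)

lemma lift_0 [simp]: "lift s r s 0 = 0"
  by (simp add: lift_def)

lemma lift_Suc [simp]: "lift s r s (Suc i) = Suc (r s i)"
  by (simp add: lift_def)

lemma lift_other [simp]: "s' \<noteq> s \<Longrightarrow> lift s r s' = r s'"
  by (simp add: lift_def)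

text \<open>
  Derivability is invariant under arbitrary renaming of free variables.  This yields generalization over
  fresh variables, and it transports instances of comprehension to the parameters of the term model.
\<close>

lemma proves_ren: "A \<turnstile>\<^bsub>k\<^esub> p \<Longrightarrow> ren r ` A \<turnstile>\<^bsub>k\<^esub> ren r p"
proof (induction arbitrary: r rule: proves.induct)
  case (Assm p A k)
  then show ?case by (auto intro: proves.Assm)
next
  case (ImpI k p A q)
  then show ?case using proves.ImpI[of k "ren r p" "ren r ` A" "ren r q"] by simp
next
  case (ImpE A k p q)
  then show ?case using proves.ImpE[of "ren r ` A" k "ren r p" "ren r q"] by simp
next
  case (Raa k p A)
  then show ?case using proves.Raa[of k "ren r p" "ren r ` A"] by simp
next
  case (AllI s A k p)
  have "ren (lift s r) ` shift s ` A = shift s ` ren r ` A"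
    by (auto simp: image_image ren_shift)
  then show ?case using proves.AllI[of s "ren r ` A" k "ren (lift s r) p"] AllI.IH[of "lift s r"]
    by simp
next
  case (AllE A k s p t)
  then show ?case using proves.AllE[of "ren r ` A" k s "ren (lift s r) p" "r s t"]
    by (simp add: ren_inst)
next
  case (EqRefl A k x)
  then show ?case by (simp add: proves.EqRefl)
next
  case (EqSubst A k x y p)
  then show ?case
    using proves.EqSubst[of "ren r ` A" k "r Obj x" "r Obj y" "ren (lift Obj r) p"]
    by (simp add: ren_inst)
next
  case (FuncUnique A k P x y z)
  then show ?case using proves.FuncUnique[of "ren r ` A" k "r Func P" "r Obj x" "r Obj y" "r Obj z"]
    by simp
next
  case (PredComp k p A n)
  let ?r = "(lift Obj ^^ n) r"
  have "map ((lift Obj ^^ n) (lift (Pred n) r) Obj) [0..<n] = [0..<n]"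
    by (rule map_idI) (simp add: lifts_less)
  then show ?case
    using proves.PredComp[of k "ren ?r p" "ren r ` A" n] PredComp
    by (simp add: ren_Alls lifts_other lifts_commute ren_shift)
next
  case (FuncComp k p A)
  let ?r = "lift Obj (lift Obj r)"
  have eq: "ren (lift Obj ?r) (ren (lift Obj ((\<lambda>_. id)(Obj := Suc))) p)
      = ren (lift Obj ((\<lambda>_. id)(Obj := Suc))) (ren ?r p)"
    unfolding ren_ren by (rule ren_cong) (auto simp: lift_def split: nat.split)
  have eq2: "lift Obj (lift Obj (lift Func r)) = lift Func ?r"
    by (simp add: lift_commute)
  have l: "lift Obj r' Obj 1 = Suc (r' Obj 0)" for r' :: "sort \<Rightarrow> nat \<Rightarrow> nat"
    by (simp add: lift_def)
  show ?case
    using proves.FuncComp[of k "ren ?r p" "ren r ` A"] FuncComp.IH[of r] FuncComp.hyps(1)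
    by (simp add: ren_shift eq l eq2)
qed

abbreviation predCompFm where
  "predCompFm n p \<equiv> Ex (Pred n) ((All Obj ^^ n) (RelAt 0 [0..<n] \<^bold>\<leftrightarrow> shift (Pred n) p))"

abbreviation uniqueFm where
  "uniqueFm p \<equiv>
     \<^bold>\<forall> \<^bold>\<forall> \<^bold>\<forall> (shift Obj p \<^bold>\<and> ren (lift Obj ((\<lambda>_. id)(Obj := Suc))) p \<^bold>\<rightarrow> 1 \<^bold>= 0)"

abbreviation funCompFm where
  "funCompFm p \<equiv> Ex Func (\<^bold>\<forall> \<^bold>\<forall> (FunAt 0 1 0 \<^bold>\<leftrightarrow> shift Func p))"

lemma proves_mono: "A \<turnstile>\<^bsub>k\<^esub> p \<Longrightarrow> A \<subseteq> B \<Longrightarrow> B \<turnstile>\<^bsub>k\<^esub> p"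
proof (induction arbitrary: B rule: proves.induct)
  case (ImpI k p A q)
  then show ?case by (meson insert_mono proves.ImpI)
next
  case (Raa k p A)
  then show ?case by (meson insert_mono proves.Raa)
next
  case (AllI s A k p)
  then show ?case by (meson image_mono proves.AllI)
qed (blast intro: proves.intros)+

lemma proves_finite: "A \<turnstile>\<^bsub>k\<^esub> p \<Longrightarrow> \<exists>B. finite B \<and> B \<subseteq> A \<and> (B \<turnstile>\<^bsub>k\<^esub> p)"
proof (induction rule: proves.induct)
  case (Assm p A k)
  then show ?case by (intro exI[of _ "{p}"]) (auto intro: proves.Assm)
next
  case (ImpI k p A q)
  then obtain B where B: "finite B" "B \<subseteq> insert p A" "B \<turnstile>\<^bsub>k\<^esub> q" by auto
  then have "insert p (B - {p}) \<turnstile>\<^bsub>k\<^esub> q" by (auto intro: proves_mono)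
  then show ?case using B ImpI.hyps by (intro exI[of _ "B - {p}"]) (auto intro: proves.ImpI)
next
  case (ImpE A k p q)
  then obtain B C where "finite B" "B \<subseteq> A" "B \<turnstile>\<^bsub>k\<^esub> p \<^bold>\<rightarrow> q" "finite C" "C \<subseteq> A" "C \<turnstile>\<^bsub>k\<^esub> p"
    by auto
  then show ?case
    by (intro exI[of _ "B \<union> C"]) (auto intro: proves.ImpE[of _ _ p] proves_mono)
next
  case (Raa k p A)
  then obtain B where B: "finite B" "B \<subseteq> insert (\<^bold>\<not> p) A" "B \<turnstile>\<^bsub>k\<^esub> \<^bold>\<bottom>" by auto
  then have "insert (\<^bold>\<not> p) (B - {\<^bold>\<not> p}) \<turnstile>\<^bsub>k\<^esub> \<^bold>\<bottom>" by (auto intro: proves_mono)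
  then show ?case using B Raa.hyps by (intro exI[of _ "B - {\<^bold>\<not> p}"]) (auto intro: proves.Raa)
next
  case (AllI s A k p)
  then obtain B where "finite B" "B \<subseteq> shift s ` A" "B \<turnstile>\<^bsub>k\<^esub> p" by auto
  then obtain C where "finite C" "C \<subseteq> A" "B = shift s ` C"
    by (meson finite_subset_image)
  then show ?case using \<open>B \<turnstile>\<^bsub>k\<^esub> p\<close> by (auto intro: proves.AllI)
next
  case (AllE A k s p t)
  then show ?case by (auto intro: proves.AllE)
next
  case (EqSubst A k x y p)
  then obtain B C where "finite B" "B \<subseteq> A" "B \<turnstile>\<^bsub>k\<^esub> x \<^bold>= y" "finite C" "C \<subseteq> A" "C \<turnstile>\<^bsub>k\<^esub> inst Obj x p"
    by auto
  then show ?case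
    by (intro exI[of _ "B \<union> C"]) (auto intro: proves.EqSubst[of _ _ x y p] proves_mono)
next
  case (FuncUnique A k P x y z)
  then obtain B C where "finite B" "B \<subseteq> A" "B \<turnstile>\<^bsub>k\<^esub> FunAt P x y"
      "finite C" "C \<subseteq> A" "C \<turnstile>\<^bsub>k\<^esub> FunAt P x z"
    by auto
  then show ?case
    by (intro exI[of _ "B \<union> C"]) (auto intro: proves.FuncUnique[of _ _ P x] proves_mono)
next
  case (FuncComp k p A)
  then obtain B where B: "finite B" "B \<subseteq> A" "B \<turnstile>\<^bsub>k\<^esub> uniqueFm p" by blast
  from proves.FuncComp[OF FuncComp.hyps(1) B(3)] B(1,2) show ?case by blast
next
  case (EqRefl A k x)
  then show ?case by (meson proves.EqRefl empty_subsetI finite.emptyI)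
next
  case (PredComp k p A n)
  then show ?case by (meson proves.PredComp empty_subsetI finite.emptyI)
qed

subsection \<open>Soundness\<close>

text \<open>
  The effect of \<open>length xs\<close> successive object quantifiers; the innermost one binds index \<open>0\<close>, so the list
  is read from the inside out.
\<close>

definition pushs :: "'a list \<Rightarrow> 'a env \<Rightarrow> 'a env" where
  "pushs xs e = e(Obj := \<lambda>i. if i < length xs then VO (xs ! i) else e Obj (i - length xs))"

lemma pushs_append: "pushs xs (push Obj (VO x) e) = pushs (xs @ [x]) e"
proof -
  have "(case i - length xs of 0 \<Rightarrow> VO x | Suc j \<Rightarrow> e Obj j) =
      (if i = length xs then VO x else e Obj (i - Suc (length xs)))" if "\<not> i < length xs" for i
  proof -
    define j where "j = i - length xs"
    have "i = length xs + j" using that by (simp add: j_def)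
    then show ?thesis by (cases j) auto
  qed
  then show ?thesis
    by (auto simp: pushs_def push_def fun_eq_iff nth_append)
qed

lemma sat_Alls: "sat M e ((All Obj ^^ n) p) \<longleftrightarrow>
    (\<forall>xs. length xs = n \<longrightarrow> set xs \<subseteq> dom M \<longrightarrow> sat M (pushs xs e) p)"
proof (induction n arbitrary: e)
  case 0
  then show ?case by (simp add: pushs_def)
next
  case (Suc n)
  have "sat M e ((All Obj ^^ Suc n) p) \<longleftrightarrow>
      (\<forall>x\<in>dom M. \<forall>xs. length xs = n \<longrightarrow> set xs \<subseteq> dom M \<longrightarrow> sat M (pushs (xs @ [x]) e) p)"
    by (simp add: Suc pushs_append)
  also have "\<dots> \<longleftrightarrow> (\<forall>xs. length xs = Suc n \<longrightarrow> set xs \<subseteq> dom M \<longrightarrow> sat M (pushs xs e) p)"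
    by (auto simp: length_Suc_conv_rev)
  finally show ?case .
qed

definition relOf :: "'a model \<Rightarrow> nat \<Rightarrow> fm \<Rightarrow> 'a env \<Rightarrow> 'a list \<Rightarrow> bool" where
  "relOf M n p e = (\<lambda>xs. length xs = n \<and> set xs \<subseteq> dom M \<and> sat M (pushs xs e) p)"

definition funOf :: "'a model \<Rightarrow> fm \<Rightarrow> 'a env \<Rightarrow> 'a \<Rightarrow> 'a \<Rightarrow> bool" where
  "funOf M p e = (\<lambda>x y. x \<in> dom M \<and> y \<in> dom M \<and> sat M (push Obj (VO y) (push Obj (VO x) e)) p)"

definition functional :: "('a \<Rightarrow> 'a \<Rightarrow> bool) \<Rightarrow> bool" where
  "functional F \<longleftrightarrow> (\<forall>x y z. F x y \<longrightarrow> F x z \<longrightarrow> y = z)"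

text \<open>
  Predicates and functions are cut down to their arity and to the domain, so that two of them that agree
  where it matters are equal.  A valid assignment is required to exist since otherwise the comprehension
  clauses would be vacuous.
\<close>

definition henkin :: "nat \<Rightarrow> 'a model \<Rightarrow> bool" where
  "henkin k M \<longleftrightarrow>
     (\<exists>e. valid M e) \<and>
     (\<forall>n. \<forall>R\<in>rels M n. \<forall>xs. R xs \<longrightarrow> length xs = n \<and> set xs \<subseteq> dom M) \<and>
     (\<forall>F\<in>funs M. functional F \<and> (\<forall>x y. F x y \<longrightarrow> x \<in> dom M \<and> y \<in> dom M)) \<and>
     (\<forall>p e n. formula k p \<longrightarrow> valid M e \<longrightarrow> relOf M n p e \<in> rels M n) \<and>
     (\<forall>p e. formula k p \<longrightarrow> valid M e \<longrightarrow> functional (funOf M p e) \<longrightarrow> funOf M p e \<in> funs M)"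

lemma push_commute: "s \<noteq> s' \<Longrightarrow> push s v (push s' w e) = push s' w (push s v e)"
  by (auto simp: push_def fun_eq_iff)

lemma pushs_push: "s \<noteq> Obj \<Longrightarrow> pushs xs (push s v e) = push s v (pushs xs e)"
  by (auto simp: push_def pushs_def fun_eq_iff)

lemma sat_predCompFm: "sat M e (predCompFm n p) \<longleftrightarrow>
   (\<exists>R\<in>rels M n. \<forall>xs. length xs = n \<longrightarrow> set xs \<subseteq> dom M \<longrightarrow> R xs = sat M (pushs xs e) p)"
proof -
  have "map (\<lambda>i. ob (pushs xs e Obj i)) [0..<n] = xs" if "length xs = n" for xs
    using that by (auto simp: pushs_def intro: nth_equalityI)
  then show ?thesis by (simp add: sat_Alls pushs_push sat_shift) blast
qed

lemma sat_uniqueFm: "sat M e (uniqueFm p) \<longleftrightarrow> functional (funOf M p e)"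
proof -
  have a: "(\<lambda>s i. push Obj z (push Obj y (push Obj x e)) s
        (lift Obj ((\<lambda>_. id)(Obj := Suc)) s i)) = push Obj z (push Obj x e)" for x y z
    by (auto simp: push_def lift_def fun_eq_iff split: nat.split)
  show ?thesis
    by (simp add: sat_shift sat_ren a functional_def funOf_def) blast
qed

lemma sat_funCompFm: "sat M e (funCompFm p) \<longleftrightarrow>
   (\<exists>F\<in>funs M. \<forall>x\<in>dom M. \<forall>y\<in>dom M. F x y = funOf M p e x y)"
proof -
  have sh: "sat M (push Obj y (push Obj x (push Func f e))) (shift Func p) =
      sat M (push Obj y (push Obj x e)) p" for x y f
    by (simp add: push_commute[of Obj Func] sat_shift)
  have "sat M e (funCompFm p) \<longleftrightarrow> (\<exists>F\<in>funs M. \<forall>x\<in>dom M. \<forall>y\<in>dom M.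
      F x y = sat M (push Obj (VO y) (push Obj (VO x) e)) p)"
    by (simp add: iff_conv_conj_imp sh)
  then show ?thesis by (simp add: funOf_def)
qed

text \<open>
  The comprehension rules and \<open>FuncUnique\<close> rest on the clauses of \<open>henkin\<close>, the other rules on the recursive
  clauses of truth and on the effect of renaming.
\<close>

lemma sound: "A \<turnstile>\<^bsub>k\<^esub> p \<Longrightarrow> henkin k M \<Longrightarrow> valid M e \<Longrightarrow> \<forall>a\<in>A. sat M e a \<Longrightarrow> sat M e p"
proof (induction arbitrary: e rule: proves.induct)
  case (AllI s A k p)
  then show ?case by (simp add: valid_push sat_shift)
next
  case (AllE A k s p t)
  then show ?case by (auto simp: sat_inst valid_def)
next
  case (EqSubst A k x y p)
  have "ob (e Obj x) = ob (e Obj y)" using EqSubst by simp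
  moreover have "e Obj x \<in> VO ` dom M" "e Obj y \<in> VO ` dom M"
    using EqSubst.prems(2) by (metis valid_def vals.simps(1))+
  ultimately have "e Obj x = e Obj y" by auto
  moreover have "sat M e (inst Obj x p)" using EqSubst by blast
  ultimately show ?case by (simp add: sat_inst)
next
  case (FuncUnique A k P x y z)
  have "e Func P \<in> VF ` funs M"
    using FuncUnique.prems(2) by (metis valid_def vals.simps(3))
  then have "functional (fn (e Func P))" using FuncUnique.prems(1) by (auto simp: henkin_def)
  moreover have "sat M e (FunAt P x y)" "sat M e (FunAt P x z)"
    using FuncUnique.IH FuncUnique.prems by blast+
  ultimately show ?case by (simp add: functional_def)
next
  case (PredComp k p A n)
  have "relOf M n p e \<in> rels M n"
    using PredComp.hyps PredComp.prems(1,2) unfolding henkin_def by blast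
  then show ?case unfolding sat_predCompFm by (intro bexI) (simp_all add: relOf_def)
next
  case (FuncComp k p A)
  have "sat M e (uniqueFm p)" using FuncComp.IH FuncComp.prems by blast
  then have "functional (funOf M p e)" by (simp only: sat_uniqueFm)
  then have "funOf M p e \<in> funs M"
    using FuncComp.hyps(1) FuncComp.prems(1,2) unfolding henkin_def by blast
  then show ?case unfolding sat_funCompFm by (intro bexI) simp_all
qed auto

section \<open>Completeness\<close>

instance sort :: countable by countable_datatype
instance fm :: countable by countable_datatype

definition consistent :: "nat \<Rightarrow> fm set \<Rightarrow> bool" where
  "consistent k S \<longleftrightarrow> \<not> (S \<turnstile>\<^bsub>k\<^esub> \<^bold>\<bottom>)"

text \<open>
  A derivation of the instance at a fresh variable \<open>c\<close> is renamed so that \<open>c\<close> becomes index \<open>0\<close> and all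
  other indices of that sort move up; it then ends in the premise of \<open>AllI\<close>.
\<close>

lemma consistent_witness:
  assumes "consistent k (insert (\<^bold>\<not> All s q) S)" "formula k q"
    and fresh: "\<And>a. a \<in> S \<Longrightarrow> (s, c) \<notin> fv a" "(s, c) \<notin> fv (All s q)"
  shows "consistent k (insert (\<^bold>\<not> inst s c q) (insert (\<^bold>\<not> All s q) S))"
  unfolding consistent_def
proof
  let ?S = "insert (\<^bold>\<not> All s q) S"
  assume 0: "insert (\<^bold>\<not> inst s c q) ?S \<turnstile>\<^bsub>k\<^esub> \<^bold>\<bottom>"
  have 1: "?S \<turnstile>\<^bsub>k\<^esub> inst s c q" by (rule proves.Raa[OF _ 0]) (simp add: assms(2))
  \<comment> \<open>undoes the instantiation at \<open>c\<close>\<close>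
  define r :: "sort \<Rightarrow> nat \<Rightarrow> nat" where
    "r = (\<lambda>_. id)(s := \<lambda>i. if i = c then 0 else Suc i)"
  have sh: "ren r a = shift s a" if "(s, c) \<notin> fv a" for a
    unfolding shift_def using that by (intro ren_cong) (auto simp: r_def)
  have "ren r ` ?S = shift s ` ?S"
    using fresh by (intro image_cong refl sh) auto
  moreover have "ren r (inst s c q) = q"
    unfolding inst_def ren_ren
    using fresh(2) by (intro ren_fix) (auto simp: r_def split: nat.split)
  ultimately have "shift s ` ?S \<turnstile>\<^bsub>k\<^esub> q" using proves_ren[OF 1, of r] by simp
  then have "?S \<turnstile>\<^bsub>k\<^esub> All s q" by (rule proves.AllI)
  moreover have "?S \<turnstile>\<^bsub>k\<^esub> \<^bold>\<not> All s q" using assms(2) by (intro proves.Assm) auto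
  ultimately have "?S \<turnstile>\<^bsub>k\<^esub> \<^bold>\<bottom>" using proves.ImpE by blast
  then show False using assms(1) by (simp add: consistent_def)
qed

definition saturated :: "nat \<Rightarrow> fm set \<Rightarrow> bool" where
  "saturated k H \<longleftrightarrow> consistent k H \<and>
     (\<forall>p. formula k p \<longrightarrow> p \<in> H \<or> \<not> consistent k (insert p H)) \<and>
     (\<forall>s q. formula k q \<longrightarrow> (\<^bold>\<not> All s q) \<in> H \<longrightarrow> (\<exists>c. (\<^bold>\<not> inst s c q) \<in> H))"

lemma consistent_mono: "consistent k T \<Longrightarrow> S \<subseteq> T \<Longrightarrow> consistent k S"
  unfolding consistent_def using proves_mono by blast

text \<open>
  Lindenbaum's construction along an enumeration of the formulas, with Henkin witnesses.  At each stage
  only finitely many variables are free, so a fresh one is available as witness.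
\<close>

lemma saturate:
  assumes "consistent k S" "finite (\<Union>(fv ` S))"
  shows "\<exists>H. S \<subseteq> H \<and> saturated k H"
proof -
  define G where "G S \<longleftrightarrow> consistent k S \<and> finite (\<Union>(fv ` S))" for S
  define R where "R n S S' \<longleftrightarrow> S \<subseteq> S' \<and> (\<forall>p. from_nat n = p \<longrightarrow> formula k p \<longrightarrow>
      (p \<in> S' \<or> \<not> consistent k (insert p S')) \<and>
      (\<forall>s q. p = (\<^bold>\<not> All s q) \<longrightarrow> p \<in> S' \<longrightarrow> (\<exists>c. (\<^bold>\<not> inst s c q) \<in> S')))" for n S S'
  have step: "\<exists>S'. G S' \<and> R n S S'" if "G S" for S n
  proof -
    define p :: fm where "p = from_nat n"
    show ?thesis
    proof (cases "formula k p \<and> consistent k (insert p S)")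
      case False
      then have "R n S S"
        using consistent_mono[of k S] that by (auto simp: R_def p_def G_def insert_absorb)
      then show ?thesis using that by blast
    next
      case True
      show ?thesis
      proof (cases "\<exists>s q. p = (\<^bold>\<not> All s q)")
        case False
        then have "R n S (insert p S)" by (auto simp: R_def p_def)
        moreover have "G (insert p S)" using that True by (auto simp: G_def finite_fv)
        ultimately show ?thesis by blast
      next
        case c: True
        then obtain s q where p: "p = (\<^bold>\<not> All s q)" by blast
        have "finite (\<Union>(fv ` S) \<union> fv (All s q))"
          using that finite_fv by (auto simp only: G_def finite_Un)
        then have "finite {c. (s, c) \<in> \<Union>(fv ` S) \<union> fv (All s q)}"
          by (rule finite_vimageI[of _ "Pair s", unfolded vimage_def]) (simp add: inj_on_def)
        then obtain c where c: "(s, c) \<notin> \<Union>(fv ` S) \<union> fv (All s q)"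
          using ex_new_if_finite[OF infinite_UNIV_nat] by blast
        let ?S = "insert (\<^bold>\<not> inst s c q) (insert p S)"
        have "consistent k ?S" unfolding p
        proof (rule consistent_witness)
          show "consistent k (insert (\<^bold>\<not> All s q) S)" "formula k q" using True p by auto
        qed (use c in auto)
        then have "G ?S" using that by (auto simp: G_def finite_fv)
        moreover have "R n S ?S" by (auto simp: R_def p p_def[symmetric])
        ultimately show ?thesis by blast
      qed
    qed
  qed
  have "\<exists>T. \<forall>n. (G (T n) \<and> (n = 0 \<longrightarrow> T n = S)) \<and> R n (T n) (T (Suc n))"
  proof (rule dependent_nat_choice)
    show "\<exists>X. G X \<and> ((0::nat) = 0 \<longrightarrow> X = S)" using assms by (auto simp: G_def)
  qed (use step in auto)
  then obtain T where T: "T 0 = S" "\<And>n. G (T n)" "\<And>n. R n (T n) (T (Suc n))" by blast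
  have mono: "T m \<subseteq> T n" if "m \<le> n" for m n
    by (rule lift_Suc_mono_le[OF _ that]) (use T(3) in \<open>auto simp: R_def\<close>)
  define H where "H = (\<Union>n. T n)"
  have sub: "T n \<subseteq> H" for n by (auto simp: H_def)
  have "consistent k H"
    unfolding consistent_def
  proof
    assume "H \<turnstile>\<^bsub>k\<^esub> \<^bold>\<bottom>"
    from proves_finite[OF this]
    obtain B where B: "finite B" "B \<subseteq> H" "B \<turnstile>\<^bsub>k\<^esub> \<^bold>\<bottom>" by blast
    from B(1,2) have "\<exists>n. B \<subseteq> T n"
    proof (induction B rule: finite_induct)
      case (insert b B)
      obtain n where "B \<subseteq> T n" using insert.IH insert.prems by auto
      moreover obtain m where "b \<in> T m" using insert.prems by (auto simp: H_def)
      ultimately have "insert b B \<subseteq> T (max m n)"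
        using mono[of m "max m n"] mono[of n "max m n"] by auto
      then show ?case by blast
    qed simp
    then obtain n where "B \<subseteq> T n" ..
    with T(2)[of n] have "consistent k B" using consistent_mono by (auto simp: G_def)
    then show False using B(3) by (simp add: consistent_def)
  qed
  moreover have "p \<in> H \<or> \<not> consistent k (insert p H)" if "formula k p" for p
  proof -
    have "p \<in> T (Suc (to_nat p)) \<or> \<not> consistent k (insert p (T (Suc (to_nat p))))"
      using T(3)[of "to_nat p"] that by (simp add: R_def)
    then show ?thesis using sub consistent_mono by (meson insert_mono subsetD)
  qed
  moreover have "\<exists>c. (\<^bold>\<not> inst s c q) \<in> H" if q: "formula k q" "(\<^bold>\<not> All s q) \<in> H" for s q
  proof -
    let ?p = "\<^bold>\<not> All s q"
    have "consistent k (insert ?p H)" using q(2) \<open>consistent k H\<close> by (simp add: insert_absorb)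
    then have "consistent k (insert ?p (T (Suc (to_nat ?p))))" by (rule consistent_mono) (use sub in auto)
    moreover have "?p \<in> T (Suc (to_nat ?p)) \<or> \<not> consistent k (insert ?p (T (Suc (to_nat ?p))))"
      using T(3)[of "to_nat ?p"] q(1) by (simp add: R_def)
    ultimately have "?p \<in> T (Suc (to_nat ?p))" by blast
    then obtain c where "(\<^bold>\<not> inst s c q) \<in> T (Suc (to_nat ?p))"
      using T(3)[of "to_nat ?p"] q(1) by (auto simp: R_def)
    then show ?thesis using sub by blast
  qed
  ultimately have "saturated k H" by (simp add: saturated_def)
  moreover have "S \<subseteq> H" using sub[of 0] T(1) by simp
  ultimately show ?thesis by blast
qed


lemma proves_eq_sym: "A \<turnstile>\<^bsub>k\<^esub> x \<^bold>= y \<Longrightarrow> A \<turnstile>\<^bsub>k\<^esub> y \<^bold>= x"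
  using proves.EqSubst[of A k x y "0 \<^bold>= Suc x"] by (simp add: inst_def proves.EqRefl)

lemma proves_eq_trans: "A \<turnstile>\<^bsub>k\<^esub> x \<^bold>= y \<Longrightarrow> A \<turnstile>\<^bsub>k\<^esub> y \<^bold>= z \<Longrightarrow> A \<turnstile>\<^bsub>k\<^esub> x \<^bold>= z"
  using proves.EqSubst[of A k y z "Suc x \<^bold>= 0"] by (simp add: inst_def)

lemma proves_congruence:
  assumes C: "\<And>x ts. inst Obj x (C ts) = C (map (case_nat x id) ts)"
    and eq: "list_all2 (\<lambda>x y. A \<turnstile>\<^bsub>k\<^esub> x \<^bold>= y) ts ts'"
  shows "A \<turnstile>\<^bsub>k\<^esub> C (us @ ts) \<Longrightarrow> A \<turnstile>\<^bsub>k\<^esub> C (us @ ts')"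
  using eq
proof (induction arbitrary: us rule: list_all2_induct)
  case (Cons x ts y ts')
  have m: "map (case_nat z id) (map Suc us @ 0 # map Suc ts) = us @ z # ts" for z
    by (simp add: o_def)
  have "A \<turnstile>\<^bsub>k\<^esub> C (us @ y # ts)"
    using proves.EqSubst[OF Cons.hyps(1), of "C (map Suc us @ 0 # map Suc ts)"] Cons.prems
    by (simp only: C m)
  then show ?case using Cons.IH[of "us @ [y]"] by simp
qed simp

text \<open>
  The model whose values are the variables themselves.  The map \<open>q\<close> names the classes of provably equal
  object variables; it is left open so that the domain can be enumerated once it is known to be infinite.
\<close>

locale term_model =
  fixes k :: nat and H :: "fm set" and q :: "nat \<Rightarrow> 'a"
  assumes sat_H: "saturated k H"
    and q: "q x = q y \<longleftrightarrow> (H \<turnstile>\<^bsub>k\<^esub> x \<^bold>= y)"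
begin

lemma consistent_H: "\<not> (H \<turnstile>\<^bsub>k\<^esub> \<^bold>\<bottom>)"
  using sat_H by (simp add: saturated_def consistent_def)

lemma mem_H: "H \<turnstile>\<^bsub>k\<^esub> p \<Longrightarrow> p \<in> H"
proof (rule ccontr)
  assume p: "H \<turnstile>\<^bsub>k\<^esub> p" "p \<notin> H"
  have f: "formula k p" using p(1) by (rule proves_formula)
  then have "insert p H \<turnstile>\<^bsub>k\<^esub> \<^bold>\<bottom>" using sat_H p(2) by (auto simp: saturated_def consistent_def)
  then have "H \<turnstile>\<^bsub>k\<^esub> \<^bold>\<not> p" by (rule proves.ImpI[OF f])
  then show False using p(1) proves.ImpE consistent_H by blast
qed

lemma truth_neg: "formula k p \<Longrightarrow> (H \<turnstile>\<^bsub>k\<^esub> \<^bold>\<not> p) \<longleftrightarrow> \<not> (H \<turnstile>\<^bsub>k\<^esub> p)"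
proof
  assume f: "formula k p" and n: "\<not> (H \<turnstile>\<^bsub>k\<^esub> p)"
  have "p \<notin> H" using n proves.Assm[OF _ f] by blast
  then have "insert p H \<turnstile>\<^bsub>k\<^esub> \<^bold>\<bottom>" using sat_H f by (auto simp: saturated_def consistent_def)
  then show "H \<turnstile>\<^bsub>k\<^esub> \<^bold>\<not> p" by (rule proves.ImpI[OF f])
qed (use proves.ImpE consistent_H in blast)

lemma truth_imp:
  assumes "formula k p" "formula k p'"
  shows "(H \<turnstile>\<^bsub>k\<^esub> p \<^bold>\<rightarrow> p') \<longleftrightarrow> ((H \<turnstile>\<^bsub>k\<^esub> p) \<longrightarrow> (H \<turnstile>\<^bsub>k\<^esub> p'))"
proof
  assume i: "(H \<turnstile>\<^bsub>k\<^esub> p) \<longrightarrow> (H \<turnstile>\<^bsub>k\<^esub> p')"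
  show "H \<turnstile>\<^bsub>k\<^esub> p \<^bold>\<rightarrow> p'"
  proof (cases "H \<turnstile>\<^bsub>k\<^esub> p")
    case True
    then show ?thesis using i assms by (intro proves.ImpI) (auto intro: proves_mono)
  next
    case False
    let ?A = "insert (\<^bold>\<not> p') (insert p H)"
    have "?A \<turnstile>\<^bsub>k\<^esub> \<^bold>\<not> p" using False truth_neg[OF assms(1)] by (auto intro: proves_mono)
    moreover have "?A \<turnstile>\<^bsub>k\<^esub> p" using assms by (intro proves.Assm) auto
    ultimately have "?A \<turnstile>\<^bsub>k\<^esub> \<^bold>\<bottom>" by (rule proves.ImpE)
    then show ?thesis using assms by (metis proves.Raa proves.ImpI)
  qed
qed (use proves.ImpE in blast)

lemma truth_all:
  assumes "formula k p"
  shows "(H \<turnstile>\<^bsub>k\<^esub> All s p) \<longleftrightarrow> (\<forall>t. H \<turnstile>\<^bsub>k\<^esub> inst s t p)"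
proof
  assume a: "\<forall>t. H \<turnstile>\<^bsub>k\<^esub> inst s t p"
  show "H \<turnstile>\<^bsub>k\<^esub> All s p"
  proof (rule ccontr)
    assume "\<not> (H \<turnstile>\<^bsub>k\<^esub> All s p)"
    then have "(\<^bold>\<not> All s p) \<in> H" using assms by (intro mem_H) (simp add: truth_neg)
    then obtain c where "(\<^bold>\<not> inst s c p) \<in> H"
      using sat_H assms unfolding saturated_def by blast
    then have "H \<turnstile>\<^bsub>k\<^esub> \<^bold>\<not> inst s c p" using assms by (intro proves.Assm) auto
    then show False using a assms by (simp add: truth_neg)
  qed
qed (use proves.AllE in blast)

definition Rv :: "nat \<Rightarrow> nat \<Rightarrow> 'a list \<Rightarrow> bool" where
  "Rv n i = (\<lambda>vs. \<exists>ts. length ts = n \<and> vs = map q ts \<and> (H \<turnstile>\<^bsub>k\<^esub> RelAt i ts))"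

definition Fv :: "nat \<Rightarrow> 'a \<Rightarrow> 'a \<Rightarrow> bool" where
  "Fv i = (\<lambda>v w. \<exists>x y. v = q x \<and> w = q y \<and> (H \<turnstile>\<^bsub>k\<^esub> FunAt i x y))"

definition tmod :: "'a model" where
  "tmod = Model (range q) (\<lambda>vs. \<exists>ts. vs = map q ts \<and> (H \<turnstile>\<^bsub>k\<^esub> Prim ts))
     (\<lambda>n. range (Rv n)) (range Fv)"

fun vl :: "sort \<Rightarrow> nat \<Rightarrow> 'a val" where
  "vl Obj i = VO (q i)"
| "vl (Pred n) i = VP (Rv n i)"
| "vl Func i = VF (Fv i)"

definition tenv :: "(sort \<Rightarrow> nat \<Rightarrow> nat) \<Rightarrow> 'a env" where
  "tenv r = (\<lambda>s i. vl s (r s i))"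

lemma vals_tmod: "vals tmod s = range (vl s)"
  by (cases s) (auto simp: tmod_def)

lemma valid_tenv: "valid tmod (tenv r)"
  by (simp add: valid_def vals_tmod tenv_def)

lemma valid_tmod: "valid tmod e \<Longrightarrow> \<exists>r. e = tenv r"
proof -
  assume "valid tmod e"
  then have "\<forall>s i. \<exists>j. e s i = vl s j" by (auto simp: valid_def vals_tmod)
  then show ?thesis unfolding tenv_def by metis
qed

lemma q_congruence:
  assumes C: "\<And>x ts. inst Obj x (C ts) = C (map (case_nat x id) ts)"
    and eq: "map q ts = map q ts'" and "H \<turnstile>\<^bsub>k\<^esub> C ts"
  shows "H \<turnstile>\<^bsub>k\<^esub> C ts'"
proof -
  have "list_all2 (\<lambda>x y. H \<turnstile>\<^bsub>k\<^esub> x \<^bold>= y) ts ts'"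
    using eq by (simp add: list_all2_conv_all_nth list_eq_iff_nth_eq flip: q)
  from proves_congruence[OF C this, of "[]"] assms(3) show ?thesis by simp
qed

lemma Rv_map: "Rv (length ts) i (map q ts) \<longleftrightarrow> (H \<turnstile>\<^bsub>k\<^esub> RelAt i ts)"
proof
  assume "Rv (length ts) i (map q ts)"
  then obtain ts' where "map q ts' = map q ts" "H \<turnstile>\<^bsub>k\<^esub> RelAt i ts'"
    unfolding Rv_def by metis
  then show "H \<turnstile>\<^bsub>k\<^esub> RelAt i ts" 
    by (intro q_congruence[of "RelAt i" ts' ts]) (simp_all add: inst_def)
qed (auto simp: Rv_def)

lemma Fv_q: "Fv i (q x) (q y) \<longleftrightarrow> (H \<turnstile>\<^bsub>k\<^esub> FunAt i x y)"
proof
  assume "Fv i (q x) (q y)"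
  then obtain x' y' where e: "H \<turnstile>\<^bsub>k\<^esub> x' \<^bold>= x" "H \<turnstile>\<^bsub>k\<^esub> y' \<^bold>= y" "H \<turnstile>\<^bsub>k\<^esub> FunAt i x' y'"
    unfolding Fv_def by (metis q)
  then have "H \<turnstile>\<^bsub>k\<^esub> FunAt i x y'"
    using proves.EqSubst[OF e(1), of "FunAt i 0 (Suc y')"] by (simp add: inst_def)
  then show "H \<turnstile>\<^bsub>k\<^esub> FunAt i x y"
    using proves.EqSubst[OF e(2), of "FunAt i (Suc x) 0"] by (simp add: inst_def)
qed (auto simp: Fv_def)

lemma prim_tmod: "prim tmod (map q ts) \<longleftrightarrow> (H \<turnstile>\<^bsub>k\<^esub> Prim ts)"
proof
  assume "prim tmod (map q ts)"
  then obtain ts' where "map q ts' = map q ts" "H \<turnstile>\<^bsub>k\<^esub> Prim ts'"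
    by (auto simp: tmod_def)
  then show "H \<turnstile>\<^bsub>k\<^esub> Prim ts" by (intro q_congruence[of Prim ts' ts]) (simp_all add: inst_def)
qed (auto simp: tmod_def)

lemma push_tenv: "push s (vl s t) (tenv r) = tenv (r(s := case_nat t (r s)))"
  by (auto simp: push_def tenv_def fun_eq_iff split: nat.split)

lemma inst_lift: "inst s t (ren (lift s r) p) = ren (r(s := case_nat t (r s))) p"
  unfolding inst_def ren_ren by (rule ren_cong) (auto simp: lift_def split: nat.split)

text \<open>
  An assignment in the term model is a renaming, which is why truth is stated for all renamings at once.
\<close>

lemma truth: "formula k p \<Longrightarrow> sat tmod (tenv r) p \<longleftrightarrow> (H \<turnstile>\<^bsub>k\<^esub> ren r p)"
proof (induction p arbitrary: r)
  case Bot
  then show ?case by (simp add: consistent_H)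
next
  case (Prim ts)
  then show ?case using prim_tmod[of "map (r Obj) ts"] by (simp add: tenv_def o_def)
next
  case (Eq x y)
  then show ?case by (simp add: tenv_def q)
next
  case (RelAt R ts)
  then show ?case using Rv_map[of "map (r Obj) ts"] by (simp add: tenv_def o_def)
next
  case (FunAt P x y)
  then show ?case by (simp add: tenv_def Fv_q)
next
  case (Imp p1 p2)
  then show ?case by (simp add: truth_imp)
next
  case (All s p)
  then show ?case by (simp add: truth_all vals_tmod push_tenv inst_lift)
qed

lemma rels_tmod: "R \<in> rels tmod n \<Longrightarrow> R xs \<Longrightarrow> length xs = n \<and> set xs \<subseteq> dom tmod"
  by (auto simp: tmod_def Rv_def)

lemma funs_tmod: "F \<in> funs tmod \<Longrightarrow> F x y \<Longrightarrow> x \<in> dom tmod \<and> y \<in> dom tmod"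
  by (auto simp: tmod_def Fv_def)

text \<open>
  The instances of comprehension are derivable without assumptions, hence so are their renamings; by
  \<open>truth\<close> they hold in the term model for every assignment.
\<close>

lemma henkin_tmod: "henkin k tmod"
  unfolding henkin_def
proof (intro conjI allI impI ballI)
  show "\<exists>e. valid tmod e" using valid_tenv by blast
next
  fix n R xs assume "R \<in> rels tmod n" "R xs"
  then show "length xs = n" "set xs \<subseteq> dom tmod" using rels_tmod by blast+
next
  fix F x y assume "F \<in> funs tmod" "F x y"
  then show "x \<in> dom tmod" "y \<in> dom tmod" using funs_tmod by blast+
next
  fix F assume "F \<in> funs tmod"
  then obtain i where F: "F = Fv i" by (auto simp: tmod_def)
  show "functional F"
    unfolding functional_def
  proof (intro allI impI)
    fix v w w' assume "F v w" "F v w'"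
    then obtain x y y' where "v = q x" "w = q y" "w' = q y'"
      by (auto simp: F Fv_def)
    then show "w = w'" using \<open>F v w\<close> \<open>F v w'\<close> proves.FuncUnique[of H k i x y y']
      by (simp add: F Fv_q q)
  qed
next
  fix p and e :: "'a env" and n assume p: "formula k p" and "valid tmod e"
  then obtain r where e: "e = tenv r" using valid_tmod by blast
  have "{} \<turnstile>\<^bsub>k\<^esub> predCompFm n p" by (rule proves.PredComp[OF p])
  from proves_mono[OF proves_ren[OF this, of r], of H] have "sat tmod e (predCompFm n p)"
    using p unfolding e by (subst truth) (simp_all add: shift_def)
  then obtain R where R: "R \<in> rels tmod n"
    "\<And>xs. length xs = n \<Longrightarrow> set xs \<subseteq> dom tmod \<Longrightarrow> R xs = sat tmod (pushs xs e) p"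
    unfolding sat_predCompFm by blast
  have "relOf tmod n p e = R"
    unfolding relOf_def fun_eq_iff using R rels_tmod[OF R(1)] by blast
  then show "relOf tmod n p e \<in> rels tmod n" using R(1) by simp
next
  fix p and e :: "'a env"
  assume p: "formula k p" and "valid tmod e" and u: "functional (funOf tmod p e)"
  then obtain r where e: "e = tenv r" using valid_tmod by blast
  have "{uniqueFm p} \<turnstile>\<^bsub>k\<^esub> uniqueFm p" by (rule proves.Assm) (simp_all add: p)
  from proves.FuncComp[OF p this] have "{} \<turnstile>\<^bsub>k\<^esub> uniqueFm p \<^bold>\<rightarrow> funCompFm p"
    by (rule proves.ImpI[rotated]) (simp add: p)
  from proves_mono[OF proves_ren[OF this, of r], of H]
  have "sat tmod e (uniqueFm p \<^bold>\<rightarrow> funCompFm p)"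
    unfolding e by (subst truth) (simp_all add: p)
  moreover have "sat tmod e (uniqueFm p)" using u by (simp only: sat_uniqueFm)
  ultimately have "sat tmod e (funCompFm p)" by (rule sat.simps(6)[THEN iffD1, rule_format])
  then obtain F where F: "F \<in> funs tmod"
    "\<And>x y. x \<in> dom tmod \<Longrightarrow> y \<in> dom tmod \<Longrightarrow> F x y = funOf tmod p e x y"
    unfolding sat_funCompFm by blast
  have "funOf tmod p e = F"
  proof (intro ext)
    fix x y
    show "funOf tmod p e x y = F x y"
    proof (cases "x \<in> dom tmod \<and> y \<in> dom tmod")
      case True
      then show ?thesis using F(2) by simp
    next
      case False
      then show ?thesis using funs_tmod[OF F(1), of x y] by (auto simp: funOf_def)
    qed
  qed
  then show "funOf tmod p e \<in> funs tmod" using F(1) by simp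
qed

end

text \<open>
  The model is over the whole type \<^typ>\<open>nat\<close>, which spares all later arguments the relativization to a
  domain.  This needs infinitely many classes of variables, hence the assumption that models are
  infinite: it is applied to the term model with least representatives, whose domain is then
  enumerated to obtain a second one.
\<close>

theorem completeness:
  assumes A: "\<And>a. a \<in> A \<Longrightarrow> sentence k a" and p: "formula k p"
    and inf: "\<And>M :: nat model. henkin k M \<Longrightarrow> (\<And>e a. valid M e \<Longrightarrow> a \<in> A \<Longrightarrow> sat M e a)
        \<Longrightarrow> infinite (dom M)"
    and valid: "\<And>(M :: nat model) e. henkin k M \<Longrightarrow> dom M = UNIV \<Longrightarrow>
        (\<And>e a. valid M e \<Longrightarrow> a \<in> A \<Longrightarrow> sat M e a) \<Longrightarrow> valid M e \<Longrightarrow> sat M e p"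
  shows "A \<turnstile>\<^bsub>k\<^esub> p"
proof (rule ccontr)
  assume n: "\<not> (A \<turnstile>\<^bsub>k\<^esub> p)"
  have "consistent k (insert (\<^bold>\<not> p) A)"
    unfolding consistent_def using n proves.Raa[OF p] by blast
  moreover have "finite (\<Union>(fv ` insert (\<^bold>\<not> p) A))"
  proof -
    have "\<Union>(fv ` A) = {}" using A by (auto simp: sentence_def)
    then show ?thesis using finite_fv[of p] by simp
  qed
  ultimately obtain H where H: "insert (\<^bold>\<not> p) A \<subseteq> H" "saturated k H" using saturate by blast
  define q0 where "q0 x = (LEAST y. H \<turnstile>\<^bsub>k\<^esub> x \<^bold>= y)" for x
  have q0: "q0 x = q0 y \<longleftrightarrow> (H \<turnstile>\<^bsub>k\<^esub> x \<^bold>= y)" for x y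
  proof
    assume "q0 x = q0 y"
    moreover have "H \<turnstile>\<^bsub>k\<^esub> x \<^bold>= q0 x" "H \<turnstile>\<^bsub>k\<^esub> y \<^bold>= q0 y"
      unfolding q0_def by (rule LeastI, rule proves.EqRefl)+
    ultimately show "H \<turnstile>\<^bsub>k\<^esub> x \<^bold>= y" using proves_eq_sym proves_eq_trans by metis
  next
    assume "H \<turnstile>\<^bsub>k\<^esub> x \<^bold>= y"
    then have "(H \<turnstile>\<^bsub>k\<^esub> x \<^bold>= z) \<longleftrightarrow> (H \<turnstile>\<^bsub>k\<^esub> y \<^bold>= z)" for z
      using proves_eq_sym proves_eq_trans by blast
    then show "q0 x = q0 y" by (simp add: q0_def)
  qed
  have A_true: "sat (term_model.tmod k H q) e a"
    if "term_model k H q" "valid (term_model.tmod k H q) e" "a \<in> A" for q :: "nat \<Rightarrow> nat" and e a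
  proof -
    interpret term_model k H q by fact
    obtain r where e: "e = tenv r" using valid_tmod \<open>valid tmod e\<close> by blast
    have "H \<turnstile>\<^bsub>k\<^esub> a" using \<open>a \<in> A\<close> A H(1) by (intro proves.Assm) (auto simp: sentence_def)
    then show ?thesis using A[OF \<open>a \<in> A\<close>] unfolding e
      by (simp add: truth sentence_def ren_closed)
  qed
  interpret T: term_model k H q0 using H(2) q0 by unfold_locales
  have "infinite (range q0)"
    using inf[OF T.henkin_tmod A_true[OF T.term_model_axioms]] by (simp add: T.tmod_def)
  then have "bij_betw (to_nat_on (range q0)) (range q0) UNIV"
    by (intro to_nat_on_infinite) auto
  define q where "q = to_nat_on (range q0) \<circ> q0"
  have "q x = q y \<longleftrightarrow> q0 x = q0 y" for x y
    using \<open>bij_betw _ _ _\<close> by (auto simp: q_def bij_betw_def inj_on_eq_iff)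
  then interpret Q: term_model k H q using H(2) q0 by unfold_locales simp_all
  have "range q = UNIV"
    using \<open>bij_betw _ _ _\<close> unfolding q_def bij_betw_def image_comp[symmetric] by simp
  then have "sat Q.tmod (Q.tenv (\<lambda>_ i. i)) p"
    using A_true[OF Q.term_model_axioms]
    by (intro valid Q.henkin_tmod Q.valid_tenv) (simp_all add: Q.tmod_def)
  then have "H \<turnstile>\<^bsub>k\<^esub> p" by (simp add: Q.truth p ren_id)
  moreover have "H \<turnstile>\<^bsub>k\<^esub> \<^bold>\<not> p" using H(1) p by (intro proves.Assm) auto
  ultimately show False using Q.truth_neg[OF p] by blast
qed

section \<open>Definable predicates\<close>

text \<open>
  Terms of definable predicates: a variable, given by its position in the stack of objects, or a
  parameter from the model.
\<close>

type_synonym 'a scheme = "(nat \<Rightarrow> 'a) \<Rightarrow> (nat \<Rightarrow> 'a \<Rightarrow> bool) \<Rightarrow> bool"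

definition atom :: "((nat \<Rightarrow> 'a) \<Rightarrow> 'a) \<Rightarrow> bool" where
  "atom t \<longleftrightarrow> (\<exists>i. t = (\<lambda>e. e i)) \<or> (\<exists>a. t = (\<lambda>e. a))"

lemma atom_var: "atom (\<lambda>e. e i)" and atom_const: "atom (\<lambda>e. a)"
  by (auto simp: atom_def)

lemma atom_shift: "atom t \<Longrightarrow> atom (\<lambda>e. t (\<lambda>i. e (Suc i)))"
  by (auto simp: atom_def)

text \<open>
  \<open>D Q\<close> says that \<open>Q\<close> is definable with parameters.  Here \<open>Q\<close> depends on a stack \<open>e\<close> of objects and a
  stack \<open>c\<close> of classes, both with the most recently bound variable on top.  The rules are shaped so
  that \<open>intro\<close> proves definability by recursion on the syntax of a HOL predicate.  Quantification over
  classes is included because least classes are defined impredicatively.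
\<close>

locale definability =
  fixes D :: "'a scheme \<Rightarrow> bool"
  assumes D_not: "D Q \<Longrightarrow> D (\<lambda>e c. \<not> Q e c)"
    and D_imp: "D P \<Longrightarrow> D Q \<Longrightarrow> D (\<lambda>e c. P e c \<longrightarrow> Q e c)"
    and D_all: "D (\<lambda>e c. Q' (\<lambda>i. e (Suc i)) (e 0) c) \<Longrightarrow> D (\<lambda>e c. \<forall>x. Q' e x c)"
    and D_allC': "D (\<lambda>e c. Q'' e (\<lambda>i. c (Suc i)) (c 0)) \<Longrightarrow>
      D (\<lambda>e c. \<forall>P. D (\<lambda>e c. P (e 0)) \<longrightarrow> Q'' e c P)"
    and D_eq': "D (\<lambda>e c. e 0 = e 1)"
    and D_cls': "D (\<lambda>e c. c i (e 0))"
    and D_subst: "D Q \<Longrightarrow> (\<And>i. atom (t i)) \<Longrightarrow> D (\<lambda>e c. Q (\<lambda>i. t i e) c)"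
begin

definition Cl :: "('a \<Rightarrow> bool) \<Rightarrow> bool" where
  "Cl P \<longleftrightarrow> D (\<lambda>e c. P (e 0))"

definition Fn :: "('a \<Rightarrow> 'a \<Rightarrow> bool) \<Rightarrow> bool" where
  "Fn F \<longleftrightarrow> functional F \<and> D (\<lambda>e c. F (e 0) (e 1))"

lemma D_rel1: "D (\<lambda>e c. R (e 0)) \<Longrightarrow> atom t \<Longrightarrow> D (\<lambda>e c. R (t e))"
  using D_subst[of "\<lambda>e c. R (e 0)" "\<lambda>_. t"] by simp

lemma D_rel2: "D (\<lambda>e c. R (e 0) (e 1)) \<Longrightarrow> atom t \<Longrightarrow> atom s \<Longrightarrow> D (\<lambda>e c. R (t e) (s e))"
  using D_subst[of "\<lambda>e c. R (e 0) (e 1)" "case_nat t (\<lambda>_. s)"] by (simp split: nat.split)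

lemma D_rel3: "D (\<lambda>e c. R (e 0) (e 1) (e 2)) \<Longrightarrow> atom t \<Longrightarrow> atom s \<Longrightarrow> atom u \<Longrightarrow>
    D (\<lambda>e c. R (t e) (s e) (u e))"
  using D_subst[of "\<lambda>e c. R (e 0) (e 1) (e 2)" "case_nat t (case_nat s (\<lambda>_. u))"]
  by (simp split: nat.split add: numeral_2_eq_2)

lemma D_eq: "atom t \<Longrightarrow> atom s \<Longrightarrow> D (\<lambda>e c. t e = s e)"
  using D_rel2[of "(=)"] D_eq' by simp

lemma D_cls: "atom t \<Longrightarrow> D (\<lambda>e c. c i (t e))"
  using D_subst[OF D_cls', of "\<lambda>_. t"] by simp

lemma D_allC: "D (\<lambda>e c. Q e (\<lambda>i. c (Suc i)) (c 0)) \<Longrightarrow> D (\<lambda>e c. \<forall>P. Cl P \<longrightarrow> Q e c P)"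
  using D_allC' by (simp add: Cl_def)

lemma D_Cl: "Cl P \<Longrightarrow> atom t \<Longrightarrow> D (\<lambda>e c. P (t e))"
  using D_rel1[of P t] by (simp add: Cl_def)

lemma D_Fn: "Fn F \<Longrightarrow> atom t \<Longrightarrow> atom s \<Longrightarrow> D (\<lambda>e c. F (t e) (s e))"
  using D_rel2[of F t s] by (simp add: Fn_def)

lemma D_and: "D P \<Longrightarrow> D Q \<Longrightarrow> D (\<lambda>e c. P e c \<and> Q e c)"
  using D_not[OF D_imp[OF _ D_not], of P Q] by simp

lemma D_or: "D P \<Longrightarrow> D Q \<Longrightarrow> D (\<lambda>e c. P e c \<or> Q e c)"
  using D_imp[OF D_not, of P Q] by (simp add: disj_imp)

lemma D_iff: "D P \<Longrightarrow> D Q \<Longrightarrow> D (\<lambda>e c. P e c \<longleftrightarrow> Q e c)"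
  using D_and[OF D_imp D_imp, of P Q Q P] by (simp add: iff_conv_conj_imp)

lemma D_ex: "D (\<lambda>e c. Q (\<lambda>i. e (Suc i)) (e 0) c) \<Longrightarrow> D (\<lambda>e c. \<exists>x. Q e x c)"
  using D_not[OF D_all[OF D_not], of "\<lambda>e x c. Q e x c"] by simp

lemma D_True: "D (\<lambda>e c. True)"
  using D_imp[OF D_eq' D_eq'] by simp

lemma D_bool: "D (\<lambda>e c. b)"
  using D_True D_not[OF D_True] by (cases b) simp_all

lemmas D_intros = D_not D_imp D_and D_or D_iff D_all D_allC D_ex D_eq D_cls D_True
  atom_var atom_const

lemma ClI: "D (\<lambda>e c. P (e 0)) \<Longrightarrow> Cl P"
  by (simp add: Cl_def)

lemma FnI: "D (\<lambda>e c. F (e 0) (e 1)) \<Longrightarrow> (\<And>x y z. F x y \<Longrightarrow> F x z \<Longrightarrow> y = z) \<Longrightarrow> Fn F"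
  by (auto simp: Fn_def functional_def)

lemma FnD: "Fn F \<Longrightarrow> F x y \<Longrightarrow> F x z \<Longrightarrow> y = z"
  by (auto simp: Fn_def functional_def)

end

subsection \<open>Definability with parameters in a general model\<close>

definition emb :: "('a \<Rightarrow> bool) \<Rightarrow> 'a list \<Rightarrow> bool" where
  "emb P = (\<lambda>xs. length xs = 1 \<and> P (hd xs))"

lemma emb_simp [simp]: "emb P [x] = P x"
  by (simp add: emb_def)

text \<open>
  \<open>\<rho>\<close> decides for each variable of a formula whether it stands for a position in one of the two stacks or
  for a fixed value.
\<close>

definition asg :: "(nat \<Rightarrow> 'a) \<Rightarrow> (nat \<Rightarrow> 'a \<Rightarrow> bool) \<Rightarrow> (sort \<Rightarrow> nat \<Rightarrow> nat + 'a val) \<Rightarrow> 'a env" where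
  "asg e c \<rho> = (\<lambda>s i. case \<rho> s i of Inl j \<Rightarrow> if s = Obj then VO (e j) else VP (if s = Pred 1 then emb (c j) else undefined) | Inr v \<Rightarrow> v)"

locale general_model =
  fixes k :: nat and M :: "'a model"
  assumes henkin_M: "henkin k M" and dom_M: "dom M = UNIV"
begin

lemma relOf_rels: "formula k p \<Longrightarrow> valid M e \<Longrightarrow> relOf M n p e \<in> rels M n"
  using henkin_M by (simp add: henkin_def)

lemma funOf_funs:
  "formula k p \<Longrightarrow> valid M e \<Longrightarrow> functional (funOf M p e) \<Longrightarrow> funOf M p e \<in> funs M"
  using henkin_M by (simp add: henkin_def)

lemma rels_length: "R \<in> rels M n \<Longrightarrow> R xs \<Longrightarrow> length xs = n"
  using henkin_M by (simp add: henkin_def)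

lemma funs_functional: "F \<in> funs M \<Longrightarrow> functional F"
  using henkin_M by (simp add: henkin_def)

definition ok_asg :: "(sort \<Rightarrow> nat \<Rightarrow> nat + 'a val) \<Rightarrow> bool" where
  "ok_asg \<rho> \<longleftrightarrow> (\<forall>s i. case \<rho> s i of Inl j \<Rightarrow> s \<in> {Obj, Pred 1} | Inr v \<Rightarrow> v \<in> vals M s)"

definition DD :: "'a scheme \<Rightarrow> bool" where
  "DD Q \<longleftrightarrow> (\<exists>p \<rho>. formula k p \<and> ok_asg \<rho> \<and> (\<forall>e c. Q e c = sat M (asg e c \<rho>) p))"


lemma vals_ne: "vals M s \<noteq> {}"
proof -
  obtain e where "valid M e" using henkin_M by (auto simp: henkin_def)
  then show ?thesis unfolding valid_def by blast
qed

lemma valid_asg: "ok_asg \<rho> \<Longrightarrow> (\<And>i. VP (emb (c i)) \<in> vals M (Pred 1)) \<Longrightarrow> valid M (asg e c \<rho>)"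
proof -
  assume r: "ok_asg \<rho>" and c: "\<And>i. VP (emb (c i)) \<in> vals M (Pred 1)"
  have "asg e c \<rho> s i \<in> vals M s" for s i
    using spec[OF spec[OF r[unfolded ok_asg_def], of s], of i] c
    by (cases "\<rho> s i") (auto simp: asg_def dom_M)
  then show ?thesis by (simp add: valid_def)
qed

lemma emb_False: "VP (emb (\<lambda>_. False)) \<in> vals M (Pred 1)"
proof -
  obtain e where "valid M e" using henkin_M by (auto simp: henkin_def)
  then have "relOf M 1 \<^bold>\<bottom> e \<in> rels M 1"
    by (intro relOf_rels) simp_all
  moreover have "relOf M 1 \<^bold>\<bottom> e = emb (\<lambda>_. False)"
    by (auto simp: relOf_def emb_def)
  ultimately show ?thesis by simp
qed

lemma emb_hd: "R \<in> rels M 1 \<Longrightarrow> R = emb (\<lambda>x. R [x])"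
proof (rule ext)
  fix xs assume "R \<in> rels M 1"
  then have "R xs \<longrightarrow> length xs = 1" using rels_length by blast
  then show "R xs = emb (\<lambda>x. R [x]) xs"
    by (cases xs) (auto simp: emb_def)
qed

lemma Ball_emb: "(\<forall>P. emb P \<in> rels M 1 \<longrightarrow> Q P) \<longleftrightarrow> (\<forall>R\<in>rels M 1. Q (\<lambda>x. R [x]))"
proof (intro iffI ballI allI impI)
  fix R assume Q: "\<forall>P. emb P \<in> rels M 1 \<longrightarrow> Q P" and R: "R \<in> rels M 1"
  then have "emb (\<lambda>x. R [x]) \<in> rels M 1" by (simp flip: emb_hd)
  then show "Q (\<lambda>x. R [x])" using Q by simp
next
  fix P assume "\<forall>R\<in>rels M 1. Q (\<lambda>x. R [x])" and "emb P \<in> rels M 1"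
  then have "Q (\<lambda>x. emb P [x])" ..
  then show "Q P" by simp
qed

text \<open>
  Two formulas come with parameters of their own; moving the variables of one to the even and of the
  other to the odd indices lets both sets of parameters live in one assignment.
\<close>

definition merge :: "(sort \<Rightarrow> nat \<Rightarrow> 'b) \<Rightarrow> (sort \<Rightarrow> nat \<Rightarrow> 'b) \<Rightarrow> sort \<Rightarrow> nat \<Rightarrow> 'b" where
  "merge \<rho> \<sigma> = (\<lambda>s i. if even i then \<rho> s (i div 2) else \<sigma> s (i div 2))"

lemma ok_asg_merge: "ok_asg \<rho> \<Longrightarrow> ok_asg \<sigma> \<Longrightarrow> ok_asg (merge \<rho> \<sigma>)"
  by (simp add: ok_asg_def merge_def)

lemma sat_merge:
  "sat M (asg e c (merge \<rho> \<sigma>)) (ren (\<lambda>s i. 2 * i) p) = sat M (asg e c \<rho>) p"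
  "sat M (asg e c (merge \<rho> \<sigma>)) (ren (\<lambda>s i. 2 * i + 1) p) = sat M (asg e c \<sigma>) p"
  by (simp_all add: sat_ren asg_def merge_def)

text \<open>
  Before a quantifier is prefixed, every variable that stands for the top of the stack is renamed to
  index \<open>0\<close>, where the quantifier captures it.
\<close>

definition bind :: "sort \<Rightarrow> (sort \<Rightarrow> nat \<Rightarrow> nat + 'a val) \<Rightarrow> sort \<Rightarrow> nat \<Rightarrow> nat + 'a val" where
  "bind s \<rho> = \<rho>(s := \<lambda>i. case \<rho> s i of Inl j \<Rightarrow> Inl (j - 1) | Inr v \<Rightarrow> Inr v)"

definition bindr :: "sort \<Rightarrow> (sort \<Rightarrow> nat \<Rightarrow> nat + 'a val) \<Rightarrow> sort \<Rightarrow> nat \<Rightarrow> nat" where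
  "bindr s \<rho> = (\<lambda>_. id)(s := \<lambda>i. if \<rho> s i = Inl 0 then 0 else Suc i)"

lemma ok_asg_bind: "ok_asg \<rho> \<Longrightarrow> ok_asg (bind s \<rho>)"
  unfolding ok_asg_def bind_def by (auto split: sum.splits)

lemma sat_bind_Obj:
  "sat M (push Obj (VO x) (asg e c (bind Obj \<rho>))) (ren (bindr Obj \<rho>) p) =
    sat M (asg (case_nat x e) c \<rho>) p"
proof -
  have "(\<lambda>s i. push Obj (VO x) (asg e c (bind Obj \<rho>)) s (bindr Obj \<rho> s i)) =
      asg (case_nat x e) c \<rho>"
    by (auto simp: fun_eq_iff push_def asg_def bind_def bindr_def split: sum.splits nat.splits)
  then show ?thesis by (simp add: sat_ren)
qed

lemma sat_bind_Pred:
  "sat M (push (Pred 1) (VP (emb P)) (asg e c (bind (Pred 1) \<rho>))) (ren (bindr (Pred 1) \<rho>) p) =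
    sat M (asg e (case_nat P c) \<rho>) p"
proof -
  have "(\<lambda>s i. push (Pred 1) (VP (emb P)) (asg e c (bind (Pred 1) \<rho>)) s (bindr (Pred 1) \<rho> s i)) =
      asg e (case_nat P c) \<rho>"
    by (auto simp: fun_eq_iff push_def asg_def bind_def bindr_def split: sum.splits nat.splits)
  then show ?thesis by (simp add: sat_ren)
qed

lemma DD_comprehension:
  assumes "DD (\<lambda>e c. P (e 0))"
  shows "emb P \<in> rels M 1"
proof -
  obtain p \<rho> where p: "formula k p" "ok_asg \<rho>" "\<And>e c. P (e 0) = sat M (asg e c \<rho>) p"
    using assms unfolding DD_def by blast
  define e :: "'a env" where "e = asg (\<lambda>_. undefined) (\<lambda>_ _. False) (bind Obj \<rho>)"
  define r where "r = (\<lambda>_. id)(Obj := \<lambda>i. case \<rho> Obj i of Inl j \<Rightarrow> 0 | Inr v \<Rightarrow> Suc i)"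
  have "valid M e" unfolding e_def using p(2) emb_False by (intro valid_asg ok_asg_bind)
  then have "relOf M 1 (ren r p) e \<in> rels M 1"
    using p(1) by (intro relOf_rels) simp_all
  moreover have "(\<lambda>s i. pushs [x] e s (r s i)) = asg (\<lambda>_. x) (\<lambda>_ _. False) \<rho>" for x
    by (auto simp: fun_eq_iff pushs_def asg_def e_def r_def bind_def split: sum.splits)
  then have "relOf M 1 (ren r p) e = emb P"
    using p(3)[of "\<lambda>_. _" "\<lambda>_ _. False"]
    by (auto simp: fun_eq_iff relOf_def emb_def sat_ren dom_M length_Suc_conv)
  ultimately show ?thesis by simp
qed

lemma DD_comprehension_fun:
  assumes "DD (\<lambda>e c. F (e 0) (e 1))" "functional F"
  shows "F \<in> funs M"
proof -
  obtain p \<rho> where p: "formula k p" "ok_asg \<rho>" "\<And>e c. F (e 0) (e 1) = sat M (asg e c \<rho>) p"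
    using assms(1) unfolding DD_def by blast
  define e :: "'a env" where "e = asg (\<lambda>_. undefined) (\<lambda>_ _. False) \<rho>"
  define r where "r = (\<lambda>_. id)(Obj := \<lambda>i. case \<rho> Obj i of Inl j \<Rightarrow> if j = 0 then 1 else 0 | Inr v \<Rightarrow> i + 2)"
  have v: "valid M e" unfolding e_def using p(2) emb_False by (intro valid_asg)
  have "(\<lambda>s i. push Obj (VO y) (push Obj (VO x) e) s (r s i)) =
      asg (case_nat x (\<lambda>_. y)) (\<lambda>_ _. False) \<rho>" for x y
    by (auto simp: fun_eq_iff push_def asg_def e_def r_def split: sum.splits nat.splits)
  then have F: "funOf M (ren r p) e = F"
    using p(3)[of "case_nat _ (\<lambda>_. _)" "\<lambda>_ _. False"]
    by (auto simp: fun_eq_iff funOf_def sat_ren dom_M)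
  have "functional (funOf M (ren r p) e) \<longrightarrow> funOf M (ren r p) e \<in> funs M"
    using p(1) v by (intro impI funOf_funs) simp_all
  then show ?thesis using F assms(2) by simp
qed

lemma DD_class:
  assumes "emb P \<in> rels M 1"
  shows "DD (\<lambda>e c. P (e 0))"
proof -
  define \<rho> :: "sort \<Rightarrow> nat \<Rightarrow> nat + 'a val" where
    "\<rho> = (\<lambda>s i. if s = Obj then Inl i else if s = Pred 1 then Inr (VP (emb P))
        else Inr (SOME v. v \<in> vals M s))"
  have "ok_asg \<rho>" using assms vals_ne by (auto simp: ok_asg_def \<rho>_def some_in_eq)
  moreover have "P (e 0) = sat M (asg e c \<rho>) (RelAt 0 [0])" for e :: "nat \<Rightarrow> 'a" and c
    by (simp add: asg_def \<rho>_def)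
  ultimately show ?thesis unfolding DD_def
    by (intro exI[of _ "RelAt 0 [0]"] exI[of _ \<rho>]) simp
qed

lemma DD_fun:
  assumes "F \<in> funs M"
  shows "DD (\<lambda>e c. F (e 0) (e 1))"
proof -
  define \<rho> :: "sort \<Rightarrow> nat \<Rightarrow> nat + 'a val" where
    "\<rho> = (\<lambda>s i. if s = Obj then Inl i else if s = Func then Inr (VF F)
        else Inr (SOME v. v \<in> vals M s))"
  have "ok_asg \<rho>" using assms vals_ne by (auto simp: ok_asg_def \<rho>_def some_in_eq)
  moreover have "F (e 0) (e 1) = sat M (asg e c \<rho>) (FunAt 0 0 1)" for e :: "nat \<Rightarrow> 'a" and c
    by (simp add: asg_def \<rho>_def)
  ultimately show ?thesis unfolding DD_def
    by (intro exI[of _ "FunAt 0 0 1"] exI[of _ \<rho>]) simp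
qed

definition varr :: "sort \<Rightarrow> nat \<Rightarrow> nat + 'a val" where
  "varr = (\<lambda>s i. if s = Obj \<or> s = Pred 1 then Inl i else Inr (SOME v. v \<in> vals M s))"

lemma ok_asg_varr: "ok_asg varr"
  using vals_ne by (auto simp: ok_asg_def varr_def some_in_eq)

lemma DD_varr: "formula k p \<Longrightarrow> DD (\<lambda>e c. sat M (asg e c varr) p)"
  unfolding DD_def using ok_asg_varr by blast

lemma asg_varr: "asg e c varr Obj i = VO (e i)" "asg e c varr (Pred 1) i = VP (emb (c i))"
  by (simp_all add: asg_def varr_def)

sublocale definability DD
proof
  show "DD (\<lambda>e c. \<not> Q e c)" if Q: "DD Q" for Q
  proof -
    obtain p \<rho> where p: "formula k p" "ok_asg \<rho>" "\<And>e c. Q e c = sat M (asg e c \<rho>) p"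
      using Q unfolding DD_def by blast
    show ?thesis unfolding DD_def
      by (intro exI[of _ "\<^bold>\<not> p"] exI[of _ \<rho>]) (simp add: p)
  qed
  show "DD (\<lambda>e c. P e c \<longrightarrow> Q e c)" if P: "DD P" and Q: "DD Q" for P Q
  proof -
    obtain p \<rho> where p: "formula k p" "ok_asg \<rho>" "\<And>e c. P e c = sat M (asg e c \<rho>) p"
      using P unfolding DD_def by blast
    obtain q \<sigma> where q: "formula k q" "ok_asg \<sigma>" "\<And>e c. Q e c = sat M (asg e c \<sigma>) q"
      using Q unfolding DD_def by blast
    show ?thesis unfolding DD_def
      by (intro exI[of _ "ren (\<lambda>s i. 2 * i) p \<^bold>\<rightarrow> ren (\<lambda>s i. 2 * i + 1) q"] exI[of _ "merge \<rho> \<sigma>"])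
        (simp only: formula.simps formula_ren p q ok_asg_merge sat.simps sat_merge simp_thms)
  qed
  show "DD (\<lambda>e c. \<forall>x. Q' e x c)" if Q: "DD (\<lambda>e c. Q' (\<lambda>i. e (Suc i)) (e 0) c)" for Q'
  proof -
    obtain p \<rho> where p: "formula k p" "ok_asg \<rho>"
      "\<And>e c. Q' (\<lambda>i. e (Suc i)) (e 0) c = sat M (asg e c \<rho>) p"
      using Q unfolding DD_def by blast
    have "Q' e x c = sat M (asg (case_nat x e) c \<rho>) p" for e x c
      using p(3)[of "case_nat x e" c] by simp
    then have "(\<forall>x. Q' e x c) = sat M (asg e c (bind Obj \<rho>)) (All Obj (ren (bindr Obj \<rho>) p))" for e c
      by (simp add: dom_M sat_bind_Obj)
    moreover have "formula k (All Obj (ren (bindr Obj \<rho>) p))" using p(1) by simp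
    ultimately show ?thesis unfolding DD_def using ok_asg_bind[OF p(2)] by blast
  qed
  show "DD (\<lambda>e c. \<forall>P. DD (\<lambda>e c. P (e 0)) \<longrightarrow> Q e c P)"
    if Q: "DD (\<lambda>e c. Q e (\<lambda>i. c (Suc i)) (c 0))" for Q
  proof -
    obtain p \<rho> where p: "formula k p" "ok_asg \<rho>"
      "\<And>e c. Q e (\<lambda>i. c (Suc i)) (c 0) = sat M (asg e c \<rho>) p"
      using Q unfolding DD_def by blast
    have eq: "Q e c P = sat M (asg e (case_nat P c) \<rho>) p" for e c P
      using p(3)[of e "case_nat P c"] by simp
    have "(\<forall>P. DD (\<lambda>e c. P (e 0)) \<longrightarrow> Q e c P) =
        sat M (asg e c (bind (Pred 1) \<rho>)) (All (Pred 1) (ren (bindr (Pred 1) \<rho>) p))" for e c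
    proof -
      have "(\<forall>P. DD (\<lambda>e c. P (e 0)) \<longrightarrow> Q e c P) \<longleftrightarrow> (\<forall>P. emb P \<in> rels M 1 \<longrightarrow> Q e c P)"
        using DD_class DD_comprehension by blast
      also have "\<dots> \<longleftrightarrow> (\<forall>R\<in>rels M 1. Q e c (\<lambda>x. R [x]))"
        by (rule Ball_emb)
      also have "\<dots> \<longleftrightarrow> (\<forall>R\<in>rels M 1. sat M (asg e (case_nat (\<lambda>x. R [x]) c) \<rho>) p)"
        by (simp add: eq)
      also have "\<dots> \<longleftrightarrow> (\<forall>R\<in>rels M 1. sat M (push (Pred 1) (VP R) (asg e c (bind (Pred 1) \<rho>)))
          (ren (bindr (Pred 1) \<rho>) p))"
      proof (rule ball_cong[OF refl])
        fix R assume "R \<in> rels M 1"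
        from sat_bind_Pred[of "\<lambda>x. R [x]" e c \<rho> p, folded emb_hd[OF this]]
        show "sat M (asg e (case_nat (\<lambda>x. R [x]) c) \<rho>) p =
          sat M (push (Pred 1) (VP R) (asg e c (bind (Pred 1) \<rho>))) (ren (bindr (Pred 1) \<rho>) p)"
          by simp
      qed
      also have "\<dots> \<longleftrightarrow> sat M (asg e c (bind (Pred 1) \<rho>)) (All (Pred 1) (ren (bindr (Pred 1) \<rho>) p))"
        by simp
      finally show ?thesis .
    qed
    moreover have "formula k (All (Pred 1) (ren (bindr (Pred 1) \<rho>) p))" using p(1) by simp
    ultimately show ?thesis unfolding DD_def using ok_asg_bind[OF p(2)] by blast
  qed
  show "DD (\<lambda>e c. e 0 = e 1)"
    using DD_varr[of "0 \<^bold>= 1"] by (simp add: asg_varr)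
  show "DD (\<lambda>e c. c i (e 0))" for i
    using DD_varr[of "RelAt i [0]"] asg_varr(2) by (simp add: asg_varr(1))
  show "DD (\<lambda>e c. Q (\<lambda>i. t i e) c)" if Q: "DD Q" and t: "\<And>i. atom (t i)" for Q and t :: "nat \<Rightarrow> (nat \<Rightarrow> 'a) \<Rightarrow> 'a"
  proof -
    obtain p \<rho> where p: "formula k p" "ok_asg \<rho>" "\<And>e c. Q e c = sat M (asg e c \<rho>) p"
      using Q unfolding DD_def by blast
    define f where "f j = (if \<exists>i. t j = (\<lambda>e. e i) then Inl (SOME i. t j = (\<lambda>e. e i))
      else Inr (VO (SOME a. t j = (\<lambda>e. a))))" for j
    have f: "(case f j of Inl i \<Rightarrow> VO (e i) | Inr v \<Rightarrow> v) = VO (t j e)" for j e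
    proof (cases "\<exists>i. t j = (\<lambda>e. e i)")
      case True
      then have "t j = (\<lambda>e. e (SOME i. t j = (\<lambda>e. e i)))" by (rule someI_ex)
      then have "t j e = e (SOME i. t j = (\<lambda>e. e i))" by (rule fun_cong)
      then show ?thesis using True by (simp add: f_def)
    next
      case False
      then have "\<exists>a. t j = (\<lambda>e. a)" using t[of j] by (simp add: atom_def)
      then have "t j = (\<lambda>e. (SOME a. t j = (\<lambda>e. a)))" by (rule someI_ex)
      then have "t j e = (SOME a. t j = (\<lambda>e. a))" by (rule fun_cong)
      then show ?thesis using False by (simp add: f_def)
    qed
    define \<sigma> where "\<sigma> = \<rho>(Obj := \<lambda>i. case \<rho> Obj i of Inl j \<Rightarrow> f j | Inr v \<Rightarrow> Inr v)"
    have "v \<in> vals M Obj" if "\<rho> Obj i = Inr v" for i v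
      using p(2) that unfolding ok_asg_def by (metis (no_types, lifting) sum.simps(6))
    then have "ok_asg \<sigma>"
      using p(2) by (auto simp: ok_asg_def \<sigma>_def f_def dom_M split: sum.splits)
    moreover have "asg (\<lambda>i. t i e) c \<rho> = asg e c \<sigma>" for e c
    proof -
      have "f j = Inl i \<Longrightarrow> t j e = e i" "f j = Inr v \<Longrightarrow> VO (t j e) = v" for i j v
        using f[of e j] by simp_all
      then show ?thesis by (auto simp: fun_eq_iff asg_def \<sigma>_def split: sum.splits)
    qed
    ultimately show ?thesis unfolding DD_def using p(1,3) by auto
  qed
qed

text \<open>
  Comprehension in one direction, parameters in the other: in a general model the definable classes
  are exactly those over which the quantifiers range.
\<close>

lemma Cl_rels: "Cl P \<longleftrightarrow> emb P \<in> rels M 1"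
  unfolding Cl_def using DD_class DD_comprehension by blast

lemma Ball_rels: "(\<forall>R\<in>rels M 1. Q (\<lambda>x. R [x])) \<longleftrightarrow> (\<forall>P. Cl P \<longrightarrow> Q P)"
  unfolding Cl_rels by (rule Ball_emb[symmetric])

lemma Fn_funs: "Fn F \<longleftrightarrow> F \<in> funs M"
proof -
  show ?thesis unfolding Fn_def using funs_functional DD_fun DD_comprehension_fun by blast
qed

end

section \<open>Pairs and the core\<close>

text \<open>
  The notions needed for the translations are defined once, from a guard \<open>g\<close> and a membership relation
  \<open>m\<close>.  For sets, \<open>g\<close> is always true and \<open>m\<close> is membership.  For functions, \<open>g\<close> singles out the identity
  functions, and the members of a function are its fixed points.
\<close>

locale guarded = definability D for D :: "'a scheme \<Rightarrow> bool" +
  fixes g :: "'a \<Rightarrow> bool" and m :: "'a \<Rightarrow> 'a \<Rightarrow> bool"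
  assumes D_g': "D (\<lambda>e c. g (e 0))"
    and D_m': "D (\<lambda>e c. m (e 0) (e 1))"
begin

definition zero :: "'a \<Rightarrow> bool" where
  "zero z \<longleftrightarrow> g z \<and> (\<forall>x. \<not> m x z)"

text \<open>\<open>t = {\<emptyset>, a, b}\<close>\<close>

definition tri :: "'a \<Rightarrow> 'a \<Rightarrow> 'a \<Rightarrow> bool" where
  "tri a b t \<longleftrightarrow> g t \<and> (\<forall>x. m x t \<longleftrightarrow> zero x \<or> x = a \<or> x = b)"

text \<open>
  \<open>w\<close> is the Kuratowski pair of \<open>{\<emptyset>, u}\<close> and \<open>{\<emptyset>, v}\<close> with \<open>\<emptyset>\<close> thrown in at each stage.  Passing from \<open>u\<close> to
  \<open>{\<emptyset>, u}\<close> makes the components nonempty, so that the added \<open>\<emptyset>\<close> cannot be confused with them.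
\<close>

definition par :: "'a \<Rightarrow> 'a \<Rightarrow> 'a \<Rightarrow> bool" where
  "par u v w \<longleftrightarrow>
     (\<exists>a b c d. tri u u a \<and> tri v v b \<and> tri a a c \<and> tri a b d \<and> tri c d w)"

text \<open>The sets that are not the graph of a partial function.\<close>

definition wild :: "'a \<Rightarrow> bool" where
  "wild x \<longleftrightarrow> (\<exists>z. m z x \<and> \<not> (\<exists>u v. par u v z)) \<or>
     (\<exists>u v w z z'. par u v z \<and> par u w z' \<and> m z x \<and> m z' x \<and> v \<noteq> w)"

text \<open>
  \<open>x = {(u, u) | u \<in> y}\<close>, the graph of the identity on \<open>y\<close>.
\<close>

definition diag :: "'a \<Rightarrow> 'a \<Rightarrow> bool" where
  "diag y x \<longleftrightarrow> (\<forall>z. m z x \<longleftrightarrow> (\<exists>u. m u y \<and> par u u z))"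

definition core :: "'a \<Rightarrow> bool" where
  "core x \<longleftrightarrow> (\<forall>P. Cl P \<longrightarrow>
     (\<forall>x. g x \<and> wild x \<longrightarrow> P x) \<and> (\<forall>y x. P y \<and> g x \<and> diag y x \<longrightarrow> P x) \<longrightarrow> P x)"

lemmas D_g = D_rel1[OF D_g']
lemmas D_m = D_rel2[OF D_m']

lemma D_zero: "atom t \<Longrightarrow> D (\<lambda>e c. zero (t e))"
  unfolding zero_def by (intro atom_shift D_intros D_g D_m)

lemma D_tri: "atom t \<Longrightarrow> atom s \<Longrightarrow> atom u \<Longrightarrow> D (\<lambda>e c. tri (t e) (s e) (u e))"
  unfolding tri_def by (intro atom_shift D_intros D_g D_m D_zero)

lemma D_par: "atom t \<Longrightarrow> atom s \<Longrightarrow> atom u \<Longrightarrow> D (\<lambda>e c. par (t e) (s e) (u e))"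
  unfolding par_def by (intro atom_shift D_intros D_tri)

lemma D_wild: "atom t \<Longrightarrow> D (\<lambda>e c. wild (t e))"
  unfolding wild_def by (intro atom_shift D_intros D_par D_m)

lemma D_diag: "atom t \<Longrightarrow> atom s \<Longrightarrow> D (\<lambda>e c. diag (t e) (s e))"
  unfolding diag_def by (intro atom_shift D_intros D_par D_m)

lemma D_core: "atom t \<Longrightarrow> D (\<lambda>e c. core (t e))"
  unfolding core_def by (intro atom_shift D_intros D_diag D_wild D_g)

lemmas gm_intros = D_g D_m D_zero D_tri D_par D_wild D_diag D_core

lemma core_wild: "g x \<Longrightarrow> wild x \<Longrightarrow> core x"
  by (auto simp: core_def)

lemma core_diag: "core y \<Longrightarrow> g x \<Longrightarrow> diag y x \<Longrightarrow> core x"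
  unfolding core_def by blast

lemma core_induct:
  assumes "core x" "Cl P" "\<And>x. g x \<Longrightarrow> wild x \<Longrightarrow> P x"
    "\<And>y x. P y \<Longrightarrow> g x \<Longrightarrow> diag y x \<Longrightarrow> P x"
  shows "P x"
  using assms unfolding core_def by blast

lemma core_cases:
  assumes "core x"
  shows "g x \<and> (wild x \<or> (\<exists>y. core y \<and> diag y x))"
proof -
  let ?P = "\<lambda>x. core x \<and> g x \<and> (wild x \<or> (\<exists>y. core y \<and> diag y x))"
  have "Cl ?P" by (rule ClI) (intro D_intros gm_intros)
  from core_induct[OF assms this] show ?thesis
    using core_wild core_diag by blast
qed

end

locale setlike = guarded +
  assumes ext: "g x \<Longrightarrow> g y \<Longrightarrow> (\<And>z. m z x \<longleftrightarrow> m z y) \<Longrightarrow> x = y"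
    and ex_zero: "\<exists>z. zero z"
    and ex_tri: "\<exists>t. tri a b t"
begin

definition Z :: 'a where "Z = (THE z. zero z)"
definition T :: "'a \<Rightarrow> 'a \<Rightarrow> 'a" where "T a b = (THE t. tri a b t)"
definition pr :: "'a \<Rightarrow> 'a \<Rightarrow> 'a" where
  "pr u v = T (T (T u u) (T u u)) (T (T u u) (T v v))"

lemma zero_iff: "zero z \<longleftrightarrow> z = Z"
proof -
  have u: "zero x \<Longrightarrow> zero y \<Longrightarrow> x = y" for x y
    by (rule ext) (auto simp: zero_def)
  obtain z0 where z0: "zero z0" using ex_zero ..
  then have "Z = z0" unfolding Z_def by (rule the_equality) (use u z0 in blast)
  then show ?thesis using u z0 by blast
qed

lemma tri_iff: "tri a b t \<longleftrightarrow> t = T a b"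
proof -
  have u: "tri a b x \<Longrightarrow> tri a b y \<Longrightarrow> x = y" for x y
    by (rule ext) (auto simp: tri_def)
  obtain t0 where t0: "tri a b t0" using ex_tri ..
  then have "T a b = t0" unfolding T_def by (rule the_equality) (use u t0 in blast)
  then show ?thesis using u t0 by blast
qed

lemma par_iff: "par u v w \<longleftrightarrow> w = pr u v"
  by (simp add: par_def tri_iff pr_def)

lemma g_Z: "g Z" and m_Z [simp]: "\<not> m x Z"
  using zero_iff[of Z] by (auto simp: zero_def)

lemma g_T: "g (T a b)" and m_T [simp]: "m x (T a b) \<longleftrightarrow> x = Z \<or> x = a \<or> x = b"
  using tri_iff[of a b "T a b"] by (auto simp: tri_def zero_iff)

lemma T_neq_Z [simp]: "T a b \<noteq> Z" "Z \<noteq> T a b"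
  using m_Z[of Z] m_T[of Z a b] by metis+

lemma pr_neq_Z [simp]: "pr u v \<noteq> Z" "Z \<noteq> pr u v"
  by (auto simp: pr_def)

text \<open>
  Since \<open>\<emptyset>\<close> is a member of both sides anyway, only nonempty entries can be read off.
\<close>

lemma T_inj: assumes "T a b = T c d" "a \<noteq> Z" "b \<noteq> Z" "c \<noteq> Z" "d \<noteq> Z"
  shows "a = c \<and> b = d \<or> a = d \<and> b = c"
proof -
  have "x = a \<or> x = b \<longleftrightarrow> x = c \<or> x = d" if "x \<noteq> Z" for x
    using assms(1) m_T[of x a b] m_T[of x c d] that by simp
  then show ?thesis using assms(2-) by metis
qed

lemma T_self_inj: "T u u = T v v \<Longrightarrow> u = v"
  using m_T[of u u u] m_T[of u v v] m_T[of v u u] m_T[of v v v] by auto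

lemma pr_inj: "pr u v = pr u' v' \<longleftrightarrow> u = u' \<and> v = v'"
proof
  assume "pr u v = pr u' v'"
  then have 1: "T (T u u) (T u u) = T (T u' u') (T u' u') \<and> T (T u u) (T v v) = T (T u' u') (T v' v') \<or>
      T (T u u) (T u u) = T (T u' u') (T v' v') \<and> T (T u u) (T v v) = T (T u' u') (T u' u')"
    unfolding pr_def by (rule T_inj) simp_all
  then show "u = u' \<and> v = v'"
  proof
    assume a: "T (T u u) (T u u) = T (T u' u') (T u' u') \<and> T (T u u) (T v v) = T (T u' u') (T v' v')"
    then have u: "u = u'" using T_self_inj by blast
    have "T u u = T u' u' \<and> T v v = T v' v' \<or> T u u = T v' v' \<and> T v v = T u' u'"
      by (rule T_inj) (use a in simp_all)
    then show ?thesis using u T_self_inj by blast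
  next
    assume a: "T (T u u) (T u u) = T (T u' u') (T v' v') \<and> T (T u u) (T v v) = T (T u' u') (T u' u')"
    have "T u u = T u' u' \<and> T u u = T v' v' \<or> T u u = T v' v' \<and> T u u = T u' u'"
      by (rule T_inj) (use a in simp_all)
    moreover have "T u u = T u' u' \<and> T v v = T u' u' \<or> T u u = T u' u' \<and> T v v = T u' u'"
      by (rule T_inj) (use a in simp_all)
    ultimately show ?thesis using T_self_inj by blast
  qed
qed simp

lemma wild_iff: "wild x \<longleftrightarrow> (\<exists>z. m z x \<and> (\<forall>u v. z \<noteq> pr u v)) \<or>
    (\<exists>u v w. m (pr u v) x \<and> m (pr u w) x \<and> v \<noteq> w)"
  by (auto simp: wild_def par_iff)

lemma diag_iff: "diag y x \<longleftrightarrow> (\<forall>z. m z x \<longleftrightarrow> (\<exists>u. m u y \<and> z = pr u u))"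
  by (simp add: diag_def par_iff)

lemma wild_Z: "m Z x \<Longrightarrow> wild x"
  by (auto simp: wild_iff)

lemma core_T: "core (T a b)"
  by (rule core_wild[OF g_T]) (simp add: wild_Z)

text \<open>
  The empty set is its own diagonal, but a least class does not get into it that way.
\<close>

lemma not_core_Z: "\<not> core Z"
proof
  assume "core Z"
  moreover have "Cl (\<lambda>x. \<exists>z. m z x)" by (rule ClI) (intro D_intros gm_intros)
  ultimately have "\<exists>z. m z Z"
    by (rule core_induct) (auto simp: wild_iff diag_iff)
  then show False by simp
qed

lemma D_eq_pr: "atom t \<Longrightarrow> atom s \<Longrightarrow> atom u \<Longrightarrow> D (\<lambda>e c. t e = pr (s e) (u e))"
  using D_par[of s u t] by (simp add: par_iff)

lemma D_m_pr: "atom t \<Longrightarrow> atom s \<Longrightarrow> atom u \<Longrightarrow> D (\<lambda>e c. m (pr (s e) (u e)) (t e))"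
proof -
  assume "atom t" "atom s" "atom u"
  then have "D (\<lambda>e c. \<exists>z. z = pr (s e) (u e) \<and> m z (t e))"
    by (intro atom_shift D_intros D_eq_pr gm_intros)
  then show ?thesis by simp
qed

end

definition idf :: "('a \<Rightarrow> 'a \<Rightarrow> 'a \<Rightarrow> bool) \<Rightarrow> 'a \<Rightarrow> bool" where
  "idf app f \<longleftrightarrow> (\<forall>x y. app f x y \<longrightarrow> x = y)"

text \<open>
  Sets and functions on the same objects.  Each of the two contexts below assumes that one primitive is
  defined from the other and shows that pairs and core agree, whence the reverse definition.
\<close>

locale linked = V: setlike D "\<lambda>_. True" mem + F: setlike D "idf app" "\<lambda>x y. app y x x"
  for D :: "'a scheme \<Rightarrow> bool" and mem app +
  assumes ex_set: "\<exists>y. \<forall>z. mem z y \<longleftrightarrow> app f z z"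
    and ex_idf: "\<exists>f. idf app f \<and> (\<forall>z. app f z z \<longleftrightarrow> mem z x)"
    and app_ext: "(\<And>x y. app f x y \<longleftrightarrow> app h x y) \<Longrightarrow> f = h"
begin

lemma pr_eqI:
  assumes "F.Z = V.Z" and "\<And>a b. F.T a b = V.T a b"
  shows "F.pr = V.pr"
  using assms by (simp add: F.pr_def V.pr_def fun_eq_iff)

context
  assumes app: "\<And>f x y. app f x y \<longleftrightarrow>
    V.core f \<and> mem x f \<and> x = y \<or> \<not> V.core f \<and> mem (V.pr x y) f"
begin

lemma V_core_app: "V.core f \<Longrightarrow> app f x y \<longleftrightarrow> mem x f \<and> x = y"
  by (simp add: app)

lemma F_T_eq: "F.Z = V.Z" "F.T a b = V.T a b"
proof -
  have "F.zero V.Z"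
    unfolding F.zero_def idf_def using V.not_core_Z by (simp add: app)
  then show Z: "F.Z = V.Z" by (simp only: F.zero_iff)
  have "F.tri a b (V.T a b)"
    unfolding F.tri_def F.zero_iff Z idf_def using V.core_T[of a b] by (simp add: V_core_app)
  then show "F.T a b = V.T a b" by (simp only: F.tri_iff)
qed

lemma F_pr_eq: "F.pr = V.pr"
  by (rule pr_eqI) (simp_all add: F_T_eq)

text \<open>
  Core sets act as identity functions on themselves, so the closure conditions of the core of sets
  carry over to functions.  Conversely, the fixed points of an identity function that enters the core of
  functions form a set; this set enters the core of sets and acts like the given function, hence
  equals it.
\<close>

lemma core_from_V: "F.core = V.core"
proof (rule ext, rule iffI)
  fix x assume "V.core x"
  moreover have "V.Cl (\<lambda>x. V.core x \<and> F.core x)"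
    by (rule V.ClI) (intro V.D_intros V.gm_intros F.gm_intros)
  ultimately have "V.core x \<and> F.core x"
  proof (rule V.core_induct)
    fix x assume w: "V.wild x"
    then have c: "V.core x" using V.core_wild by simp
    have "F.wild x" "idf app x"
      using w by (simp_all add: F.wild_iff V.wild_iff V_core_app[OF c] F_pr_eq idf_def)
    then show "V.core x \<and> F.core x" using c F.core_wild by simp
  next
    fix y x assume y: "V.core y \<and> F.core y" and d: "V.diag y x"
    then have c: "V.core x" using y V.core_diag by blast
    have "F.diag y x" "idf app x"
      using d y by (simp_all add: F.diag_iff V.diag_iff V_core_app[OF c] V_core_app F_pr_eq idf_def)
    then show "V.core x \<and> F.core x" using c y F.core_diag by blast
  qed
  then show "F.core x" ..
next
  fix x assume "F.core x"
  moreover have "V.Cl V.core"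
    by (rule V.ClI) (intro V.D_intros V.gm_intros F.gm_intros)
  ultimately show "V.core x"
  proof (rule F.core_induct)
    fix x assume i: "idf app x" and w: "F.wild x"
    obtain y where y: "\<And>z. mem z y \<longleftrightarrow> app x z z" using ex_set by blast
    have "V.wild y" using w by (simp add: F.wild_iff V.wild_iff y F_pr_eq)
    then have "V.core y" using V.core_wild by simp
    moreover from this have "x = y"
      by (intro app_ext) (use i in \<open>auto simp: idf_def V_core_app y\<close>)
    ultimately show "V.core x" by simp
  next
    fix y x assume c: "V.core y" and i: "idf app x" and d: "F.diag y x"
    obtain x' where x': "\<And>z. mem z x' \<longleftrightarrow> app x z z" using ex_set by blast
    have "V.diag y x'" using d c by (simp add: F.diag_iff V.diag_iff x' F_pr_eq V_core_app)
    then have "V.core x'" using V.core_diag c by blast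
    moreover from this have "x = x'"
      by (intro app_ext) (use i in \<open>auto simp: idf_def V_core_app x'\<close>)
    ultimately show "V.core x" by simp
  qed
qed

lemma mem_from_V:
  "mem x f \<longleftrightarrow> F.core f \<and> app f x x \<or> \<not> F.core f \<and> (\<exists>u v. F.par u v x \<and> app f u v)"
proof (cases "V.core f")
  case True
  then show ?thesis unfolding core_from_V using V_core_app[OF True] by simp
next
  case False
  then have "\<not> V.wild f" using V.core_wild by auto
  then have "mem x f \<longrightarrow> (\<exists>u v. x = V.pr u v)" by (auto simp: V.wild_iff)
  moreover have "app f u v \<longleftrightarrow> mem (V.pr u v) f" for u v using False app[of f u v] by simp
  ultimately show ?thesis unfolding core_from_V F.par_iff F_pr_eq using False by auto
qed

end

context
  assumes mem: "\<And>x f. mem x f \<longleftrightarrow>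
    F.core f \<and> app f x x \<or> \<not> F.core f \<and> (\<exists>u v. x = F.pr u v \<and> app f u v)"
begin

lemma F_core_mem: "F.core f \<Longrightarrow> mem x f \<longleftrightarrow> app f x x"
  by (simp add: mem)

lemma V_T_eq: "F.Z = V.Z" "F.T a b = V.T a b"
proof -
  have "\<not> app F.Z u v" for u v
  proof
    assume a: "app F.Z u v"
    with F.g_Z have "u = v" unfolding idf_def by blast
    with a F.m_Z[of u] show False by simp
  qed
  then have "V.zero F.Z"
    unfolding V.zero_def using F.not_core_Z mem[of _ F.Z] by blast
  then show Z: "F.Z = V.Z" by (simp only: V.zero_iff)
  have "V.tri a b (F.T a b)"
    unfolding V.tri_def V.zero_iff
    using F.core_T[of a b] F_core_mem[of "F.T a b"] F.m_T[of _ a b] Z by simp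
  then show "F.T a b = V.T a b" by (simp only: V.tri_iff)
qed

lemma V_pr_eq: "V.pr = F.pr"
  by (rule pr_eqI[symmetric]) (simp_all add: V_T_eq)

text \<open>
  As in \<open>core_from_V\<close>, with extensionality of sets in place of that of functions.
\<close>

lemma core_from_F: "V.core = F.core"
proof (rule ext, rule iffI)
  fix x assume "F.core x"
  moreover have "V.Cl (\<lambda>x. F.core x \<and> V.core x)"
    by (rule V.ClI) (intro V.D_intros V.gm_intros F.gm_intros)
  ultimately have "F.core x \<and> V.core x"
  proof (rule F.core_induct)
    fix x assume i: "idf app x" and w: "F.wild x"
    then have c: "F.core x" using F.core_wild by simp
    have "V.wild x"
      using w by (simp add: F.wild_iff V.wild_iff F_core_mem[OF c] V_pr_eq)
    then show "F.core x \<and> V.core x" using c V.core_wild by simp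
  next
    fix y x assume y: "F.core y \<and> V.core y" and i: "idf app x" and d: "F.diag y x"
    then have c: "F.core x" using F.core_diag by blast
    have "V.diag y x"
      using d y by (simp add: F.diag_iff V.diag_iff F_core_mem[OF c] F_core_mem V_pr_eq)
    then show "F.core x \<and> V.core x" using c y V.core_diag by blast
  qed
  then show "V.core x" ..
next
  fix x assume "V.core x"
  moreover have "V.Cl F.core"
    by (rule V.ClI) (intro V.D_intros V.gm_intros F.gm_intros)
  ultimately show "F.core x"
  proof (rule V.core_induct)
    fix x assume w: "V.wild x"
    obtain y where y: "idf app y" "\<And>z. app y z z \<longleftrightarrow> mem z x" using ex_idf by blast
    have "F.wild y" using w by (simp add: F.wild_iff V.wild_iff y V_pr_eq)
    then have "F.core y" using F.core_wild y by simp
    moreover from this have "y = x"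
      by (intro V.ext) (use F_core_mem[of y] y(2) in blast)+
    ultimately show "F.core x" by simp
  next
    fix y x assume c: "F.core y" and d: "V.diag y x"
    obtain x' where x': "idf app x'" "\<And>z. app x' z z \<longleftrightarrow> mem z x" using ex_idf by blast
    have "F.diag y x'" using d c by (simp add: F.diag_iff V.diag_iff x' V_pr_eq F_core_mem)
    then have "F.core x'" using F.core_diag c x' by blast
    moreover from this have "x' = x"
      by (intro V.ext) (use F_core_mem[of x'] x'(2) in blast)+
    ultimately show "F.core x" by simp
  qed
qed

lemma app_from_F:
  assumes i: "\<And>f. F.core f \<Longrightarrow> idf app f"
  shows "app f x y \<longleftrightarrow> V.core f \<and> mem x f \<and> x = y \<or> \<not> V.core f \<and> (\<exists>z. V.par x y z \<and> mem z f)"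
proof (cases "F.core f")
  case True
  then show ?thesis
    unfolding core_from_F using i[OF True] F_core_mem[OF True] by (auto simp: idf_def)
next
  case False
  then have "mem (F.pr x y) f \<longleftrightarrow> app f x y"
    using mem[of "F.pr x y" f] by (simp add: F.pr_inj)
  then show ?thesis unfolding core_from_F V.par_iff V_pr_eq using False by simp
qed

end

end

section \<open>Function levels\<close>

subsection \<open>Histories and fevels\<close>

locale application = definability D for D :: "'a scheme \<Rightarrow> bool" +
  fixes app :: "'a \<Rightarrow> 'a \<Rightarrow> 'a \<Rightarrow> bool"
  assumes D_app': "D (\<lambda>e c. app (e 0) (e 1) (e 2))"
begin

definition defined :: "'a \<Rightarrow> 'a \<Rightarrow> bool" where
  "defined f x \<longleftrightarrow> (\<exists>y. app f x y)"

definition inn :: "'a \<Rightarrow> 'a \<Rightarrow> bool" (infix \<open>\<triangleleft>\<close> 50) where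
  "g \<triangleleft> f \<longleftrightarrow> defined f g \<or> (\<exists>y. app f y g)"

definition sub :: "'a \<Rightarrow> 'a \<Rightarrow> bool" (infix \<open>\<preceq>\<close> 50) where
  "g \<preceq> f \<longleftrightarrow> (\<forall>x. x \<triangleleft> g \<longrightarrow> x \<triangleleft> f)"

definition ident :: "'a \<Rightarrow> ('a \<Rightarrow> bool) \<Rightarrow> bool" where
  "ident e P \<longleftrightarrow> (\<forall>v. (P v \<longrightarrow> app e v v) \<and> (\<not> P v \<longrightarrow> \<not> defined e v))"

definition isPi :: "'a \<Rightarrow> 'a \<Rightarrow> bool" where
  "isPi a f \<longleftrightarrow> ident a (\<lambda>x. \<exists>g. g \<triangleleft> f \<and> x \<preceq> g)"

definition fist :: "'a \<Rightarrow> bool" where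
  "fist h \<longleftrightarrow> (\<forall>x. x \<triangleleft> h \<longrightarrow> (\<exists>e. ident e (\<lambda>z. z \<triangleleft> h \<and> z \<triangleleft> x) \<and> isPi x e))"

definition fev :: "'a \<Rightarrow> bool" where
  "fev s \<longleftrightarrow> (\<exists>h. fist h \<and> isPi s h)"

lemmas D_app = D_rel3[OF D_app']

lemma D_defined: "atom t \<Longrightarrow> atom s \<Longrightarrow> D (\<lambda>e c. defined (t e) (s e))"
  unfolding defined_def by (intro atom_shift D_intros D_app)

lemma D_inn: "atom t \<Longrightarrow> atom s \<Longrightarrow> D (\<lambda>e c. t e \<triangleleft> s e)"
  unfolding inn_def by (intro atom_shift D_intros D_app D_defined)

lemma D_sub: "atom t \<Longrightarrow> atom s \<Longrightarrow> D (\<lambda>e c. t e \<preceq> s e)"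
  unfolding sub_def by (intro atom_shift D_intros D_inn)

lemma D_isPi: "atom t \<Longrightarrow> atom s \<Longrightarrow> D (\<lambda>e c. isPi (t e) (s e))"
  unfolding isPi_def ident_def by (intro atom_shift D_intros D_inn D_sub D_app D_defined)

lemma D_fist: "atom t \<Longrightarrow> D (\<lambda>e c. fist (t e))"
  unfolding fist_def ident_def by (intro atom_shift D_intros D_inn D_isPi D_app D_defined)

lemma D_fev: "atom t \<Longrightarrow> D (\<lambda>e c. fev (t e))"
  unfolding fev_def by (intro atom_shift D_intros D_isPi D_fist)

lemma D_idf: "atom t \<Longrightarrow> D (\<lambda>e c. idf app (t e))"
  unfolding idf_def by (intro atom_shift D_intros D_app)

lemmas fl_intros = D_app D_defined D_inn D_sub D_isPi D_fist D_fev D_idf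

lemma Cl_inn: "Cl (\<lambda>x. x \<triangleleft> f)"
  by (rule ClI) (intro D_intros fl_intros)

lemma inn_defined: "app f x y \<Longrightarrow> x \<triangleleft> f" "app f x y \<Longrightarrow> y \<triangleleft> f"
  by (auto simp: inn_def defined_def)

lemma sub_refl: "x \<preceq> x" and sub_trans: "x \<preceq> y \<Longrightarrow> y \<preceq> z \<Longrightarrow> x \<preceq> z"
  by (auto simp: sub_def)

lemma subD: "x \<preceq> y \<Longrightarrow> z \<triangleleft> x \<Longrightarrow> z \<triangleleft> y"
  by (auto simp: sub_def)

end

text \<open>
  \<open>FLT_ZF\<close> without stratification; supercomprehension subsumes comprehension.
\<close>

locale function_universe = application +
  assumes functional: "app f x y \<Longrightarrow> app f x z \<Longrightarrow> y = z"
    and app_ext: "(\<And>x y. app f x y \<longleftrightarrow> app g x y) \<Longrightarrow> f = g"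
    and supercomp: "Fn F \<Longrightarrow> (\<And>x y. F x y \<Longrightarrow> x \<triangleleft> f) \<Longrightarrow> \<exists>h. \<forall>x y. app h x y \<longleftrightarrow> F x y"
    and infinity: "\<exists>s p. p \<triangleleft> s \<and> (\<forall>q. q \<triangleleft> s \<longrightarrow> (\<exists>r. q \<triangleleft> r \<and> r \<triangleleft> s))"
begin

lemma ident_app: "ident e P \<longleftrightarrow> (\<forall>x y. app e x y \<longleftrightarrow> P x \<and> x = y)"
  unfolding ident_def defined_def using functional by blast

lemma ident_inn: "ident e P \<Longrightarrow> x \<triangleleft> e \<longleftrightarrow> P x"
  by (auto simp: ident_app inn_def defined_def)

lemma ident_unique: "ident e P \<Longrightarrow> ident e' P \<Longrightarrow> e = e'"
  by (rule app_ext) (simp add: ident_app)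

lemma ex_ident: "Cl P \<Longrightarrow> (\<And>x. P x \<Longrightarrow> x \<triangleleft> f) \<Longrightarrow> \<exists>e. ident e P"
  unfolding ident_app
  by (rule supercomp[of "\<lambda>x y. P x \<and> x = y" f]) (auto intro!: FnI D_and D_eq D_Cl atom_var)

definition piOf :: "'a \<Rightarrow> ('a \<Rightarrow> bool) \<Rightarrow> bool" where
  "piOf a P \<longleftrightarrow> ident a (\<lambda>x. \<exists>g. P g \<and> x \<preceq> g)"

lemma isPi_piOf: "isPi a f \<longleftrightarrow> piOf a (\<lambda>g. g \<triangleleft> f)"
  by (simp add: isPi_def piOf_def)

lemma piOf_inn: "piOf a P \<Longrightarrow> x \<triangleleft> a \<longleftrightarrow> (\<exists>g. P g \<and> x \<preceq> g)"
  unfolding piOf_def by (rule ident_inn)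

lemma piOf_unique: "piOf a P \<Longrightarrow> piOf b P \<Longrightarrow> a = b"
  unfolding piOf_def by (rule ident_unique)

lemma piOf_cong: "(\<And>x. P x \<longleftrightarrow> Q x) \<Longrightarrow> piOf a P \<longleftrightarrow> piOf a Q"
  by (simp add: piOf_def)

text \<open>
  The subfunction of a history whose \<open>\<pi>\<close> is taken always exists, so it need not be mentioned.
\<close>

lemma fist_iff: "fist h \<longleftrightarrow> (\<forall>x. x \<triangleleft> h \<longrightarrow> piOf x (\<lambda>z. z \<triangleleft> h \<and> z \<triangleleft> x))"
proof -
  have "(\<exists>e. ident e (\<lambda>z. z \<triangleleft> h \<and> z \<triangleleft> x) \<and> isPi x e) \<longleftrightarrow> piOf x (\<lambda>z. z \<triangleleft> h \<and> z \<triangleleft> x)" for x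
  proof -
    have "Cl (\<lambda>z. z \<triangleleft> h \<and> z \<triangleleft> x)" by (rule ClI) (intro D_intros fl_intros)
    then obtain e where e: "ident e (\<lambda>z. z \<triangleleft> h \<and> z \<triangleleft> x)"
      using ex_ident[of "\<lambda>z. z \<triangleleft> h \<and> z \<triangleleft> x" h] by blast
    have "isPi x e \<longleftrightarrow> piOf x (\<lambda>z. z \<triangleleft> h \<and> z \<triangleleft> x)"
      unfolding isPi_piOf by (rule piOf_cong) (rule ident_inn[OF e])
    then show ?thesis using e ident_unique by metis
  qed
  then show ?thesis by (simp add: fist_def)
qed

lemma fist_inn: "fist h \<Longrightarrow> x \<triangleleft> h \<Longrightarrow> y \<triangleleft> x \<longleftrightarrow> (\<exists>z. z \<triangleleft> h \<and> z \<triangleleft> x \<and> y \<preceq> z)"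
  using piOf_inn[of x "\<lambda>z. z \<triangleleft> h \<and> z \<triangleleft> x" y] by (auto simp: fist_iff)

text \<open>
  Otherwise consider the identity \<open>r\<close> on the \<open>x\<close> that lie in every stage satisfying \<open>K\<close> but not in
  themselves.  Every such stage has a smaller one among its members, which includes \<open>r\<close>, so \<open>r\<close> lies in
  every such stage; then \<open>r\<close> lies in itself iff it does not.
\<close>

lemma fist_wf:
  assumes h: "fist h" and K: "Cl K" and a: "K a" "a \<triangleleft> h"
  shows "\<exists>k. K k \<and> k \<triangleleft> h \<and> (\<forall>j. K j \<and> j \<triangleleft> h \<longrightarrow> \<not> j \<triangleleft> k)"
proof (rule ccontr)
  assume n: "\<not> ?thesis"
  let ?P = "\<lambda>x. \<not> x \<triangleleft> x \<and> (\<forall>k. K k \<and> k \<triangleleft> h \<longrightarrow> x \<triangleleft> k)"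
  have "Cl ?P" by (rule ClI) (intro D_intros fl_intros D_Cl[OF K])
  then obtain r where r: "ident r ?P" using ex_ident[of ?P a] a by blast
  have "r \<triangleleft> k" if k: "K k" "k \<triangleleft> h" for k
  proof -
    obtain j where j: "K j" "j \<triangleleft> h" "j \<triangleleft> k" using n k by blast
    have "r \<preceq> j" unfolding sub_def ident_inn[OF r] using j by blast
    then show ?thesis using fist_inn[OF h k(2)] j by blast
  qed
  moreover have "r \<triangleleft> r \<longleftrightarrow> ?P r" by (rule ident_inn[OF r])
  ultimately show False by blast
qed

text \<open>
  In a minimal counterexample \<open>c\<close>, the stage \<open>d\<close> of \<open>c\<close> that includes \<open>x\<close> is transitive; so a stage
  \<open>w\<close> of \<open>d\<close> that includes \<open>y\<close> is itself included in \<open>d\<close>.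
\<close>

lemma fist_trans:
  assumes h: "fist h" and c: "c \<triangleleft> h" "x \<triangleleft> c" "y \<triangleleft> x"
  shows "y \<triangleleft> c"
proof (rule ccontr)
  let ?K = "\<lambda>c. \<exists>x y. x \<triangleleft> c \<and> y \<triangleleft> x \<and> \<not> y \<triangleleft> c"
  assume "\<not> y \<triangleleft> c"
  then have "?K c" using c by blast
  moreover have "Cl ?K" by (rule ClI) (intro D_intros fl_intros)
  ultimately obtain c where c: "?K c" "c \<triangleleft> h" and min: "\<And>j. ?K j \<Longrightarrow> j \<triangleleft> h \<Longrightarrow> \<not> j \<triangleleft> c"
    using fist_wf[OF h, of ?K c] \<open>c \<triangleleft> h\<close> by blast
  then obtain x y where xy: "x \<triangleleft> c" "y \<triangleleft> x" "\<not> y \<triangleleft> c" by blast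
  obtain d where d: "d \<triangleleft> h" "d \<triangleleft> c" "x \<preceq> d" using fist_inn[OF h c(2)] xy(1) by blast
  have "y \<triangleleft> d" using d xy subD by blast
  then obtain w where w: "w \<triangleleft> h" "w \<triangleleft> d" "y \<preceq> w" using fist_inn[OF h d(1)] by blast
  have "\<not> ?K d" using min d by blast
  then have "w \<preceq> d" using w(2) unfolding sub_def by blast
  then have "y \<preceq> d" using w(3) sub_trans by blast
  then have "y \<triangleleft> c" using fist_inn[OF h c(2)] d by blast
  then show False using xy by blast
qed

text \<open>
  The stages below \<open>c\<close> again form a history, because \<open>c\<close> is transitive.
\<close>

lemma fist_fev:
  assumes h: "fist h" and c: "c \<triangleleft> h"
  shows "fev c"
proof -
  have "Cl (\<lambda>z. z \<triangleleft> h \<and> z \<triangleleft> c)" by (rule ClI) (intro D_intros fl_intros)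
  then obtain e where e: "ident e (\<lambda>z. z \<triangleleft> h \<and> z \<triangleleft> c)"
    using ex_ident[of "\<lambda>z. z \<triangleleft> h \<and> z \<triangleleft> c" h] by blast
  have "isPi c e"
    unfolding isPi_piOf ident_inn[OF e] using h c by (simp add: fist_iff)
  moreover have "fist e"
    unfolding fist_iff
  proof (intro allI impI)
    fix x assume "x \<triangleleft> e"
    then have x: "x \<triangleleft> h" "x \<triangleleft> c" by (simp_all add: ident_inn[OF e])
    have "piOf x (\<lambda>z. z \<triangleleft> h \<and> z \<triangleleft> x)" using h x by (simp add: fist_iff)
    moreover have "z \<triangleleft> e \<and> z \<triangleleft> x \<longleftrightarrow> z \<triangleleft> h \<and> z \<triangleleft> x" for z
      using fist_trans[OF h c x(2)] by (auto simp: ident_inn[OF e])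
    ultimately show "piOf x (\<lambda>z. z \<triangleleft> e \<and> z \<triangleleft> x)" by simp
  qed
  ultimately show ?thesis by (auto simp: fev_def)
qed

lemma fev_potent: "fev s \<Longrightarrow> x \<preceq> c \<Longrightarrow> c \<triangleleft> s \<Longrightarrow> x \<triangleleft> s"
  unfolding fev_def isPi_piOf using piOf_inn sub_trans by blast

lemma fev_trans: "fev s \<Longrightarrow> x \<triangleleft> s \<Longrightarrow> y \<triangleleft> x \<Longrightarrow> y \<triangleleft> s"
proof -
  assume s: "fev s" and x: "x \<triangleleft> s" "y \<triangleleft> x"
  then obtain h where h: "fist h" "piOf s (\<lambda>g. g \<triangleleft> h)" by (auto simp: fev_def isPi_piOf)
  obtain c where c: "c \<triangleleft> h" "x \<preceq> c" using piOf_inn[OF h(2)] x by blast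
  then have "y \<triangleleft> c" using x subD by blast
  then obtain d where "d \<triangleleft> h" "y \<preceq> d" using fist_inn[OF h(1) c(1)] by blast
  then show ?thesis using piOf_inn[OF h(2)] by blast
qed

lemma fev_sub: "fev s \<Longrightarrow> x \<triangleleft> s \<Longrightarrow> x \<preceq> s"
  using fev_trans by (auto simp: sub_def)

lemma fev_inn: "fev s \<Longrightarrow> x \<triangleleft> s \<longleftrightarrow> (\<exists>g. fev g \<and> g \<triangleleft> s \<and> x \<preceq> g)"
proof
  assume s: "fev s" and x: "x \<triangleleft> s"
  then obtain h where h: "fist h" "piOf s (\<lambda>g. g \<triangleleft> h)" by (auto simp: fev_def isPi_piOf)
  obtain c where c: "c \<triangleleft> h" "x \<preceq> c" using piOf_inn[OF h(2)] x by blast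
  moreover have "c \<triangleleft> s" using piOf_inn[OF h(2)] c(1) sub_refl by blast
  ultimately show "\<exists>g. fev g \<and> g \<triangleleft> s \<and> x \<preceq> g" using fist_fev[OF h(1)] by blast
qed (use fev_potent in blast)

text \<open>
  A fevel is thus determined by the fevels in it, and the choice of a history for it is immaterial.
\<close>

lemma fev_piOf: "fev s \<Longrightarrow> piOf s (\<lambda>g. fev g \<and> g \<triangleleft> s)"
proof -
  assume s: "fev s"
  then obtain h where h: "piOf s (\<lambda>g. g \<triangleleft> h)" by (auto simp: fev_def isPi_piOf)
  have "(\<exists>g. g \<triangleleft> h \<and> x \<preceq> g) \<longleftrightarrow> (\<exists>g. (fev g \<and> g \<triangleleft> s) \<and> x \<preceq> g)" for x
    using fev_inn[OF s, of x] piOf_inn[OF h, of x] by simp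
  then show ?thesis using h by (simp add: piOf_def)
qed

lemma fev_ext: "fev s \<Longrightarrow> fev t \<Longrightarrow> (\<And>g. fev g \<Longrightarrow> g \<triangleleft> s \<longleftrightarrow> g \<triangleleft> t) \<Longrightarrow> s = t"
  using fev_piOf[of s] fev_piOf[of t] piOf_unique[of s "\<lambda>g. fev g \<and> g \<triangleleft> s" t]
    piOf_cong[of "\<lambda>g. fev g \<and> g \<triangleleft> s" "\<lambda>g. fev g \<and> g \<triangleleft> t" t] by blast

lemma fist_fevs:
  assumes e: "ident e K" and K: "\<And>x. K x \<Longrightarrow> fev x" "\<And>x y. K x \<Longrightarrow> fev y \<Longrightarrow> y \<triangleleft> x \<Longrightarrow> K y"
  shows "fist e"
  unfolding fist_iff ident_inn[OF e]
proof (intro allI impI)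
  fix x assume x: "K x"
  have "K z \<and> z \<triangleleft> x \<longleftrightarrow> fev z \<and> z \<triangleleft> x" for z using K x by blast
  then show "piOf x (\<lambda>z. K z \<and> z \<triangleleft> x)" using fev_piOf K(1)[OF x] by simp
qed

text \<open>The fevels in a given fevel form a history, so \<open>fist_wf\<close> applies.\<close>

lemma fev_wf:
  assumes K: "Cl K" and a: "K a" "fev a"
  shows "\<exists>k. K k \<and> fev k \<and> (\<forall>j. K j \<and> fev j \<longrightarrow> \<not> j \<triangleleft> k)"
proof (cases "\<exists>j. K j \<and> fev j \<and> j \<triangleleft> a")
  case True
  then obtain j where j: "K j" "fev j" "j \<triangleleft> a" by blast
  have "Cl (\<lambda>x. fev x \<and> x \<triangleleft> a)" by (rule ClI) (intro D_intros fl_intros)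
  then obtain e where e: "ident e (\<lambda>x. fev x \<and> x \<triangleleft> a)"
    using ex_ident[of "\<lambda>x. fev x \<and> x \<triangleleft> a" a] by blast
  have "fist e" by (rule fist_fevs[OF e]) (use fev_trans[OF a(2)] in auto)
  from fist_wf[OF this K j(1)] obtain k where k: "K k" "k \<triangleleft> e"
    "\<And>j. K j \<Longrightarrow> j \<triangleleft> e \<Longrightarrow> \<not> j \<triangleleft> k"
    using j by (auto simp: ident_inn[OF e])
  have "\<not> j \<triangleleft> k" if "K j" "fev j" for j
    using k that fev_trans[OF a(2)] by (auto simp: ident_inn[OF e])
  then show ?thesis using k by (auto simp: ident_inn[OF e])
qed (use a in blast)

text \<open>
  For a minimal \<open>s\<close> that is incomparable with some \<open>t\<close>, and then a minimal such \<open>t\<close>, the same fevels lie in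
  \<open>s\<close> and in \<open>t\<close>; so they are equal.
\<close>

lemma fev_linear:
  assumes "fev s" "fev t"
  shows "s \<triangleleft> t \<or> s = t \<or> t \<triangleleft> s"
proof (rule ccontr)
  define I where "I s t \<longleftrightarrow> \<not> (s \<triangleleft> t \<or> s = t \<or> t \<triangleleft> s)" for s t
  assume "\<not> ?thesis"
  then have "I s t" by (simp add: I_def)
  let ?K1 = "\<lambda>s. \<exists>t. fev t \<and> I s t"
  have "Cl ?K1" unfolding I_def by (rule ClI) (intro D_intros fl_intros)
  from fev_wf[OF this, of s] obtain s where s: "?K1 s" "fev s"
    and min1: "\<And>j. ?K1 j \<Longrightarrow> fev j \<Longrightarrow> \<not> j \<triangleleft> s"
    using assms \<open>I s t\<close> by blast
  then obtain t where t: "fev t" "I s t" by blast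
  have "Cl (\<lambda>t. I s t)" unfolding I_def by (rule ClI) (intro D_intros fl_intros)
  from fev_wf[OF this t(2,1)] obtain t where t: "I s t" "fev t"
    and min2: "\<And>j. I s j \<Longrightarrow> fev j \<Longrightarrow> \<not> j \<triangleleft> t" by blast
  have "s = t"
  proof (rule fev_ext[OF s(2) t(2)])
    fix g assume g: "fev g"
    show "g \<triangleleft> s \<longleftrightarrow> g \<triangleleft> t"
    proof
      assume "g \<triangleleft> s"
      then have "\<not> I g t" using min1 g t(2) by blast
      then show "g \<triangleleft> t" using \<open>g \<triangleleft> s\<close> t(1) fev_trans[OF s(2)] unfolding I_def by blast
    next
      assume "g \<triangleleft> t"
      then have "\<not> I s g" using min2 g by blast
      then show "g \<triangleleft> s" using \<open>g \<triangleleft> t\<close> t(1) fev_trans[OF t(2)] unfolding I_def by blast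
    qed
  qed
  then show False using t by (simp add: I_def)
qed

end

subsection \<open>Well-founded universes of functions\<close>

text \<open>
  The consequences of stratification that are used below and that can be verified for \<open>vapp\<close> without
  knowing any fevels.  They are equivalent to stratification, by \<open>strat\<close> and the sublocale declaration
  after it.
\<close>

locale founded_functions = function_universe +
  assumes induct: "Cl Q \<Longrightarrow> (\<And>f. (\<And>x. x \<triangleleft> f \<Longrightarrow> Q x) \<Longrightarrow> Q f) \<Longrightarrow> Q f"
    and power: "\<exists>b. \<forall>x. x \<preceq> a \<longrightarrow> x \<triangleleft> b"
    and hull: "\<exists>b. \<forall>x y. x \<triangleleft> a \<longrightarrow> y \<triangleleft> x \<longrightarrow> y \<triangleleft> b"
begin

definition small :: "('a \<Rightarrow> bool) \<Rightarrow> bool" where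
  "small A \<longleftrightarrow> (\<exists>f. \<forall>x. A x \<longrightarrow> x \<triangleleft> f)"

lemma small_inn: "small (\<lambda>x. x \<triangleleft> f)" and small_mono: "small A \<Longrightarrow> (\<And>x. B x \<Longrightarrow> A x) \<Longrightarrow> small B"
  by (auto simp: small_def)

lemma small_ident: "small A \<Longrightarrow> Cl A \<Longrightarrow> \<exists>e. ident e A"
  using ex_ident[of A] by (auto simp: small_def)

lemma small_image:
  assumes "small A" "Cl A" "Fn F"
  shows "small (\<lambda>y. \<exists>x. A x \<and> F x y)"
proof -
  obtain f where f: "\<And>x. A x \<Longrightarrow> x \<triangleleft> f" using assms(1) by (auto simp: small_def)
  have "Fn (\<lambda>x y. A x \<and> F x y)"
    by (rule FnI) (intro D_intros D_Cl[OF assms(2)] D_Fn[OF assms(3)], use FnD[OF assms(3)] in blast)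
  then obtain h where "\<And>x y. app h x y \<longleftrightarrow> A x \<and> F x y"
    using supercomp[of "\<lambda>x y. A x \<and> F x y" f] f by blast
  then show ?thesis unfolding small_def using inn_defined(2) by blast
qed

text \<open>
  Each \<open>R x\<close> is coded by the identity function on it; these codes form a small class, and \<open>hull\<close> bounds
  their members.
\<close>

lemma small_union:
  assumes "small A" "Cl A" "D (\<lambda>e c. R (e 0) (e 1))" "\<And>x. A x \<Longrightarrow> small (R x)"
  shows "small (\<lambda>y. \<exists>x. A x \<and> R x y)"
proof -
  have R: "atom t \<Longrightarrow> atom s \<Longrightarrow> D (\<lambda>e c. R (t e) (s e))" for t s by (rule D_rel2[OF assms(3)])
  have F: "Fn (\<lambda>x g. ident g (R x))"
    by (rule FnI) (unfold ident_app, intro D_intros fl_intros R, metis app_ext)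
  obtain b where b: "\<And>x g. A x \<Longrightarrow> ident g (R x) \<Longrightarrow> g \<triangleleft> b"
    using small_image[OF assms(1,2) F] by (auto simp: small_def)
  obtain b' where b': "\<And>x y. x \<triangleleft> b \<Longrightarrow> y \<triangleleft> x \<Longrightarrow> y \<triangleleft> b'" using hull by blast
  have "y \<triangleleft> b'" if x: "A x" and y: "R x y" for x y
  proof -
    have "Cl (R x)" by (rule ClI) (intro R atom_var atom_const)
    then obtain g where g: "ident g (R x)" using small_ident[OF assms(4)[OF x]] by blast
    then show ?thesis using b[OF x g] b' y by (auto simp: ident_inn[OF g])
  qed
  then show ?thesis unfolding small_def by blast
qed

lemma small_power: "small A \<Longrightarrow> small (\<lambda>x. \<forall>y. y \<triangleleft> x \<longrightarrow> A y)"
proof -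
  assume "small A"
  then obtain f where "\<And>x. A x \<Longrightarrow> x \<triangleleft> f" by (auto simp: small_def)
  moreover obtain b where "\<And>x. x \<preceq> f \<Longrightarrow> x \<triangleleft> b" using power by blast
  ultimately show ?thesis unfolding small_def sub_def by blast
qed

lemma not_refl: "\<not> x \<triangleleft> x"
proof -
  have "Cl (\<lambda>x. \<not> x \<triangleleft> x)" by (rule ClI) (intro D_intros fl_intros)
  then show ?thesis by (rule induct) blast
qed

text \<open>
  The infinite function supplies a small class with two elements, whose image is the pair.
\<close>

lemma small_pair: "small (\<lambda>x. x = a \<or> x = b)"
proof -
  obtain s p where "p \<triangleleft> s" "\<forall>q. q \<triangleleft> s \<longrightarrow> (\<exists>r. q \<triangleleft> r \<and> r \<triangleleft> s)" using infinity by blast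
  then obtain r where r: "p \<triangleleft> r" "r \<triangleleft> s" by blast
  then have "p \<noteq> r" using not_refl by blast
  have "Fn (\<lambda>x y. x = p \<and> y = a \<or> x = r \<and> y = b)"
    using \<open>p \<noteq> r\<close> by (intro FnI) (intro D_intros, blast)
  from small_image[OF small_inn Cl_inn this, of s] have "small (\<lambda>y. \<exists>x. x \<triangleleft> s \<and> (x = p \<and> y = a \<or> x = r \<and> y = b))" .
  then show ?thesis by (rule small_mono) (use \<open>p \<triangleleft> s\<close> r in blast)
qed

lemma small_Un: "small A \<Longrightarrow> small B \<Longrightarrow> Cl A \<Longrightarrow> Cl B \<Longrightarrow> small (\<lambda>x. A x \<or> B x)"
proof -
  assume *: "small A" "small B" "Cl A" "Cl B"
  then obtain e e' where e: "ident e A" "ident e' B" using small_ident by blast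
  have "small (\<lambda>y. \<exists>x. (x = e \<or> x = e') \<and> y \<triangleleft> x)"
    by (rule small_union[OF small_pair]) (intro ClI D_intros fl_intros small_inn)+
  then show ?thesis by (rule small_mono) (use e in \<open>auto simp: ident_inn\<close>)
qed

lemma fev_min:
  assumes "\<exists>s. fev s \<and> x \<preceq> s"
  shows "\<exists>s. fev s \<and> x \<preceq> s \<and> (\<forall>t. fev t \<and> x \<preceq> t \<longrightarrow> \<not> t \<triangleleft> s)"
proof -
  have "Cl (\<lambda>s. x \<preceq> s)" by (rule ClI) (intro D_intros fl_intros)
  from fev_wf[OF this] show ?thesis using assms by blast
qed

text \<open>
  By induction, every \<open>x \<sqsubset> a\<close> is included in a fevel, and by comparability in a unique least one.  The
  fevels that are included in one of these form a history, and its \<open>\<pi>\<close> is a fevel that includes \<open>a\<close>.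
\<close>

theorem strat: "\<exists>s. fev s \<and> a \<preceq> s"
proof -
  have "Cl (\<lambda>a. \<exists>s. fev s \<and> a \<preceq> s)" by (rule ClI) (intro D_intros fl_intros)
  then show ?thesis
  proof (rule induct)
    fix a assume IH: "\<And>x. x \<triangleleft> a \<Longrightarrow> \<exists>s. fev s \<and> x \<preceq> s"
    let ?F = "\<lambda>x s. fev s \<and> x \<preceq> s \<and> (\<forall>t. fev t \<and> x \<preceq> t \<longrightarrow> \<not> t \<triangleleft> s)"
    have "Fn ?F"
      by (rule FnI) (intro D_intros fl_intros, use fev_linear in blast)
    from small_image[OF small_inn[of a] Cl_inn this] have S: "small (\<lambda>s. \<exists>x. x \<triangleleft> a \<and> ?F x s)" .
    have CS: "Cl (\<lambda>s. \<exists>x. x \<triangleleft> a \<and> ?F x s)" by (rule ClI) (intro D_intros fl_intros)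
    let ?H = "\<lambda>t. fev t \<and> (\<exists>s. (\<exists>x. x \<triangleleft> a \<and> ?F x s) \<and> t \<preceq> s)"
    have CH: "Cl ?H" by (rule ClI) (intro D_intros fl_intros)
    have "small (\<lambda>t. \<exists>s. (\<exists>x. x \<triangleleft> a \<and> ?F x s) \<and> t \<preceq> s)"
      by (rule small_union[OF S CS]) (intro D_intros fl_intros, unfold sub_def, rule small_power[OF small_inn])
    then have SH: "small ?H" by (rule small_mono) blast
    then obtain h where h: "ident h ?H" using small_ident CH by blast
    have "fist h"
      by (rule fist_fevs[OF h]) (use fev_sub sub_trans in blast)+
    have "small (\<lambda>x. \<exists>g. g \<triangleleft> h \<and> x \<preceq> g)"
      by (rule small_union[OF small_inn])
        (intro ClI D_intros fl_intros | unfold sub_def, rule small_power[OF small_inn])+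
    moreover have "Cl (\<lambda>x. \<exists>g. g \<triangleleft> h \<and> x \<preceq> g)" by (rule ClI) (intro D_intros fl_intros)
    ultimately obtain s where s: "ident s (\<lambda>x. \<exists>g. g \<triangleleft> h \<and> x \<preceq> g)" using small_ident by blast
    then have "fev s" using \<open>fist h\<close> unfolding fev_def isPi_def by blast
    moreover have "a \<preceq> s"
      unfolding sub_def
    proof (intro allI impI)
      fix x assume x: "x \<triangleleft> a"
      then obtain t where "?F x t" using fev_min[OF IH[OF x]] by blast
      then have "t \<triangleleft> h" using x sub_refl unfolding ident_inn[OF h] by blast
      then show "x \<triangleleft> s" using \<open>?F x t\<close> unfolding ident_inn[OF s] by blast
    qed
    ultimately show "\<exists>s. fev s \<and> a \<preceq> s" by blast
  qed
qed

end

locale stratified_functions = function_universe +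
  assumes stratified: "\<exists>s. fev s \<and> a \<preceq> s"

text \<open>
  There is no last fevel, because supercomprehension provides a function that takes a given fevel as
  value; so a fevel is followed by one that contains everything included in it.
\<close>

sublocale stratified_functions \<subseteq> founded_functions
proof
  have fn: "\<exists>t. fev t \<and> s \<triangleleft> t" for s
  proof -
    obtain s0 p where p: "p \<triangleleft> s0" using infinity by blast
    have "Fn (\<lambda>x y. x = p \<and> y = s)" by (rule FnI) (intro D_intros, blast)
    then obtain b where "\<And>x y. app b x y \<longleftrightarrow> x = p \<and> y = s"
      using supercomp[of "\<lambda>x y. x = p \<and> y = s" s0] p by blast
    then have "s \<triangleleft> b" using inn_defined(2) by blast
    then show ?thesis using stratified[of b] subD by blast
  qed
  show "Q f" if Q: "Cl Q" and step: "\<And>f. (\<And>x. x \<triangleleft> f \<Longrightarrow> Q x) \<Longrightarrow> Q f" for Q f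
  proof (rule ccontr)
    assume "\<not> Q f"
    let ?K = "\<lambda>s. \<exists>f. \<not> Q f \<and> f \<preceq> s"
    have "Cl ?K" by (rule ClI) (intro D_intros fl_intros D_Cl[OF Q])
    moreover obtain s where "fev s" "f \<preceq> s" using stratified by blast
    ultimately obtain k where k: "?K k" "fev k" "\<And>j. ?K j \<Longrightarrow> fev j \<Longrightarrow> \<not> j \<triangleleft> k"
      using fev_wf[of ?K s] \<open>\<not> Q f\<close> by blast
    then obtain f where f: "\<not> Q f" "f \<preceq> k" by blast
    have "Q x" if x: "x \<triangleleft> f" for x
    proof -
      have "x \<triangleleft> k" using f x subD by blast
      then obtain g where "fev g" "g \<triangleleft> k" "x \<preceq> g" using fev_inn[OF k(2)] by blast
      then show ?thesis using k(3) by blast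
    qed
    then show False using step f by blast
  qed
  show "\<exists>b. \<forall>x. x \<preceq> a \<longrightarrow> x \<triangleleft> b" for a
  proof -
    obtain s where s: "fev s" "a \<preceq> s" using stratified by blast
    obtain t where "fev t" "s \<triangleleft> t" using fn by blast
    then show ?thesis using s fev_potent sub_trans by blast
  qed
  show "\<exists>b. \<forall>x y. x \<triangleleft> a \<longrightarrow> y \<triangleleft> x \<longrightarrow> y \<triangleleft> b" for a
    using stratified[of a] fev_trans subD by blast
qed

section \<open>Sets among functions\<close>

locale membership = definability D for D :: "'a scheme \<Rightarrow> bool" +
  fixes mem :: "'a \<Rightarrow> 'a \<Rightarrow> bool"
  assumes D_mem': "D (\<lambda>e c. mem (e 0) (e 1))"

sublocale membership \<subseteq> V: guarded D "\<lambda>_. True" mem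
  by unfold_locales (rule D_True, rule D_mem')

locale zf_sets = membership +
  assumes extensionality: "(\<And>z. mem z x \<longleftrightarrow> mem z y) \<Longrightarrow> x = y"
    and separation: "Cl P \<Longrightarrow> \<exists>b. \<forall>x. mem x b \<longleftrightarrow> mem x a \<and> P x"
    and pairing: "\<exists>c. \<forall>x. mem x c \<longleftrightarrow> x = a \<or> x = b"
    and unions: "\<exists>b. \<forall>x. mem x b \<longleftrightarrow> (\<exists>y. mem y a \<and> mem x y)"
    and powersets: "\<exists>b. \<forall>x. mem x b \<longleftrightarrow> (\<forall>z. mem z x \<longrightarrow> mem z a)"
    and infinity: "\<exists>w. (\<exists>x. mem x w \<and> (\<forall>y. \<not> mem y x)) \<and>
      (\<forall>x. mem x w \<longrightarrow> (\<exists>y. mem y w \<and> (\<forall>z. mem z y \<longleftrightarrow> mem z x \<or> z = x)))"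
    and foundation: "\<exists>x. mem x a \<Longrightarrow> \<exists>x. mem x a \<and> \<not> (\<exists>y. mem y x \<and> mem y a)"
    and replacement: "Fn F \<Longrightarrow> \<exists>b. \<forall>y. mem y b \<longleftrightarrow> (\<exists>x. mem x a \<and> F x y)"

sublocale application \<subseteq> F: guarded D "idf app" "\<lambda>x y. app y x x"
  by unfold_locales (intro D_idf D_app atom_var)+

context application
begin

text \<open>The translation of membership.\<close>

definition memf :: "'a \<Rightarrow> 'a \<Rightarrow> bool" where
  "memf x f \<longleftrightarrow> F.core f \<and> app f x x \<or> \<not> F.core f \<and> (\<exists>u v. F.par u v x \<and> app f u v)"

lemma D_memf: "atom t \<Longrightarrow> atom s \<Longrightarrow> D (\<lambda>e c. memf (t e) (s e))"
  unfolding memf_def by (intro atom_shift D_intros fl_intros F.gm_intros)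

end

text \<open>
  Identity functions are extensional with respect to their fixed points, and every small class is the
  class of fixed points of one.
\<close>

sublocale founded_functions \<subseteq> F: setlike D "idf app" "\<lambda>x y. app y x x"
proof unfold_locales
  show ext: "x = y" if "idf app x" "idf app y" "\<And>z. app x z z \<longleftrightarrow> app y z z" for x y
    using that unfolding idf_def by (intro app_ext iffI) metis+
  have idf: "ident e P \<Longrightarrow> idf app e" for e P by (auto simp: ident_app idf_def)
  have "Cl (\<lambda>_. False)" "small (\<lambda>_. False)" by (auto simp: small_def intro: ClI D_bool)
  then obtain z where z: "ident z (\<lambda>_. False)" using small_ident by blast
  then have fz: "F.zero z" using idf[OF z] by (simp add: F.zero_def ident_app)
  then show "\<exists>z. F.zero z" ..
  have uz: "F.zero x \<longleftrightarrow> x = z" for x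
    using fz ext[of x z] by (auto simp: F.zero_def)
  show "\<exists>t. F.tri a b t" for a b
  proof -
    have "small (\<lambda>x. x = z \<or> (x = a \<or> x = b))"
      using small_Un[OF small_pair[of z z] small_pair[of a b]] by (simp add: ClI D_intros)
    moreover have "Cl (\<lambda>x. x = z \<or> (x = a \<or> x = b))" by (rule ClI) (intro D_intros)
    ultimately obtain t where t: "ident t (\<lambda>x. x = z \<or> (x = a \<or> x = b))" using small_ident by blast
    then show ?thesis unfolding F.tri_def uz
      by (intro exI[of _ t] conjI idf[OF t]) (simp add: ident_app)
  qed
qed

context founded_functions
begin

lemma core_idf: "F.core f \<Longrightarrow> app f x y \<Longrightarrow> x = y"
  using F.core_cases by (auto simp: idf_def)

lemma memf_iff:
  "memf x f \<longleftrightarrow> F.core f \<and> app f x x \<or> \<not> F.core f \<and> (\<exists>u v. x = F.pr u v \<and> app f u v)"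
  by (simp add: memf_def F.par_iff)

lemma not_app_Z: "\<not> app F.Z u v"
proof
  assume a: "app F.Z u v"
  with F.g_Z have "u = v" unfolding idf_def by blast
  with a F.m_Z[of u] show False by simp
qed

lemma not_memf_Z: "\<not> memf x F.Z"
  using not_app_Z F.not_core_Z by (simp add: memf_iff)

lemma memf_core: "F.core f \<Longrightarrow> memf x f \<longleftrightarrow> app f x x"
  by (simp add: memf_iff)

lemma memf_pr: "\<not> F.core f \<Longrightarrow> memf (F.pr u v) f \<longleftrightarrow> app f u v"
  by (simp add: memf_iff F.pr_inj)

text \<open>
  If \<open>x\<close> in the core had the same members as \<open>y\<close> outside it, then \<open>x\<close> would be a graph,
  hence the diagonal of some \<open>y'\<close> in the core; but then \<open>y'\<close> and \<open>y\<close> are the same function.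
\<close>

lemma memf_core_neq:
  assumes x: "F.core x" and y: "\<not> F.core y" and eq: "\<And>z. memf z x \<longleftrightarrow> memf z y"
  shows False
proof -
  have xy: "app x z z \<longleftrightarrow> memf z y" for z using eq memf_core[OF x] by simp
  have pr: "app x (F.pr u v) (F.pr u v) \<longleftrightarrow> app y u v" for u v using xy memf_pr[OF y] by simp
  have "\<not> F.wild x"
    unfolding F.wild_iff xy using memf_pr[OF y] memf_iff[of _ y] y functional[of y] by blast
  then obtain y' where y': "F.core y'" "F.diag y' x" using F.core_cases[OF x] by blast
  have "app y u v \<longleftrightarrow> app y' u v" for u v
  proof -
    have "app y u v \<longleftrightarrow> app y' u u \<and> u = v"
      using y'(2) unfolding F.diag_iff pr[symmetric] by (auto simp: F.par_iff F.pr_inj)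
    then show ?thesis using core_idf[OF y'(1)] by blast
  qed
  then show False using app_ext[of y y'] y y'(1) by blast
qed

lemma memf_ext:
  assumes "\<And>z. memf z x \<longleftrightarrow> memf z y"
  shows "x = y"
proof (cases "F.core x")
  case True
  then have y: "F.core y" using memf_core_neq assms by blast
  have "app x a b \<longleftrightarrow> app y a b" for a b
    using assms[of a] core_idf[OF True, of a b] core_idf[OF y, of a b]
    unfolding memf_core[OF True] memf_core[OF y] by blast
  then show ?thesis by (rule app_ext)
next
  case False
  then have "\<not> F.core y" using memf_core_neq[of y x] assms by blast
  then show ?thesis using assms memf_pr False by (intro app_ext) blast
qed

text \<open>
  The identity on \<open>A\<close> serves if it is in the core.  Otherwise \<open>A\<close> is the graph of a function \<open>h\<close>, and \<open>h\<close>
  serves: if \<open>h\<close> were in the core, the identity on \<open>A\<close> would be its diagonal.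
\<close>

lemma memf_ex:
  assumes "small A" and A: "Cl A"
  shows "\<exists>x. \<forall>z. memf z x \<longleftrightarrow> A z"
proof -
  obtain f where f: "ident f A" using small_ident assms by blast
  then have fA: "app f z z \<longleftrightarrow> A z" for z by (simp add: ident_app)
  have if_: "idf app f" using f by (auto simp: ident_app idf_def)
  show ?thesis
  proof (cases "F.core f")
    case True
    then show ?thesis using memf_core fA by blast
  next
    case False
    then have w: "\<not> F.wild f" using F.core_wild if_ by blast
    then have pairs: "A z \<Longrightarrow> \<exists>u v. z = F.pr u v" for z by (auto simp: F.wild_iff fA)
    have "Fn (\<lambda>z u. \<exists>v. z = F.pr u v)"
      by (rule FnI) (unfold F.par_iff[symmetric], intro D_intros F.gm_intros, auto simp: F.par_iff F.pr_inj)
    from small_image[OF assms this] obtain a where a: "\<And>u v. A (F.pr u v) \<Longrightarrow> u \<triangleleft> a"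
      unfolding small_def by blast
    have "Fn (\<lambda>u v. A (F.pr u v))"
    proof (rule FnI)
      have "D (\<lambda>e c. \<exists>z. z = F.pr (e 0) (e 1) \<and> A z)"
        by (unfold F.par_iff[symmetric], intro D_intros D_Cl[OF A] F.gm_intros)
      then show "D (\<lambda>e c. A (F.pr (e 0) (e 1)))" by simp
      show "\<And>x y z. A (F.pr x y) \<Longrightarrow> A (F.pr x z) \<Longrightarrow> y = z"
        using w by (auto simp: F.wild_iff fA)
    qed
    then obtain h where h: "\<And>u v. app h u v \<longleftrightarrow> A (F.pr u v)"
      using supercomp[of "\<lambda>u v. A (F.pr u v)" a] a by blast
    have "\<not> F.core h"
    proof
      assume c: "F.core h"
      have "F.diag h f"
        unfolding F.diag_iff fA h using pairs h core_idf[OF c] by blast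
      then show False using F.core_diag[OF c if_] False by blast
    qed
    then have "memf z h \<longleftrightarrow> A z" for z
      using pairs[of z] by (auto simp: memf_iff h)
    then show ?thesis by blast
  qed
qed

lemma Cl_memf: "Cl (\<lambda>z. memf z x)"
  by (rule ClI) (intro D_memf atom_var atom_const)

lemma small_memf: "small (\<lambda>z. memf z x)"
proof (cases "F.core x")
  case True
  show ?thesis
    by (rule small_mono[OF small_inn[of x]]) (auto simp: memf_core[OF True] inn_defined)
next
  case False
  have "Fn (\<lambda>u z. \<exists>v. z = F.pr u v \<and> app x u v)"
    by (rule FnI) (unfold F.par_iff[symmetric], intro D_intros F.gm_intros fl_intros, auto simp: F.par_iff dest: functional)
  from small_image[OF small_inn Cl_inn this, of x] show ?thesis
    by (rule small_mono) (use False inn_defined in \<open>auto simp: memf_iff\<close>)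
qed

text \<open>
  Members of \<open>f\<close> are either in its domain or pairs of such objects, and pairs inherit \<open>Q\<close> from their
  components because they are built from sets \<open>{\<emptyset>, a, b}\<close>.
\<close>

lemma memf_induct:
  assumes Q: "Cl Q" and step: "\<And>y. (\<And>x. memf x y \<Longrightarrow> Q x) \<Longrightarrow> Q y"
  shows "Q f"
  using Q
proof (rule induct)
  fix f assume IH: "\<And>x. x \<triangleleft> f \<Longrightarrow> Q x"
  have Z: "Q F.Z" by (rule step) (simp add: not_memf_Z)
  have T: "Q (F.T a b)" if "Q a" "Q b" for a b
    by (rule step) (use that Z in \<open>auto simp: memf_core F.core_T\<close>)
  show "Q f"
  proof (rule step)
    fix x assume "memf x f"
    then consider "app f x x" | u v where "x = F.pr u v" "app f u v"
      by (auto simp: memf_iff)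
    then show "Q x"
    proof cases
      case 1
      then show ?thesis using IH inn_defined by blast
    next
      case 2
      then have "Q u" "Q v" using IH inn_defined by blast+
      then show ?thesis unfolding 2 F.pr_def by (intro T)
    qed
  qed
qed

text \<open>
  A subset \<open>x\<close> of \<open>a\<close> has only members of \<open>a\<close> and components of pairs in \<open>a\<close> in its domain and range.
\<close>

lemma small_powerset: "small (\<lambda>x. \<forall>z. memf z x \<longrightarrow> memf z a)"
proof -
  have Fn1: "Fn (\<lambda>z u. \<exists>v. z = F.pr u v)" and Fn2: "Fn (\<lambda>z v. \<exists>u. z = F.pr u v)"
    by ((rule FnI, (unfold F.par_iff[symmetric], intro D_intros F.gm_intros)[1], auto simp: F.par_iff F.pr_inj)[1])+
  let ?A1 = "\<lambda>u. \<exists>z. memf z a \<and> (\<exists>v. z = F.pr u v)"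
  let ?A2 = "\<lambda>v. \<exists>z. memf z a \<and> (\<exists>u. z = F.pr u v)"
  have "small (\<lambda>z. (?A1 z \<or> ?A2 z) \<or> memf z a)"
  proof (intro small_Un)
    show "small ?A1" by (rule small_image[OF small_memf Cl_memf Fn1])
    show "small ?A2" by (rule small_image[OF small_memf Cl_memf Fn2])
    show c: "Cl ?A1" "Cl ?A2"
      by (rule ClI, (unfold F.par_iff[symmetric])?, intro D_intros F.gm_intros D_memf)+
    show "Cl (\<lambda>z. ?A1 z \<or> ?A2 z)"
      by (rule ClI) (intro D_intros D_Cl[OF c(1)] D_Cl[OF c(2)])
    show "small (\<lambda>z. memf z a)" "Cl (\<lambda>z. memf z a)" by (rule small_memf, rule Cl_memf)
  qed
  from small_power[OF this] show ?thesis
  proof (rule small_mono)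
    fix x assume x: "\<forall>z. memf z x \<longrightarrow> memf z a"
    show "\<forall>y. y \<triangleleft> x \<longrightarrow> (?A1 y \<or> ?A2 y) \<or> memf y a"
    proof (cases "F.core x")
      case True
      then show ?thesis using x core_idf[OF True] memf_core[OF True] unfolding inn_def defined_def by blast
    next
      case False
      then show ?thesis using x memf_pr[OF False] unfolding inn_def defined_def by blast
    qed
  qed
qed

text \<open>
  Take the first fevel \<open>t\<close> that includes a witness \<open>s\<close> of infinity.  A fevel \<open>g \<sqsubset> t\<close> does not include \<open>s\<close>, so
  some \<open>q \<sqsubset> s\<close> lies outside \<open>g\<close>; the fevel of an object above \<open>q\<close> in \<open>s\<close> comes after \<open>g\<close> and before \<open>t\<close>.
\<close>

lemma limit_fev:
  "\<exists>t. fev t \<and> (\<exists>p. p \<triangleleft> t) \<and> (\<forall>x. x \<triangleleft> t \<longrightarrow> (\<exists>g. fev g \<and> g \<triangleleft> t \<and> x \<triangleleft> g))"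
proof -
  let ?I = "\<lambda>s. (\<exists>p. p \<triangleleft> s) \<and> (\<forall>q. q \<triangleleft> s \<longrightarrow> (\<exists>r. q \<triangleleft> r \<and> r \<triangleleft> s))"
  let ?K = "\<lambda>t. \<exists>s. ?I s \<and> s \<preceq> t"
  have K: "Cl ?K" by (rule ClI) (intro D_intros fl_intros)
  obtain s where s: "?I s" using infinity by blast
  moreover obtain t where "fev t" "s \<preceq> t" using strat by blast
  ultimately obtain t where t: "?K t" "fev t" and min: "\<And>j. ?K j \<Longrightarrow> fev j \<Longrightarrow> \<not> j \<triangleleft> t"
    using fev_wf[OF K, of t] by blast
  then obtain s where s: "?I s" "s \<preceq> t" by blast
  have lim: "\<exists>g'. fev g' \<and> g' \<triangleleft> t \<and> g \<triangleleft> g'" if g: "fev g" "g \<triangleleft> t" for g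
  proof -
    have "\<not> s \<preceq> g" using min g s by blast
    then obtain q where q: "q \<triangleleft> s" "\<not> q \<triangleleft> g" by (auto simp: sub_def)
    then obtain r where r: "q \<triangleleft> r" "r \<triangleleft> s" using s by blast
    then have "r \<triangleleft> t" using s subD by blast
    then obtain g' where g': "fev g'" "g' \<triangleleft> t" "r \<preceq> g'" using fev_inn[OF t(2)] by blast
    then have "q \<triangleleft> g'" using r subD by blast
    then have "g' \<noteq> g" "\<not> g' \<triangleleft> g" using q(2) fev_trans[OF g(1)] by blast+
    then show ?thesis using fev_linear g g' by blast
  qed
  moreover have "\<exists>g. fev g \<and> g \<triangleleft> t \<and> x \<triangleleft> g" if x: "x \<triangleleft> t" for x
  proof -
    obtain g where g: "fev g" "g \<triangleleft> t" "x \<preceq> g" using fev_inn[OF t(2)] x by blast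
    obtain g' where "fev g'" "g' \<triangleleft> t" "g \<triangleleft> g'" using lim g by blast
    then show ?thesis using fev_potent g(3) by blast
  qed
  moreover have "\<exists>p. p \<triangleleft> t" using s subD by blast
  ultimately show ?thesis using t(2) by blast
qed

text \<open>
  A limit fevel is closed under successors of the sets that are empty or contain \<open>\<emptyset>\<close>: such a nonempty
  set lies in the core, so its domain is the set itself.
\<close>

lemma memf_infinity: "\<exists>w. (\<exists>x. memf x w \<and> (\<forall>y. \<not> memf y x)) \<and>
  (\<forall>x. memf x w \<longrightarrow> (\<exists>y. memf y w \<and> (\<forall>z. memf z y \<longleftrightarrow> memf z x \<or> z = x)))"
proof -
  obtain t p where t: "fev t" "p \<triangleleft> t"
    and lim: "\<And>x. x \<triangleleft> t \<Longrightarrow> \<exists>g. fev g \<and> g \<triangleleft> t \<and> x \<triangleleft> g" using limit_fev by blast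
  have nZ: "\<not> x \<triangleleft> F.Z" "\<not> memf x F.Z" for x
    using not_app_Z not_memf_Z by (auto simp: inn_def defined_def)
  have coreZ: "F.core x" if "memf F.Z x" for x
    using that by (auto simp: memf_iff)
  let ?W = "\<lambda>x. x \<triangleleft> t \<and> (x = F.Z \<or> memf F.Z x)"
  have "Cl ?W" by (rule ClI) (intro D_intros fl_intros D_memf)
  moreover have "small ?W" by (rule small_mono[OF small_inn[of t]]) blast
  ultimately obtain w where w: "\<And>z. memf z w \<longleftrightarrow> ?W z" using memf_ex by blast
  have "F.Z \<triangleleft> t" using nZ(1) by (intro fev_potent[OF t(1) _ t(2)]) (simp add: sub_def)
  moreover have "\<exists>y. ?W y \<and> (\<forall>z. memf z y \<longleftrightarrow> memf z x \<or> z = x)" if x: "?W x" for x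
  proof -
    have "small (\<lambda>z. memf z x \<or> z = x)"
      using small_Un[OF small_memf[of x] small_pair[of x x] Cl_memf] by (simp add: ClI D_intros)
    moreover have "Cl (\<lambda>z. memf z x \<or> z = x)" by (rule ClI) (intro D_intros D_memf)
    ultimately obtain y where y: "\<And>z. memf z y \<longleftrightarrow> memf z x \<or> z = x" using memf_ex by blast
    have Zy: "memf F.Z y" using y x by blast
    then have cy: "F.core y" by (rule coreZ)
    obtain g where g: "fev g" "g \<triangleleft> t" "x \<triangleleft> g" using lim x by blast
    have "y \<preceq> g"
      unfolding sub_def
    proof (intro allI impI)
      fix z assume "z \<triangleleft> y"
      then have "memf z y" using memf_core[OF cy] core_idf[OF cy] by (auto simp: inn_def defined_def)
      then have "memf z x \<or> z = x" by (simp add: y)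
      moreover have "z \<triangleleft> x" if "memf z x"
      proof -
        have "F.core x" using x that nZ coreZ by blast
        then show ?thesis using that memf_core inn_defined by blast
      qed
      ultimately show "z \<triangleleft> g" using g fev_trans by blast
    qed
    then have "y \<triangleleft> t" using fev_potent t g by blast
    then show ?thesis using Zy y by blast
  qed
  ultimately show ?thesis using nZ(2) by (intro exI[of _ w]) (simp add: w, blast)
qed

theorem memf_zf: "zf_sets D memf"
proof unfold_locales
  show "D (\<lambda>e c. memf (e 0) (e 1))" by (intro D_memf atom_var)
  show "\<And>x y. (\<And>z. memf z x \<longleftrightarrow> memf z y) \<Longrightarrow> x = y" by (rule memf_ext)
  show "\<exists>b. \<forall>x. memf x b \<longleftrightarrow> memf x a \<and> P x" if "Cl P" for P a
    by (rule memf_ex) (rule small_mono[OF small_memf[of a]], blast, rule ClI, intro D_intros D_memf D_Cl[OF that])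
  show "\<exists>c. \<forall>x. memf x c \<longleftrightarrow> x = a \<or> x = b" for a b
    by (rule memf_ex[OF small_pair]) (rule ClI, intro D_intros)
  show "\<exists>b. \<forall>x. memf x b \<longleftrightarrow> (\<exists>y. memf y a \<and> memf x y)" for a
    by (rule memf_ex, rule small_union[OF small_memf Cl_memf _ small_memf])
      (intro D_intros D_memf, rule ClI, intro D_intros D_memf)
  show "\<exists>b. \<forall>x. memf x b \<longleftrightarrow> (\<forall>z. memf z x \<longrightarrow> memf z a)" for a
    by (rule memf_ex[OF small_powerset]) (rule ClI, intro D_intros D_memf)
  show "\<exists>w. (\<exists>x. memf x w \<and> (\<forall>y. \<not> memf y x)) \<and>
      (\<forall>x. memf x w \<longrightarrow> (\<exists>y. memf y w \<and> (\<forall>z. memf z y \<longleftrightarrow> memf z x \<or> z = x)))"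
    by (rule memf_infinity)
  show "\<exists>x. memf x a \<and> \<not> (\<exists>y. memf y x \<and> memf y a)" if "\<exists>x. memf x a" for a
  proof (rule ccontr)
    assume n: "\<not> ?thesis"
    have "Cl (\<lambda>x. \<not> memf x a)" by (rule ClI) (intro D_intros D_memf)
    then have "\<not> memf x a" for x by (rule memf_induct) (use n in blast)
    then show False using that by blast
  qed
  show "\<exists>b. \<forall>y. memf y b \<longleftrightarrow> (\<exists>x. memf x a \<and> F x y)" if "Fn F" for F a
    by (rule memf_ex[OF small_image[OF small_memf Cl_memf that]])
      (rule ClI, intro D_intros D_memf D_Fn[OF that])
qed

end

section \<open>Functions among sets\<close>

context membership
begin

text \<open>The translation of application.\<close>

definition vapp :: "'a \<Rightarrow> 'a \<Rightarrow> 'a \<Rightarrow> bool" where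
  "vapp f x y \<longleftrightarrow> V.core f \<and> mem x f \<and> x = y \<or> \<not> V.core f \<and> (\<exists>z. V.par x y z \<and> mem z f)"

lemma D_vapp: "atom t \<Longrightarrow> atom s \<Longrightarrow> atom u \<Longrightarrow> D (\<lambda>e c. vapp (t e) (s e) (u e))"
  unfolding vapp_def by (intro atom_shift D_intros V.gm_intros)

end

sublocale membership \<subseteq> A: application D vapp
  by unfold_locales (intro D_vapp atom_var)

context zf_sets
begin

lemma set_ex: "Cl P \<Longrightarrow> (\<And>x. P x \<Longrightarrow> mem x a) \<Longrightarrow> \<exists>b. \<forall>x. mem x b \<longleftrightarrow> P x"
  using separation[of P a] by blast

lemma Un_ex: "\<exists>c. \<forall>x. mem x c \<longleftrightarrow> mem x a \<or> mem x b"
proof -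
  obtain p where p: "\<And>x. mem x p \<longleftrightarrow> x = a \<or> x = b" using pairing by blast
  obtain c where "\<And>x. mem x c \<longleftrightarrow> (\<exists>y. mem y p \<and> mem x y)" using unions by blast
  then have "\<And>x. mem x c \<longleftrightarrow> mem x a \<or> mem x b" using p by auto
  then show ?thesis by blast
qed

end

sublocale zf_sets \<subseteq> V: setlike D "\<lambda>_. True" mem
proof unfold_locales
  show "x = y" if "\<And>z. mem z x \<longleftrightarrow> mem z y" for x y using that by (rule extensionality)
  obtain z where "\<forall>y. \<not> mem y z" using infinity by blast
  then have z: "V.zero z" by (simp add: V.zero_def)
  then show "\<exists>z. V.zero z" ..
  have zz: "V.zero x \<longleftrightarrow> x = z" for x
    using z extensionality[of x z] by (auto simp: V.zero_def)
  show "\<exists>t. V.tri a b t" for a b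
  proof -
    obtain p q where "\<And>x. mem x p \<longleftrightarrow> x = z \<or> x = z" "\<And>x. mem x q \<longleftrightarrow> x = a \<or> x = b"
      using pairing[of z z] pairing[of a b] by blast
    then show ?thesis using Un_ex[of p q] by (auto simp: V.tri_def zz)
  qed
qed

context zf_sets
begin

subsection \<open>Transitive closures\<close>

definition suc :: "'a \<Rightarrow> 'a \<Rightarrow> bool" where
  "suc n s \<longleftrightarrow> (\<forall>z. mem z s \<longleftrightarrow> mem z n \<or> z = n)"

definition union_of :: "'a \<Rightarrow> 'a \<Rightarrow> bool" where
  "union_of y u \<longleftrightarrow> (\<forall>x. mem x u \<longleftrightarrow> (\<exists>z. mem z y \<and> mem x z))"

text \<open>
  The finite ordinals as a least class; the axiom of infinity serves to show that they form a set.
\<close>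

definition finord :: "'a \<Rightarrow> bool" where
  "finord n \<longleftrightarrow> (\<forall>P. Cl P \<longrightarrow> (\<forall>x. V.zero x \<longrightarrow> P x) \<and> (\<forall>x s. P x \<and> suc x s \<longrightarrow> P s) \<longrightarrow> P n)"

text \<open>
  The graph of the sequence \<open>a, \<Union>a, \<Union>\<Union>a, \<dots>\<close> as a class of ordered pairs; a class suffices here, since
  replacement turns its range into a set.
\<close>

definition iter :: "'a \<Rightarrow> 'a \<Rightarrow> bool" where
  "iter a w \<longleftrightarrow> (\<forall>P. Cl P \<longrightarrow> (\<forall>x w. V.zero x \<and> V.par x a w \<longrightarrow> P w) \<and>
     (\<forall>n y s u v w. V.par n y v \<and> P v \<and> suc n s \<and> union_of y u \<and> V.par s u w \<longrightarrow> P w) \<longrightarrow> P w)"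

lemma D_mem: "atom t \<Longrightarrow> atom s \<Longrightarrow> D (\<lambda>e c. mem (t e) (s e))"
  by (rule V.D_m)

lemma D_suc: "atom t \<Longrightarrow> atom s \<Longrightarrow> D (\<lambda>e c. suc (t e) (s e))"
  unfolding suc_def by (intro atom_shift D_intros V.gm_intros)

lemma D_union_of: "atom t \<Longrightarrow> atom s \<Longrightarrow> D (\<lambda>e c. union_of (t e) (s e))"
  unfolding union_of_def by (intro atom_shift D_intros V.gm_intros)

lemma D_finord: "atom t \<Longrightarrow> D (\<lambda>e c. finord (t e))"
  unfolding finord_def by (intro atom_shift D_intros V.gm_intros D_suc)

lemma D_iter: "atom t \<Longrightarrow> atom s \<Longrightarrow> D (\<lambda>e c. iter (t e) (s e))"
  unfolding iter_def by (intro atom_shift D_intros V.gm_intros D_suc D_union_of)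

lemmas zf_intros = V.gm_intros D_suc D_union_of D_finord D_iter

lemma ex_suc: "\<exists>s. suc n s"
  unfolding suc_def using Un_ex pairing[of n n] by metis

lemma ex_union_of: "\<exists>u. union_of y u"
  unfolding union_of_def by (rule unions)

lemma suc_fun: "suc n s \<Longrightarrow> suc n s' \<Longrightarrow> s = s'"
  unfolding suc_def by (rule extensionality) simp

lemma union_of_fun: "union_of n s \<Longrightarrow> union_of n s' \<Longrightarrow> s = s'"
  unfolding union_of_def by (rule extensionality) simp

lemma suc_inj: "suc n s \<Longrightarrow> suc m s \<Longrightarrow> n = m"
proof (rule ccontr)
  assume s: "suc n s" "suc m s" and "n \<noteq> m"
  then have nm: "mem n m" "mem m n" unfolding suc_def by blast+
  obtain p where p: "\<And>x. mem x p \<longleftrightarrow> x = n \<or> x = m" using pairing by blast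
  show False using foundation[of p] nm by (auto simp: p)
qed

lemma suc_Z: "\<not> suc n V.Z"
  unfolding suc_def using V.m_Z by blast

lemma finord_Z: "finord V.Z"
  by (simp add: finord_def V.zero_iff)

lemma finord_suc: "finord n \<Longrightarrow> suc n s \<Longrightarrow> finord s"
  unfolding finord_def by blast

lemma finord_induct:
  "finord n \<Longrightarrow> Cl P \<Longrightarrow> P V.Z \<Longrightarrow> (\<And>x s. P x \<Longrightarrow> suc x s \<Longrightarrow> P s) \<Longrightarrow> P n"
  unfolding finord_def V.zero_iff by blast

lemma iter_Z: "iter a (V.pr V.Z a)"
  by (simp add: iter_def V.zero_iff V.par_iff)

lemma iter_suc: "iter a (V.pr n y) \<Longrightarrow> suc n s \<Longrightarrow> union_of y u \<Longrightarrow> iter a (V.pr s u)"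
  unfolding iter_def V.par_iff by blast

lemma iter_induct:
  assumes "iter a w" "Cl P" "P (V.pr V.Z a)"
    "\<And>n y s u. P (V.pr n y) \<Longrightarrow> suc n s \<Longrightarrow> union_of y u \<Longrightarrow> P (V.pr s u)"
  shows "P w"
  using assms unfolding iter_def V.par_iff V.zero_iff by blast

lemma iter_cases:
  assumes "iter a w"
  shows "w = V.pr V.Z a \<or> (\<exists>n y s u. iter a (V.pr n y) \<and> suc n s \<and> union_of y u \<and> w = V.pr s u)"
proof -
  let ?P = "\<lambda>w. iter a w \<and> ((\<exists>x. V.zero x \<and> V.par x a w) \<or>
     (\<exists>n y s u v. V.par n y v \<and> iter a v \<and> suc n s \<and> union_of y u \<and> V.par s u w))"
  have "Cl ?P" by (rule ClI) (intro D_intros zf_intros)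
  with assms have "?P w"
  proof (rule iter_induct)
    show "?P (V.pr V.Z a)" using iter_Z by (simp add: V.par_iff V.zero_iff)
    show "?P (V.pr s u)" if "?P (V.pr n y)" "suc n s" "union_of y u" for n y s u
      using that iter_suc[of a n y s u] unfolding V.par_iff by blast
  qed
  then show ?thesis by (simp add: V.par_iff V.zero_iff)
qed

lemma iter_fun:
  assumes "finord n"
  shows "\<forall>y y'. iter a (V.pr n y) \<and> iter a (V.pr n y') \<longrightarrow> y = y'"
proof -
  let ?P = "\<lambda>n. \<forall>y y' w w'. V.par n y w \<and> V.par n y' w' \<and> iter a w \<and> iter a w' \<longrightarrow> y = y'"
  have "Cl ?P" by (rule ClI) (intro D_intros zf_intros)
  with assms have "?P n"
  proof (rule finord_induct)
    have "y = a" if "iter a (V.pr V.Z y)" for y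
      using iter_cases[OF that] suc_Z by (auto simp: V.pr_inj)
    then show "?P V.Z" by (auto simp: V.par_iff)
  next
    fix n s assume IH: "?P n" and s: "suc n s"
    have *: "\<exists>z. iter a (V.pr n z) \<and> union_of z y" if "iter a (V.pr s y)" for y
      using iter_cases[OF that] suc_Z suc_inj s by (auto simp: V.pr_inj) metis
    have "y = y'" if "iter a (V.pr s y)" "iter a (V.pr s y')" for y y'
      using *[OF that(1)] *[OF that(2)] IH union_of_fun by (auto simp: V.par_iff) metis
    then show "?P s" by (auto simp: V.par_iff)
  qed
  then show ?thesis by (auto simp: V.par_iff)
qed

text \<open>The union of all \<open>\<Union>\<^sup>n {f}\<close>.\<close>

lemma trans_closure: "\<exists>t. mem f t \<and> (\<forall>x y. mem x t \<longrightarrow> mem y x \<longrightarrow> mem y t)"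
proof -
  obtain a where a: "\<And>x. mem x a \<longleftrightarrow> x = f" using pairing[of f f] by auto
  obtain I where I0: "\<exists>x. mem x I \<and> (\<forall>y. \<not> mem y x)"
    and IS: "\<And>x. mem x I \<Longrightarrow> \<exists>s. mem s I \<and> suc x s"
    using infinity unfolding suc_def by blast
  have nI: "mem n I" if "finord n" for n
    using that
  proof (rule finord_induct)
    show "Cl (\<lambda>n. mem n I)" by (rule ClI) (intro D_intros zf_intros)
    obtain x where "mem x I" "V.zero x" using I0 by (auto simp: V.zero_def)
    then show "mem V.Z I" by (simp add: V.zero_iff)
  qed (use IS suc_fun in blast)
  have "Fn (\<lambda>n y. finord n \<and> (\<exists>w. V.par n y w \<and> iter a w))"
    by (rule FnI) (intro D_intros zf_intros, use iter_fun in \<open>auto simp: V.par_iff\<close>)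
  from replacement[OF this, of I]
  obtain B where B: "\<And>y. mem y B \<longleftrightarrow> (\<exists>n. finord n \<and> iter a (V.pr n y))"
    using nI unfolding V.par_iff by metis
  obtain t where t: "\<And>x. mem x t \<longleftrightarrow> (\<exists>y. mem y B \<and> mem x y)" using unions by blast
  have "mem a B" using B finord_Z iter_Z by blast
  then have "mem f t" using t a by blast
  moreover have "mem y t" if x: "mem x t" and y: "mem y x" for x y
  proof -
    obtain z where z: "mem z B" "mem x z" using x t by blast
    obtain n where n: "finord n" "iter a (V.pr n z)" using z B by blast
    obtain s u where "suc n s" "union_of z u" using ex_suc ex_union_of by blast
    then have "mem u B" using n finord_suc iter_suc B by blast
    moreover have "mem y u" using \<open>union_of z u\<close> z y unfolding union_of_def by blast
    ultimately show ?thesis using t by blast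
  qed
  ultimately show ?thesis by blast
qed

lemma mem_induct:
  assumes Q: "Cl Q" and step: "\<And>y. (\<And>x. mem x y \<Longrightarrow> Q x) \<Longrightarrow> Q y"
  shows "Q f"
proof (rule ccontr)
  assume f: "\<not> Q f"
  obtain t where t: "mem f t" "\<And>x y. mem x t \<Longrightarrow> mem y x \<Longrightarrow> mem y t"
    using trans_closure by blast
  have "Cl (\<lambda>x. \<not> Q x)" by (rule ClI) (intro D_intros D_Cl[OF Q])
  then obtain b where b: "\<And>x. mem x b \<longleftrightarrow> mem x t \<and> \<not> Q x" using separation by blast
  then obtain x where "mem x b" "\<And>y. mem y x \<Longrightarrow> \<not> mem y b" using foundation[of b] t(1) f by blast
  then show False using b t(2) step by blast
qed

subsection \<open>Sets acting as functions\<close>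

lemma vapp_core: "V.core f \<Longrightarrow> vapp f x y \<longleftrightarrow> mem x f \<and> x = y"
  by (simp add: vapp_def)

lemma vapp_pr: "\<not> V.core f \<Longrightarrow> vapp f x y \<longleftrightarrow> mem (V.pr x y) f"
  by (simp add: vapp_def V.par_iff)

lemma mem_pr: "\<not> V.core f \<Longrightarrow> mem z f \<Longrightarrow> \<exists>u v. z = V.pr u v"
  using V.core_wild[of f] by (auto simp: V.wild_iff)

lemma vapp_fun: "vapp f x y \<Longrightarrow> vapp f x z \<Longrightarrow> y = z"
  using V.core_wild[of f] by (cases "V.core f") (auto simp: vapp_core vapp_pr V.wild_iff)

text \<open>
  The function of a set \<open>h\<close> outside the core determines \<open>h\<close> as its graph; if it is the identity on \<open>f\<close>, then
  \<open>h\<close> is the diagonal of \<open>f\<close>.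
\<close>

lemma vapp_core_neq:
  assumes f: "V.core f" and h: "\<not> V.core h" and eq: "\<And>x y. vapp f x y \<longleftrightarrow> vapp h x y"
  shows False
proof -
  have "mem (V.pr u v) h \<longleftrightarrow> mem u f \<and> u = v" for u v
    using eq[of u v] by (simp add: vapp_core[OF f] vapp_pr[OF h])
  then have "V.diag f h" unfolding V.diag_iff using mem_pr[OF h] by metis
  then show False using V.core_diag[OF f] h by blast
qed

lemma vapp_ext:
  assumes eq: "\<And>x y. vapp f x y \<longleftrightarrow> vapp h x y"
  shows "f = h"
proof (cases "V.core f")
  case True
  then have h: "V.core h" using vapp_core_neq eq by blast
  then show ?thesis using eq by (intro extensionality) (metis vapp_core True)
next
  case False
  then have h: "\<not> V.core h" using vapp_core_neq[of h f] eq by blast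
  show ?thesis
    using eq mem_pr[OF False] mem_pr[OF h] unfolding vapp_pr[OF False] vapp_pr[OF h]
    by (intro extensionality) blast
qed

text \<open>
  The graph of \<open>F\<close> serves unless it is in the core.  In that case it is the diagonal of some \<open>y\<close> in the
  core, and \<open>F\<close> is the identity on \<open>y\<close>, so \<open>y\<close> serves.
\<close>

lemma vapp_ex:
  assumes F: "Fn F" and a: "\<And>x y. F x y \<Longrightarrow> mem x a"
  shows "\<exists>h. \<forall>x y. vapp h x y \<longleftrightarrow> F x y"
proof -
  have "Fn (\<lambda>x z. \<exists>y. F x y \<and> V.par x y z)"
    by (rule FnI) (intro D_intros D_Fn[OF F] V.gm_intros, use FnD[OF F] in \<open>auto simp: V.par_iff\<close>)
  from replacement[OF this, of a]
  obtain h where "\<And>z. mem z h \<longleftrightarrow> (\<exists>x. mem x a \<and> (\<exists>y. F x y \<and> V.par x y z))" by blast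
  then have h: "mem z h \<longleftrightarrow> (\<exists>x y. F x y \<and> z = V.pr x y)" for z
    using a unfolding V.par_iff by blast
  then have hF: "mem (V.pr x y) h \<longleftrightarrow> F x y" for x y by (auto simp: V.pr_inj)
  show ?thesis
  proof (cases "V.core h")
    case False
    then show ?thesis using vapp_pr hF by blast
  next
    case True
    have "\<not> V.wild h" using FnD[OF F] h hF by (auto simp: V.wild_iff)
    then obtain y where y: "V.core y" "V.diag y h" using V.core_cases[OF True] by blast
    have "vapp y u v \<longleftrightarrow> F u v" for u v
      using y(2) unfolding V.diag_iff vapp_core[OF y(1)] hF[symmetric] by (auto simp: V.pr_inj)
    then show ?thesis by blast
  qed
qed

lemma vapp_id: "\<exists>h. \<forall>x y. vapp h x y \<longleftrightarrow> mem x a \<and> x = y"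
proof -
  have "Fn (\<lambda>x y. mem x a \<and> x = y)" by (rule FnI) (intro D_intros V.gm_intros, blast)
  then show ?thesis by (rule vapp_ex) blast
qed

lemma inn_id: "\<forall>x y. vapp h x y \<longleftrightarrow> mem x a \<and> x = y \<Longrightarrow> A.inn x h \<longleftrightarrow> mem x a"
  by (auto simp: A.inn_def A.defined_def)

lemma inn_cases:
  assumes "A.inn x f"
  shows "mem x f \<or> (\<exists>u v. mem (V.pr u v) f \<and> (x = u \<or> x = v))"
proof (cases "V.core f")
  case True
  then show ?thesis using assms by (auto simp: A.inn_def A.defined_def vapp_core)
next
  case False
  then show ?thesis using assms unfolding A.inn_def A.defined_def vapp_pr[OF False] by blast
qed

lemma hull_ex: "\<exists>t. mem f t \<and> (\<forall>x y. mem x t \<longrightarrow> A.inn y x \<longrightarrow> mem y t)"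
proof -
  obtain t where t: "mem f t" "\<And>x y. mem x t \<Longrightarrow> mem y x \<Longrightarrow> mem y t"
    using trans_closure by blast
  have "mem y t" if x: "mem x t" and y: "A.inn y x" for x y
    using inn_cases[OF y]
  proof
    assume "\<exists>u v. mem (V.pr u v) x \<and> (y = u \<or> y = v)"
    then obtain u v where uv: "mem (V.pr u v) x" "y = u \<or> y = v" by blast
    have "mem (V.pr u v) t" by (rule t(2)[OF x uv(1)])
    then have T: "mem (V.T (V.T u u) (V.T v v)) t" by (rule t(2)) (simp add: V.pr_def)
    have "mem (V.T u u) t" "mem (V.T v v) t" by (rule t(2)[OF T], simp)+
    then have "mem u t" "mem v t"
      using t(2)[of "V.T u u" u] t(2)[of "V.T v v" v] by simp_all
    then show ?thesis using uv(2) by blast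
  qed (use t(2) x in blast)
  then show ?thesis using t(1) by blast
qed

text \<open>
  Three powersets of \<open>b \<union> {\<emptyset>}\<close> suffice, as a pair arises from its components by three formations of \<open>{\<emptyset>, a, b}\<close>.
\<close>

lemma pair_power:
  "\<exists>c. (\<forall>u v. mem u b \<longrightarrow> mem v b \<longrightarrow> mem (V.pr u v) c)"
proof -
  have T: "\<exists>q. mem V.Z q \<and> (\<forall>u v. mem u p \<longrightarrow> mem v p \<longrightarrow> mem (V.T u v) q)" if "mem V.Z p" for p
  proof -
    obtain q where "\<And>x. mem x q \<longleftrightarrow> (\<forall>z. mem z x \<longrightarrow> mem z p)" using powersets by blast
    then show ?thesis using that by (intro exI[of _ q]) auto
  qed
  obtain z where z: "\<And>x. mem x z \<longleftrightarrow> x = V.Z" using pairing[of V.Z V.Z] by auto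
  obtain p where p: "\<And>x. mem x p \<longleftrightarrow> mem x z \<or> mem x b" using Un_ex by blast
  obtain p1 where p1: "mem V.Z p1" "\<And>u v. mem u p \<Longrightarrow> mem v p \<Longrightarrow> mem (V.T u v) p1"
    using T[of p] p z by blast
  obtain p2 where p2: "mem V.Z p2" "\<And>u v. mem u p1 \<Longrightarrow> mem v p1 \<Longrightarrow> mem (V.T u v) p2"
    using T[OF p1(1)] by blast
  obtain p3 where p3: "\<And>u v. mem u p2 \<Longrightarrow> mem v p2 \<Longrightarrow> mem (V.T u v) p3"
    using T[OF p2(1)] by blast
  have "mem (V.pr u v) p3" if "mem u b" "mem v b" for u v
    unfolding V.pr_def using that p by (intro p3 p2 p1) simp_all
  then show ?thesis by blast
qed

lemma vapp_power: "\<exists>b. \<forall>x. A.sub x a \<longrightarrow> A.inn x b"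
proof -
  obtain t where t: "mem a t" "\<And>x y. mem x t \<Longrightarrow> A.inn y x \<Longrightarrow> mem y t" using hull_ex by blast
  obtain c where c: "\<And>u v. mem u t \<Longrightarrow> mem v t \<Longrightarrow> mem (V.pr u v) c" using pair_power by blast
  obtain d where d: "\<And>x. mem x d \<longleftrightarrow> mem x t \<or> mem x c" using Un_ex by blast
  obtain q where q: "\<And>x. mem x q \<longleftrightarrow> (\<forall>z. mem z x \<longrightarrow> mem z d)" using powersets by blast
  obtain b where b: "\<And>x. A.inn x b \<longleftrightarrow> mem x q" using vapp_id[of q] inn_id by blast
  have "mem x q" if x: "A.sub x a" for x
    unfolding q
  proof (intro allI impI)
    fix z assume z: "mem z x"
    have *: "A.inn y x \<Longrightarrow> mem y t" for y using x t by (auto simp: A.sub_def)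
    show "mem z d"
    proof (cases "V.core x")
      case True
      then have "vapp x z z" using z by (simp add: vapp_core)
      then show ?thesis using * d A.inn_defined by blast
    next
      case False
      then obtain u v where uv: "z = V.pr u v" using mem_pr z by blast
      then have "vapp x u v" using z False by (simp add: vapp_pr)
      then show ?thesis unfolding uv using * d c A.inn_defined by blast
    qed
  qed
  then show ?thesis using b by blast
qed

text \<open>
  If \<open>x \<sqsubset> f\<close>, then \<open>x\<close> is a member of \<open>f\<close> or a component of a pair in \<open>f\<close>, thus at most four membership steps
  below \<open>f\<close>.  So \<open>\<in>\<close>-induction applies to the property that \<open>Q\<close> holds within three steps.
\<close>

lemma vapp_induct:
  assumes Q: "Cl Q" and step: "\<And>f. (\<And>x. A.inn x f \<Longrightarrow> Q x) \<Longrightarrow> Q f"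
  shows "Q f"
proof -
  \<comment> \<open>\<open>Q\<close> holds at \<open>y\<close> and everything at most three membership steps below it\<close>
  let ?R = "\<lambda>y. Q y \<and> (\<forall>a. mem a y \<longrightarrow> Q a \<and> (\<forall>b. mem b a \<longrightarrow> Q b \<and> (\<forall>c. mem c b \<longrightarrow> Q c)))"
  have "Cl ?R" by (rule ClI) (intro D_intros D_Cl[OF Q] V.gm_intros)
  then have "?R f"
  proof (rule mem_induct)
    fix y assume IH: "\<And>x. mem x y \<Longrightarrow> ?R x"
    have "Q u \<and> Q v" if "mem (V.pr u v) y" for u v
    proof -
      have "?R (V.pr u v)" using IH that by blast
      then show ?thesis by (simp add: V.pr_def)
    qed
    then have "Q x" if "A.inn x y" for x using inn_cases[OF that] IH by blast
    then have "Q y" by (rule step)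
    then show "?R y" using IH by blast
  qed
  then show ?thesis by blast
qed

text \<open>
  The axiom of infinity may provide sets outside the core, for which \<open>q\<close> need not be in the domain of its
  successor; so its set is restricted to \<open>\<emptyset>\<close> and the sets that contain \<open>\<emptyset>\<close>.
\<close>

lemma vapp_infinity: "\<exists>s p. A.inn p s \<and> (\<forall>q. A.inn q s \<longrightarrow> (\<exists>r. A.inn q r \<and> A.inn r s))"
proof -
  obtain w where w0: "\<exists>x. mem x w \<and> (\<forall>y. \<not> mem y x)"
    and ws: "\<And>x. mem x w \<Longrightarrow> \<exists>y. mem y w \<and> suc x y"
    using infinity unfolding suc_def by blast
  obtain x where "mem x w" "V.zero x" using w0 by (auto simp: V.zero_def)
  then have Z: "mem V.Z w" by (simp add: V.zero_iff)
  have "Cl (\<lambda>x. \<exists>z. V.zero z \<and> (x = z \<or> mem z x))" by (rule ClI) (intro D_intros V.gm_intros)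
  from separation[OF this, of w]
  obtain w' where w': "\<And>x. mem x w' \<longleftrightarrow> mem x w \<and> (x = V.Z \<or> mem V.Z x)"
    unfolding V.zero_iff by auto
  obtain s where s: "\<And>x. A.inn x s \<longleftrightarrow> mem x w'" using vapp_id[of w'] inn_id by blast
  have "\<exists>r. A.inn q r \<and> A.inn r s" if q: "A.inn q s" for q
  proof -
    have qw: "mem q w" "q = V.Z \<or> mem V.Z q" using q by (simp_all add: s w')
    obtain r where r: "mem r w" "suc q r" using ws[OF qw(1)] by blast
    have rq: "mem z r \<longleftrightarrow> mem z q \<or> z = q" for z using r(2) unfolding suc_def by (rule spec)
    have Zr: "mem V.Z r" using qw(2) rq by auto
    then have "V.core r" using V.core_wild V.wild_Z by simp
    then have "vapp r q q" by (simp add: vapp_core rq)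
    then have "A.inn q r" by (rule A.inn_defined)
    moreover have "A.inn r s" using r(1) Zr by (simp add: s w')
    ultimately show ?thesis by blast
  qed
  moreover have "A.inn V.Z s" using Z by (simp add: s w')
  ultimately show ?thesis by blast
qed

theorem vapp_founded: "founded_functions D vapp"
proof unfold_locales
  show "\<exists>h. \<forall>x y. vapp h x y \<longleftrightarrow> F x y" if F: "Fn F" and f: "\<And>x y. F x y \<Longrightarrow> A.inn x f" for F f
  proof -
    obtain t where "mem f t" "\<And>x y. mem x t \<Longrightarrow> A.inn y x \<Longrightarrow> mem y t" using hull_ex by blast
    then show ?thesis using f by (intro vapp_ex[OF F, of t]) blast
  qed
  show "\<exists>b. \<forall>x y. A.inn x a \<longrightarrow> A.inn y x \<longrightarrow> A.inn y b" for a
  proof -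
    obtain t where "mem a t" "\<And>x y. mem x t \<Longrightarrow> A.inn y x \<Longrightarrow> mem y t" using hull_ex by blast
    moreover obtain b where "\<And>x. A.inn x b \<longleftrightarrow> mem x t" using vapp_id[of t] inn_id by blast
    ultimately show ?thesis by blast
  qed
qed (fact vapp_fun vapp_ext vapp_infinity vapp_induct vapp_power)+

theorem mem_vapp: "A.memf x f \<longleftrightarrow> mem x f"
proof -
  interpret N: founded_functions D vapp by (rule vapp_founded)
  interpret linked D mem vapp
  proof unfold_locales
    show "\<exists>y. \<forall>z. mem z y \<longleftrightarrow> vapp f z z" for f
    proof -
      obtain t where t: "mem f t" "\<And>x y. mem x t \<Longrightarrow> A.inn y x \<Longrightarrow> mem y t" using hull_ex by blast
      have "Cl (\<lambda>z. vapp f z z)" by (rule ClI) (intro D_intros D_vapp)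
      then show ?thesis by (rule set_ex[of _ t]) (use t A.inn_defined in blast)
    qed
    show "\<exists>f. idf vapp f \<and> (\<forall>z. vapp f z z \<longleftrightarrow> mem z x)" for x
      using vapp_id[of x] by (auto simp: idf_def)
  qed (fact vapp_ext)
  have "vapp f x y \<longleftrightarrow> V.core f \<and> mem x f \<and> x = y \<or> \<not> V.core f \<and> mem (V.pr x y) f" for f x y
    by (cases "V.core f") (simp_all add: vapp_core vapp_pr)
  from mem_from_V[OF this, of x f] show ?thesis by (simp only: A.memf_def)
qed

end

theorem (in founded_functions) app_memf: "membership.vapp D memf f x y \<longleftrightarrow> app f x y"
proof -
  interpret Z: zf_sets D memf by (rule memf_zf)
  interpret linked D memf app
  proof unfold_locales
    show "\<exists>y. \<forall>z. memf z y \<longleftrightarrow> app f z z" for f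
    proof (rule memf_ex)
      show "small (\<lambda>z. app f z z)" by (rule small_mono[OF small_inn[of f]]) (rule inn_defined)
      show "Cl (\<lambda>z. app f z z)" by (rule ClI) (intro D_intros fl_intros)
    qed
    show "\<exists>f. idf app f \<and> (\<forall>z. app f z z \<longleftrightarrow> memf z x)" for x
      using small_ident[OF small_memf Cl_memf, of x] by (auto simp: ident_app idf_def)
  qed (fact app_ext)
  have "F.core f \<Longrightarrow> idf app f" for f using core_idf by (auto simp: idf_def)
  from app_from_F[OF memf_iff this, of f x y] show ?thesis by (simp only: Z.vapp_def)
qed

section \<open>The formulas\<close>

text \<open>
  The formulas that express the notions of \<open>guarded\<close>, for either language; the arguments are variables,
  and inside \<open>n\<close> object quantifiers a variable \<open>x\<close> from outside becomes \<open>x + n\<close>.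
\<close>

locale pair_formulas =
  fixes gf :: "nat \<Rightarrow> fm" and mf :: "nat \<Rightarrow> nat \<Rightarrow> fm"
begin

definition fZero where
  "fZero z = (gf z \<^bold>\<and> (\<^bold>\<forall> \<^bold>\<not> mf 0 (z + 1)))"

definition fTri where
  "fTri a b t = (gf t \<^bold>\<and> (\<^bold>\<forall> (mf 0 (t + 1) \<^bold>\<leftrightarrow> fZero 0 \<^bold>\<or> 0 \<^bold>= a + 1 \<^bold>\<or> 0 \<^bold>= b + 1)))"

definition fPar where
  "fPar u v w = (\<^bold>\<exists> \<^bold>\<exists> \<^bold>\<exists> \<^bold>\<exists> (fTri (u + 4) (u + 4) 3 \<^bold>\<and> fTri (v + 4) (v + 4) 2 \<^bold>\<and>
     fTri 3 3 1 \<^bold>\<and> fTri 3 2 0 \<^bold>\<and> fTri 1 0 (w + 4)))"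

definition fWild where
  "fWild x = ((\<^bold>\<exists> (mf 0 (x + 1) \<^bold>\<and> \<^bold>\<not> (\<^bold>\<exists> \<^bold>\<exists> fPar 1 0 2))) \<^bold>\<or>
     (\<^bold>\<exists> \<^bold>\<exists> \<^bold>\<exists> \<^bold>\<exists> \<^bold>\<exists> (fPar 4 3 1 \<^bold>\<and> fPar 4 2 0 \<^bold>\<and> mf 1 (x + 5) \<^bold>\<and> mf 0 (x + 5) \<^bold>\<and> \<^bold>\<not> 3 \<^bold>= 2)))"

definition fDiag where
  "fDiag y x = (\<^bold>\<forall> (mf 0 (x + 1) \<^bold>\<leftrightarrow> (\<^bold>\<exists> (mf 0 (y + 2) \<^bold>\<and> fPar 0 0 1))))"

definition fCore where
  "fCore x = All (Pred 1) ((\<^bold>\<forall> (gf 0 \<^bold>\<and> fWild 0 \<^bold>\<rightarrow> RelAt 0 [0])) \<^bold>\<and>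
     (\<^bold>\<forall> \<^bold>\<forall> (RelAt 0 [1] \<^bold>\<and> gf 0 \<^bold>\<and> fDiag 1 0 \<^bold>\<rightarrow> RelAt 0 [0])) \<^bold>\<rightarrow> RelAt 0 [x])"

lemmas gmf_defs = fZero_def fTri_def fPar_def fWild_def fDiag_def fCore_def

lemma formula_gmf:
  assumes "\<And>i. formula k (gf i)" "\<And>i j. formula k (mf i j)"
  shows "formula k (fPar u v w)" "formula k (fCore x)"
  using assms by (simp_all add: gmf_defs)

context
  assumes fv_gf: "\<And>i. fv (gf i) \<subseteq> {(Obj, i)}" and fv_mf: "\<And>i j. fv (mf i j) \<subseteq> {(Obj, i), (Obj, j)}"
begin

lemma fv_fZero: "fv (fZero z) \<subseteq> {(Obj, z)}"
  using fv_gf fv_mf[of 0 "z + 1"] by (auto simp: fZero_def split: if_splits)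

lemma fv_fTri: "fv (fTri a b t) \<subseteq> {(Obj, a), (Obj, b), (Obj, t)}"
  using fv_gf fv_mf[of 0 "t + 1"] fv_fZero[of 0] by (auto simp: fTri_def split: if_splits)

lemma fv_fPar: "fv (fPar u v w) \<subseteq> {(Obj, u), (Obj, v), (Obj, w)}"
  using fv_fTri[of "u + 4" "u + 4" 3] fv_fTri[of "v + 4" "v + 4" 2] fv_fTri[of 3 3 1]
    fv_fTri[of 3 2 0] fv_fTri[of 1 0 "w + 4"]
  by (auto simp: fPar_def numeral_eq_Suc split: if_splits)

lemma fv_fWild: "fv (fWild x) \<subseteq> {(Obj, x)}"
  using fv_mf[of 0 "x + 1"] fv_fPar[of 1 0 2] fv_fPar[of 4 3 1] fv_fPar[of 4 2 0]
    fv_mf[of 1 "x + 5"] fv_mf[of 0 "x + 5"]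
  by (auto simp: fWild_def numeral_eq_Suc split: if_splits)

lemma fv_fDiag: "fv (fDiag y x) \<subseteq> {(Obj, y), (Obj, x)}"
  using fv_mf[of 0 "x + 1"] fv_mf[of 0 "y + 2"] fv_fPar[of 0 0 1]
  by (auto simp: fDiag_def numeral_eq_Suc split: if_splits)

lemma fv_fCore: "fv (fCore x) \<subseteq> {(Obj, x)}"
  using fv_gf[of 0] fv_fWild[of 0] fv_fDiag[of 1 0]
  by (auto simp: fCore_def split: if_splits)

end

end

interpretation VF: pair_formulas "\<lambda>_. \<^bold>\<not> \<^bold>\<bottom>" "\<lambda>x y. x \<^bold>\<in> y" .

definition fIdf where
  "fIdf f = (\<^bold>\<forall> \<^bold>\<forall> (Val (f + 2) 1 0 \<^bold>\<rightarrow> 1 \<^bold>= 0))"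

interpretation FF: pair_formulas fIdf "\<lambda>x f. Val f x x" .

definition iotaP where
  "iotaP = ((VF.fCore 0 \<^bold>\<and> 1 \<^bold>\<in> 0 \<^bold>\<and> 1 \<^bold>= 2) \<^bold>\<or> (\<^bold>\<not> VF.fCore 0 \<^bold>\<and> (\<^bold>\<exists> (VF.fPar 2 3 0 \<^bold>\<and> 0 \<^bold>\<in> 1))))"

definition kappaP where
  "kappaP = ((FF.fCore 1 \<^bold>\<and> Val 1 0 0) \<^bold>\<or> (\<^bold>\<not> FF.fCore 1 \<^bold>\<and> (\<^bold>\<exists> \<^bold>\<exists> (FF.fPar 1 0 2 \<^bold>\<and> Val 3 1 0))))"

definition iota where "iota = Trans (\<^bold>\<not> \<^bold>\<bottom>) iotaP"
definition kappa where "kappa = Trans (\<^bold>\<not> \<^bold>\<bottom>) kappaP"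

lemma translation_iota: "translation 3 2 iota"
proof -
  have c: "fv (VF.fCore 0) \<subseteq> {(Obj, 0)}" by (rule VF.fv_fCore) auto
  have p: "fv (VF.fPar 2 3 0) \<subseteq> {(Obj, 2), (Obj, 3), (Obj, 0)}" by (rule VF.fv_fPar) auto
  have "fv iotaP \<subseteq> Pair Obj ` {..<3}"
    using c p by (auto simp: iotaP_def numeral_eq_Suc split: if_splits)
  then show ?thesis
    using VF.formula_gmf by (simp add: translation_def iota_def iotaP_def)
qed

lemma translation_kappa: "translation 2 3 kappa"
proof -
  have i: "fv (fIdf i) \<subseteq> {(Obj, i)}" for i
    by (auto simp: fIdf_def numeral_eq_Suc split: if_splits)
  have c: "fv (FF.fCore 1) \<subseteq> {(Obj, 1)}" by (rule FF.fv_fCore) (use i in auto)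
  have p: "fv (FF.fPar 1 0 2) \<subseteq> {(Obj, 1), (Obj, 0), (Obj, 2)}" by (rule FF.fv_fPar) (use i in auto)
  have "fv kappaP \<subseteq> Pair Obj ` {..<2}"
    using c p by (auto simp: kappaP_def numeral_eq_Suc split: if_splits)
  moreover have "formula 3 (fIdf i)" for i by (simp add: fIdf_def)
  ultimately show ?thesis
    using FF.formula_gmf by (simp add: translation_def kappa_def kappaP_def)
qed

subsection \<open>Truth\<close>

text \<open>
  \<open>M\<close> has the same second-order part as \<open>M0\<close> but another primitive, so definable classes and functions of
  \<open>M0\<close> interpret the second-order quantifiers of \<open>M\<close>.
\<close>

locale expanded_model = general_model k M0 for k and M0 :: "'a model" +
  fixes prm :: "'a list \<Rightarrow> bool"
begin

definition M :: "'a model" where "M = Model UNIV prm (rels M0) (funs M0)"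

lemma M_simps [simp]: "dom M = UNIV" "prim M = prm" "rels M = rels M0" "funs M = funs M0"
  by (simp_all add: M_def)

abbreviation at :: "'a env \<Rightarrow> nat \<Rightarrow> 'a" where "at e i \<equiv> ob (e Obj i)"

context
  fixes gf mf g m
  assumes guarded: "guarded DD g m"
    and gf: "\<And>e i. sat M e (gf i) \<longleftrightarrow> g (at e i)"
    and mf: "\<And>e i j. sat M e (mf i j) \<longleftrightarrow> m (at e i) (at e j)"
begin

interpretation G: guarded DD g m by (rule guarded)

lemma sat_fZero: "sat M e (pair_formulas.fZero gf mf z) \<longleftrightarrow> G.zero (at e z)"
  by (simp add: pair_formulas.fZero_def G.zero_def gf mf)

lemma sat_fTri: "sat M e (pair_formulas.fTri gf mf a b t) \<longleftrightarrow> G.tri (at e a) (at e b) (at e t)"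
  by (simp add: pair_formulas.fTri_def G.tri_def gf mf sat_fZero) blast

lemma sat_fPar: "sat M e (pair_formulas.fPar gf mf u v w) \<longleftrightarrow> G.par (at e u) (at e v) (at e w)"
  by (simp add: pair_formulas.fPar_def G.par_def sat_fTri numeral_eq_Suc)

lemma sat_fWild: "sat M e (pair_formulas.fWild gf mf x) \<longleftrightarrow> G.wild (at e x)"
  by (simp add: pair_formulas.fWild_def G.wild_def sat_fPar mf numeral_eq_Suc disj_imp)

lemma sat_fDiag: "sat M e (pair_formulas.fDiag gf mf y x) \<longleftrightarrow> G.diag (at e y) (at e x)"
  by (simp add: pair_formulas.fDiag_def G.diag_def sat_fPar mf numeral_eq_Suc) blast

lemma sat_fCore: "sat M e (pair_formulas.fCore gf mf x) \<longleftrightarrow> G.core (at e x)"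
proof -
  have "sat M e (pair_formulas.fCore gf mf x) \<longleftrightarrow> (\<forall>R\<in>rels M0 1.
     (\<forall>x. g x \<and> G.wild x \<longrightarrow> R [x]) \<and> (\<forall>y x. R [y] \<and> g x \<and> G.diag y x \<longrightarrow> R [x]) \<longrightarrow> R [at e x])"
    by (simp add: pair_formulas.fCore_def gf sat_fWild sat_fDiag, intro ball_cong refl, blast)
  also have "\<dots> \<longleftrightarrow> G.core (at e x)"
    unfolding G.core_def by (rule Ball_rels)
  finally show ?thesis .
qed

end


definition memp :: "'a \<Rightarrow> 'a \<Rightarrow> bool" where "memp x y \<longleftrightarrow> prm [x, y]"

lemma sat_Mem: "sat M e (x \<^bold>\<in> y) \<longleftrightarrow> memp (at e x) (at e y)"
  by (simp add: memp_def)

lemma sat_iotaP: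
  assumes "membership DD memp"
  shows "sat M e iotaP \<longleftrightarrow> membership.vapp DD memp (at e 0) (at e 1) (at e 2)"
proof -
  interpret S: membership DD memp by fact
  note sat = sat_fPar[OF S.V.guarded_axioms _ sat_Mem] sat_fCore[OF S.V.guarded_axioms _ sat_Mem]
  show ?thesis
    by (simp add: iotaP_def sat S.vapp_def sat_Mem numeral_eq_Suc del: sat.simps(2), blast)
qed

lemma sat_ZF:
  assumes "membership DD memp"
  shows "(\<forall>a\<in>ZF. sat M e a) \<longleftrightarrow> zf_sets DD memp"
proof -
  interpret S: membership DD memp by fact
  have sep: "sat M e Separation \<longleftrightarrow> (\<forall>P. Cl P \<longrightarrow> (\<forall>a. \<exists>b. \<forall>x. memp x b \<longleftrightarrow> memp x a \<and> P x))"
  proof -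
    have "sat M e Separation \<longleftrightarrow> (\<forall>R\<in>rels M0 1. \<forall>a. \<exists>b. \<forall>x. memp x b \<longleftrightarrow> memp x a \<and> R [x])"
      by (simp add: Separation_def memp_def iff_conv_conj_imp imp_conjL numeral_eq_Suc)
    also have "\<dots> \<longleftrightarrow> (\<forall>P. Cl P \<longrightarrow> (\<forall>a. \<exists>b. \<forall>x. memp x b \<longleftrightarrow> memp x a \<and> P x))"
      by (rule Ball_rels)
    finally show ?thesis .
  qed
  have repl: "sat M e Replacement \<longleftrightarrow>
      (\<forall>F. Fn F \<longrightarrow> (\<forall>a. \<exists>b. \<forall>y. memp y b \<longleftrightarrow> (\<exists>x. memp x a \<and> F x y)))"
  proof -
    have "sat M e Replacement \<longleftrightarrow>
        (\<forall>F\<in>funs M0. \<forall>a. \<exists>b. \<forall>y. memp y b \<longleftrightarrow> (\<exists>x. memp x a \<and> F x y))"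
      by (simp add: Replacement_def memp_def numeral_eq_Suc,
          intro ball_cong all_cong1 ex_cong1 refl, blast)
    then show ?thesis by (simp add: Fn_funs Ball_def)
  qed
  have ext: "sat M e Extensionality \<longleftrightarrow> (\<forall>x y. (\<forall>z. memp z x \<longleftrightarrow> memp z y) \<longrightarrow> x = y)"
    by (simp add: Extensionality_def memp_def iff_conv_conj_imp imp_conjL numeral_eq_Suc)
  have pair: "sat M e Pairing \<longleftrightarrow> (\<forall>a b. \<exists>c. \<forall>x. memp x c \<longleftrightarrow> x = a \<or> x = b)"
    by (simp add: Pairing_def memp_def iff_conv_conj_imp imp_conjL disj_imp numeral_eq_Suc)
  have un: "sat M e Unions \<longleftrightarrow> (\<forall>a. \<exists>b. \<forall>x. memp x b \<longleftrightarrow> (\<exists>y. memp y a \<and> memp x y))"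
    by (simp add: Unions_def memp_def numeral_eq_Suc, intro all_cong1 ex_cong1, blast)
  have pow: "sat M e Powersets \<longleftrightarrow> (\<forall>a. \<exists>b. \<forall>x. memp x b \<longleftrightarrow> (\<forall>z. memp z x \<longrightarrow> memp z a))"
    by (simp add: Powersets_def memp_def numeral_eq_Suc, intro all_cong1 ex_cong1, blast)
  have inf: "sat M e Infinity \<longleftrightarrow> (\<exists>w. (\<exists>x. memp x w \<and> (\<forall>y. \<not> memp y x)) \<and>
      (\<forall>x. memp x w \<longrightarrow> (\<exists>y. memp y w \<and> (\<forall>z. memp z y \<longleftrightarrow> memp z x \<or> z = x))))"
    by (simp add: Infinity_def memp_def iff_conv_conj_imp imp_conjL disj_imp numeral_eq_Suc)
  have found: "sat M e Foundation \<longleftrightarrow>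
      (\<forall>a. (\<exists>x. memp x a) \<longrightarrow> (\<exists>x. memp x a \<and> \<not> (\<exists>y. memp y x \<and> memp y a)))"
    by (simp add: Foundation_def memp_def numeral_eq_Suc)
  show ?thesis
    unfolding ZF_def zf_sets_def zf_sets_axioms_def ball_simps sep repl ext pair un pow inf found
    by (simp add: assms)
qed

definition appp :: "'a \<Rightarrow> 'a \<Rightarrow> 'a \<Rightarrow> bool" where "appp f x y \<longleftrightarrow> prm [f, x, y]"

lemma sat_Val: "sat M e (Val f x y) \<longleftrightarrow> appp (at e f) (at e x) (at e y)"
  by (simp add: appp_def)

lemma sat_fIdf: "sat M e (fIdf f) \<longleftrightarrow> idf appp (at e f)"
  by (simp add: fIdf_def idf_def appp_def numeral_eq_Suc)

lemma sat_kappaP: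
  assumes "application DD appp"
  shows "sat M e kappaP \<longleftrightarrow> application.memf DD appp (at e 0) (at e 1)"
proof -
  interpret S: application DD appp by fact
  note sat = sat_fPar[OF S.F.guarded_axioms sat_fIdf sat_Val] sat_fCore[OF S.F.guarded_axioms sat_fIdf sat_Val]
  show ?thesis
    by (simp add: kappaP_def sat S.memf_def sat_Val numeral_eq_Suc del: sat.simps(2), blast)
qed

context
  assumes application: "application DD appp"
begin

interpretation S: application DD appp by (rule application)

lemma sat_Defined: "sat M e (Defined f x) \<longleftrightarrow> S.defined (at e f) (at e x)"
  by (simp add: Defined_def S.defined_def appp_def)

lemma sat_In: "sat M e (x \<^bold>\<sqsubset> f) \<longleftrightarrow> S.inn (at e x) (at e f)"
  by (simp add: In_def S.inn_def sat_Defined appp_def disj_imp)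

lemma sat_Sub: "sat M e (x \<^bold>\<sqsubseteq> f) \<longleftrightarrow> S.sub (at e x) (at e f)"
  by (simp add: Sub_def S.sub_def sat_In)

lemma sat_IsIdOn:
  "sat M e (IsIdOn f p) \<longleftrightarrow> S.ident (at e f) (\<lambda>x. sat M (push Obj (VO x) e) p)"
  by (simp add: IsIdOn_def S.ident_def sat_Defined appp_def) blast

lemma sat_IsPi: "sat M e (IsPi a f) \<longleftrightarrow> S.isPi (at e a) (at e f)"
  by (simp add: IsPi_def S.isPi_def sat_IsIdOn sat_In sat_Sub)

lemma sat_Fist: "sat M e (Fist h) \<longleftrightarrow> S.fist (at e h)"
  by (simp add: Fist_def S.fist_def sat_IsIdOn sat_In sat_IsPi numeral_eq_Suc)

lemma sat_Fev: "sat M e (Fev s) \<longleftrightarrow> S.fev (at e s)"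
  by (simp add: Fev_def S.fev_def sat_Fist sat_IsPi)

lemma sat_SameAtF: "sat M e (SameAtF f P x) \<longleftrightarrow>
    ((\<exists>y. appp (at e f) (at e x) y) \<or> (\<exists>y. fn (e Func P) (at e x) y) \<longrightarrow>
     (\<exists>y. appp (at e f) (at e x) y \<and> fn (e Func P) (at e x) y))"
  by (simp add: SameAtF_def DefinedF_def sat_Defined S.defined_def appp_def disj_imp)

lemma sat_SameAt: "sat M e (SameAt f h x) \<longleftrightarrow>
    ((\<exists>y. appp (at e f) (at e x) y) \<or> (\<exists>y. appp (at e h) (at e x) y) \<longrightarrow>
     (\<exists>y. appp (at e f) (at e x) y \<and> appp (at e h) (at e x) y))"
  by (simp add: SameAt_def sat_Defined S.defined_def appp_def disj_imp)

lemma sat_FLT_ZF: "(\<forall>a\<in>FLT_ZF. sat M e a) \<longleftrightarrow> stratified_functions DD appp"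
proof -
  let ?fun = "\<forall>f x y z. appp f x y \<longrightarrow> appp f x z \<longrightarrow> y = z"
  have same: "(\<forall>x. (\<exists>y. A x y) \<or> (\<exists>y. B x y) \<longrightarrow> (\<exists>y. A x y \<and> B x y)) \<longleftrightarrow> (\<forall>x y. A x y \<longleftrightarrow> B x y)"
    if "functional A" "functional B" for A B :: "'a \<Rightarrow> 'a \<Rightarrow> bool"
    using that unfolding functional_def by metis
  have vf: "sat M e ValFunctional \<longleftrightarrow> ?fun"
    by (simp add: ValFunctional_def appp_def numeral_eq_Suc) blast
  have fext: "sat M e FunExt \<longleftrightarrow> (\<forall>f g. (\<forall>x y. appp f x y \<longleftrightarrow> appp g x y) \<longrightarrow> f = g)" if ?fun
  proof -
    have "functional (appp f)" for f using that by (auto simp: functional_def)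
    then have "(\<forall>x. (\<exists>y. appp f x y) \<or> (\<exists>y. appp g x y) \<longrightarrow> (\<exists>y. appp f x y \<and> appp g x y)) \<longleftrightarrow>
       (\<forall>x y. appp f x y \<longleftrightarrow> appp g x y)" for f g by (intro same)
    moreover have "sat M e FunExt \<longleftrightarrow> (\<forall>f g. (\<forall>x. (\<exists>y. appp f x y) \<or> (\<exists>y. appp g x y) \<longrightarrow>
        (\<exists>y. appp f x y \<and> appp g x y)) \<longrightarrow> f = g)"
      by (simp add: FunExt_def sat_SameAt numeral_eq_Suc)
    ultimately show ?thesis by simp
  qed
  have strat: "sat M e FunStrat \<longleftrightarrow> (\<forall>a. \<exists>s. S.fev s \<and> S.sub a s)"
    by (simp add: FunStrat_def sat_Fev sat_Sub)
  have inf: "sat M e FunInfinity \<longleftrightarrow>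
      (\<exists>s p. S.inn p s \<and> (\<forall>q. S.inn q s \<longrightarrow> (\<exists>r. S.inn q r \<and> S.inn r s)))"
    by (simp add: FunInfinity_def sat_In numeral_eq_Suc)
  have lam: "sat M (push Func (VF F) e) (LambdaExists 0) \<longleftrightarrow> (\<exists>h. \<forall>x y. appp h x y \<longleftrightarrow> F x y)"
    if ?fun "Fn F" for F
  proof -
    have "functional (appp f)" for f using that by (auto simp: functional_def)
    then have "(\<forall>x. (\<exists>y. appp h x y) \<or> (\<exists>y. F x y) \<longrightarrow> (\<exists>y. appp h x y \<and> F x y)) \<longleftrightarrow>
       (\<forall>x y. appp h x y \<longleftrightarrow> F x y)" for h
      using that(2) by (intro same) (simp_all add: Fn_def)
    then show ?thesis by (simp add: LambdaExists_def sat_SameAtF)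
  qed
  have super0: "sat M e FunSupercomp \<longleftrightarrow> (\<forall>F\<in>funs M0.
      (\<exists>f. \<forall>x. (\<exists>y. F x y) \<longrightarrow> S.inn x f) \<longrightarrow> sat M (push Func (VF F) e) (LambdaExists 0))"
    by (simp add: FunSupercomp_def DefinedF_def sat_In, intro ball_cong refl imp_cong ex_cong1, blast)
  have super: "sat M e FunSupercomp \<longleftrightarrow> (\<forall>F. Fn F \<longrightarrow> (\<forall>f. (\<forall>x y. F x y \<longrightarrow> S.inn x f) \<longrightarrow>
      (\<exists>h. \<forall>x y. appp h x y \<longleftrightarrow> F x y)))" if ?fun
  proof -
    have "((\<exists>f. \<forall>x. (\<exists>y. F x y) \<longrightarrow> S.inn x f) \<longrightarrow> sat M (push Func (VF F) e) (LambdaExists 0)) \<longleftrightarrow>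
        (\<forall>f. (\<forall>x y. F x y \<longrightarrow> S.inn x f) \<longrightarrow> (\<exists>h. \<forall>x y. appp h x y \<longleftrightarrow> F x y))" if "Fn F" for F
      unfolding lam[OF \<open>?fun\<close> that] by blast
    then have "(\<forall>F. Fn F \<longrightarrow> ((\<exists>f. \<forall>x. (\<exists>y. F x y) \<longrightarrow> S.inn x f) \<longrightarrow>
          sat M (push Func (VF F) e) (LambdaExists 0))) \<longleftrightarrow>
        (\<forall>F. Fn F \<longrightarrow> (\<forall>f. (\<forall>x y. F x y \<longrightarrow> S.inn x f) \<longrightarrow> (\<exists>h. \<forall>x y. appp h x y \<longleftrightarrow> F x y)))"
      by (intro all_cong1 imp_cong refl)
    then show ?thesis by (simp only: super0 Ball_def Fn_funs)
  qed
  have comp0: "sat M e FunComp \<longleftrightarrow> (\<forall>F\<in>funs M0.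
      (\<exists>f. \<forall>x. (\<exists>y. F x y) \<longrightarrow> S.inn x f \<and> (\<exists>y. F x y \<and> S.inn y f)) \<longrightarrow>
      sat M (push Func (VF F) e) (LambdaExists 0))"
    by (simp add: FunComp_def DefinedF_def sat_In numeral_eq_Suc,
        intro ball_cong refl imp_cong ex_cong1, blast)
  have comp: "sat M e FunComp" if "sat M e FunSupercomp"
    using that unfolding super0 comp0 by blast
  have "(\<forall>a\<in>FLT_ZF. sat M e a) \<longleftrightarrow> sat M e ValFunctional \<and> sat M e FunExt \<and> sat M e FunStrat \<and>
      sat M e FunInfinity \<and> sat M e FunSupercomp"
    unfolding FLT_ZF_def FLT_def using comp by auto
  also have "\<dots> \<longleftrightarrow> stratified_functions DD appp"
  proof (cases ?fun)
    case True
    have "sat M e FunSupercomp \<longleftrightarrow> (\<forall>F f. Fn F \<longrightarrow> (\<forall>x y. F x y \<longrightarrow> S.inn x f) \<longrightarrow>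
      (\<exists>h. \<forall>x y. appp h x y \<longleftrightarrow> F x y))"
      unfolding super[OF True] by (simp only: all_simps)
    then show ?thesis
      unfolding stratified_functions_def function_universe_def stratified_functions_axioms_def function_universe_axioms_def vf strat inf fext[OF True]
      using application True by argo
  next
    case False
    then show ?thesis unfolding stratified_functions_def function_universe_def function_universe_axioms_def vf by argo
  qed
  finally show ?thesis .
qed

end

end

section \<open>Translations and models\<close>

lemma sat_plug:
  "sat M e (plug p ts) = sat M (\<lambda>s i. if s = Obj \<and> i < length ts then e Obj (ts ! i) else e s i) p"
  unfolding plug_def sat_ren by (rule arg_cong2[of _ _ _ _ "sat M"]) (auto simp: fun_eq_iff)

lemma sat_inDom2:
  assumes "domain \<tau> = (\<^bold>\<not> \<^bold>\<bottom>)"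
  shows "sat M e (inDom2 \<tau> s)"
proof -
  have d: "sat M e (inDom \<tau> x)" for e x by (simp add: inDom_def assms plug_def)
  have "sat M e (foldr (\<lambda>i p. inDom \<tau> i \<^bold>\<and> p) is (\<^bold>\<not> \<^bold>\<bottom>))" for e "is"
    by (induction "is") (simp_all add: d)
  then show ?thesis by (cases s) (simp_all add: d sat_Alls)
qed

lemma sat_translate:
  assumes "domain \<tau> = (\<^bold>\<not> \<^bold>\<bottom>)"
    and "dom M' = dom M" "rels M' = rels M" "funs M' = funs M"
    and prim: "\<And>e ts. length ts = l \<Longrightarrow>
      sat M e (plug (primitive \<tau>) ts) \<longleftrightarrow> prim M' (map (\<lambda>i. ob (e Obj i)) ts)"
  shows "formula l p \<Longrightarrow> sat M e (translate \<tau> p) \<longleftrightarrow> sat M' e p"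
proof (induction p arbitrary: e)
  case (All s p)
  have "vals M' s = vals M s" using assms(2-4) by (cases s) simp_all
  then show ?case using All by (simp add: sat_inDom2[OF assms(1)])
qed (simp_all add: prim)

lemma formula_translate:
  assumes "domain \<tau> = (\<^bold>\<not> \<^bold>\<bottom>)" "formula k (primitive \<tau>)"
  shows "formula k (translate \<tau> p)"
proof (induction p)
  case (All s p)
  have d: "formula k (inDom \<tau> x)" for x by (simp add: inDom_def assms plug_def)
  have "formula k (foldr (\<lambda>i p. inDom \<tau> i \<^bold>\<and> p) is (\<^bold>\<not> \<^bold>\<bottom>))" for "is"
    by (induction "is") (simp_all add: d)
  then show ?case using All by (cases s) (simp_all add: d)
qed (simp_all add: plug_def assms)

text \<open>
  Comprehension for \<open>p\<close> in the new model is comprehension for the translation of \<open>p\<close> in the old one.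
\<close>

lemma henkin_translate:
  assumes "henkin k M" and t: "domain \<tau> = (\<^bold>\<not> \<^bold>\<bottom>)" "formula k (primitive \<tau>)"
    and M': "dom M' = dom M" "rels M' = rels M" "funs M' = funs M"
    and prim: "\<And>e ts. length ts = l \<Longrightarrow>
      sat M e (plug (primitive \<tau>) ts) \<longleftrightarrow> prim M' (map (\<lambda>i. ob (e Obj i)) ts)"
  shows "henkin l M'"
proof -
  have "vals M' s = vals M s" for s using M' by (cases s) simp_all
  then have v: "valid M' e = valid M e" for e by (simp add: valid_def)
  have s: "formula l p \<Longrightarrow> sat M' e p = sat M e (translate \<tau> p)" for e p
    using sat_translate[OF t(1) M' prim] by blast
  have "relOf M' n p e = relOf M n (translate \<tau> p) e" "funOf M' p e = funOf M (translate \<tau> p) e"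
    if "formula l p" for n p e
    using s[OF that] by (simp_all add: relOf_def funOf_def M' fun_eq_iff)
  then show ?thesis
    using assms(1) formula_translate[OF t] unfolding henkin_def M' v by simp
qed

subsection \<open>Models are infinite\<close>

text \<open>Taking singletons is injective and misses the empty set.\<close>

lemma infinite_ZF:
  assumes "henkin k M" and A: "\<And>e a. valid M e \<Longrightarrow> a \<in> ZF \<Longrightarrow> sat M e a"
  shows "infinite (dom M)"
proof
  assume fin: "finite (dom M)"
  obtain e where "valid M e" using assms(1) by (auto simp: henkin_def)
  then have "sat M e Pairing" "sat M e Infinity" using A by (simp_all add: ZF_def)
  then have "\<forall>a\<in>dom M. \<forall>b\<in>dom M. \<exists>c\<in>dom M. \<forall>x\<in>dom M. prim M [x, c] \<longleftrightarrow> x = a \<or> x = b"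
    by (simp add: Pairing_def iff_conv_conj_imp imp_conjL disj_imp numeral_eq_Suc)
  then have P: "\<forall>a\<in>dom M. \<exists>c\<in>dom M. \<forall>x\<in>dom M. prim M [x, c] \<longleftrightarrow> x = a" by fastforce
  have "\<exists>z\<in>dom M. \<forall>x\<in>dom M. \<not> prim M [x, z]"
    using \<open>sat M e Infinity\<close> by (simp add: Infinity_def numeral_eq_Suc) blast
  then obtain z where z: "z \<in> dom M" "\<forall>x\<in>dom M. \<not> prim M [x, z]" by blast
  obtain f where f: "\<And>a. a \<in> dom M \<Longrightarrow> f a \<in> dom M"
    "\<And>a x. a \<in> dom M \<Longrightarrow> x \<in> dom M \<Longrightarrow> prim M [x, f a] \<longleftrightarrow> x = a"
    using bchoice[OF P[unfolded Bex_def]] by blast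
  have "inj_on f (dom M)" using f by (metis inj_onI)
  then have "f ` dom M = dom M" using f(1) fin by (intro endo_inj_surj) auto
  then obtain a where "a \<in> dom M" "z = f a" using z(1) by blast
  then show False using z(2) f(2) by blast
qed

text \<open>
  With \<open>p \<sqsubset> s\<close> from the axiom of infinity, the map from \<open>v\<close> to the function with the single value \<open>v\<close> at \<open>p\<close> is
  injective and misses the empty function.
\<close>

lemma infinite_FLT_ZF:
  assumes H: "henkin k M" and A: "\<And>e a. valid M e \<Longrightarrow> a \<in> FLT_ZF \<Longrightarrow> sat M e a"
  shows "infinite (dom M)"
proof
  assume fin: "finite (dom M)"
  obtain e where e: "valid M e" using H by (auto simp: henkin_def)
  then have super: "sat M e FunSupercomp" and "sat M e FunInfinity"
    using A by (simp_all add: FLT_ZF_def)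
  then obtain s p where s: "s \<in> dom M" "p \<in> dom M" "sat M (push Obj (VO p) (push Obj (VO s) e)) (0 \<^bold>\<sqsubset> 1)"
    by (auto simp: FunInfinity_def)
  let ?inn = "\<lambda>x. (\<exists>y\<in>dom M. prim M [s, x, y]) \<or> (\<exists>y\<in>dom M. prim M [s, y, x])"
  have p: "?inn p" using s(3) by (auto simp: In_def Defined_def numeral_eq_Suc)
  have L: "\<exists>h\<in>dom M. \<forall>x\<in>dom M. \<forall>y\<in>dom M. prim M [h, x, y] \<longleftrightarrow> x = p \<and> y \<in> V"
    if V: "V = {} \<or> (\<exists>v\<in>dom M. V = {v})" for V
  proof -
    define F where "F = (\<lambda>x y. x = p \<and> y \<in> V)"
    have "F \<in> funs M"
    proof (cases "V = {}")
      case True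
      then have "F = funOf M \<^bold>\<bottom> e" by (simp add: F_def funOf_def)
      moreover have "functional F" using True by (simp add: F_def functional_def)
      ultimately show ?thesis using H e by (auto simp: henkin_def)
    next
      case False
      then obtain v where v: "v \<in> dom M" "V = {v}" using V by blast
      let ?e = "push Obj (VO p) (push Obj (VO v) e)"
      have "F = funOf M (1 \<^bold>= 2 \<^bold>\<and> 0 \<^bold>= 3) ?e"
        using v s(2) by (auto simp: F_def funOf_def fun_eq_iff numeral_eq_Suc)
      moreover have "functional F" using v by (simp add: F_def functional_def)
      moreover have "valid M ?e" using e v s by (intro valid_push) auto
      moreover have "formula k (1 \<^bold>= 2 \<^bold>\<and> 0 \<^bold>= 3)" by simp
      ultimately show ?thesis using H unfolding henkin_def by metis
    qed
    moreover have "F x y \<Longrightarrow> ?inn x" for x y using p by (simp add: F_def)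
    ultimately have "sat M (push Func (VF F) e) (LambdaExists 0)"
      using super s(1)
      by (simp add: FunSupercomp_def DefinedF_def In_def Defined_def numeral_eq_Suc) blast
    then have "\<exists>h\<in>dom M. \<forall>x\<in>dom M. (\<forall>y\<in>dom M. \<not> prim M [h, x, y]) \<and> (\<forall>y\<in>dom M. \<not> F x y) \<or>
        (\<exists>y\<in>dom M. prim M [h, x, y] \<and> F x y)"
      by (simp add: LambdaExists_def SameAtF_def Defined_def DefinedF_def numeral_eq_Suc)
    then obtain h where h: "h \<in> dom M" "\<And>x. x \<in> dom M \<Longrightarrow>
        (\<forall>y\<in>dom M. \<not> prim M [h, x, y]) \<and> (\<forall>y\<in>dom M. \<not> F x y) \<or>
        (\<exists>y\<in>dom M. prim M [h, x, y] \<and> F x y)" by blast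
    have "sat M e ValFunctional" using A e by (simp add: FLT_ZF_def FLT_def)
    then have "prim M [h, x, y] \<Longrightarrow> prim M [h, x, z] \<Longrightarrow> y = z"
      if "x \<in> dom M" "y \<in> dom M" "z \<in> dom M" for x y z
      using that h(1) by (simp add: ValFunctional_def numeral_eq_Suc)
    then have "prim M [h, x, y] \<longleftrightarrow> F x y" if "x \<in> dom M" "y \<in> dom M" for x y
      using h(2)[OF that(1)] that V by (auto simp: F_def)
    then show ?thesis using h(1) by (auto simp: F_def)
  qed
  obtain z where z: "z \<in> dom M" "\<forall>x\<in>dom M. \<forall>y\<in>dom M. \<not> prim M [z, x, y]"
    using L[of "{}"] by auto
  have P: "\<forall>v\<in>dom M. \<exists>h\<in>dom M. \<forall>x\<in>dom M. \<forall>y\<in>dom M. prim M [h, x, y] \<longleftrightarrow> x = p \<and> y = v"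
  proof
    fix v assume "v \<in> dom M"
    then show "\<exists>h\<in>dom M. \<forall>x\<in>dom M. \<forall>y\<in>dom M. prim M [h, x, y] \<longleftrightarrow> x = p \<and> y = v"
      using L[of "{v}"] by auto
  qed
  obtain f where f: "\<And>v. v \<in> dom M \<Longrightarrow> f v \<in> dom M" "\<And>v x y. v \<in> dom M \<Longrightarrow> x \<in> dom M \<Longrightarrow>
      y \<in> dom M \<Longrightarrow> prim M [f v, x, y] \<longleftrightarrow> x = p \<and> y = v"
    using bchoice[OF P[unfolded Bex_def]] by blast
  have "inj_on f (dom M)" using f s(2) by (metis inj_onI)
  then have "f ` dom M = dom M" using f(1) fin by (intro endo_inj_surj) auto
  then obtain v where "v \<in> dom M" "z = f v" using z(1) by blast
  then show False using z(2) f(2) s(2) by blast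
qed

subsection \<open>Each model of one theory yields a model of the other\<close>

lemma list2: "length ts = 2 \<Longrightarrow> \<exists>x y. ts = [x, y]"
  by (auto simp: numeral_eq_Suc length_Suc_conv)

lemma list3: "length ts = 3 \<Longrightarrow> \<exists>x y z. ts = [x, y, z]"
  by (auto simp: numeral_eq_Suc length_Suc_conv)

lemma ZF_model:
  fixes M :: "'a model"
  assumes H: "henkin 2 M" "dom M = UNIV" and A: "\<And>e a. valid M e \<Longrightarrow> a \<in> ZF \<Longrightarrow> sat M e a"
  obtains M' where "henkin 3 M'" "\<forall>e. valid M' e = valid M e"
    "\<forall>e. \<forall>a\<in>FLT_ZF. sat M' e a"
    "\<forall>e p. formula 3 p \<longrightarrow> (sat M e (translate iota p) \<longleftrightarrow> sat M' e p)"
    "\<forall>e p. formula 2 p \<longrightarrow> (sat M' e (translate kappa p) \<longleftrightarrow> sat M e p)"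
proof -
  interpret I: expanded_model 2 M "prim M" using H by unfold_locales
  have self: "I.M = M" by (rule model.expand) (simp add: H(2))
  have membership: "membership I.DD I.memp"
  proof
    show "I.DD (\<lambda>e c. I.memp (e 0) (e 1))"
      using I.DD_varr[of "0 \<^bold>\<in> 1"] by (simp add: I.asg_varr I.memp_def)
  qed
  obtain e0 where e0: "valid M e0" using H(1) by (auto simp: henkin_def)
  have zf_sets: "zf_sets I.DD I.memp" using I.sat_ZF[OF membership, of e0] A[OF e0] by (simp add: self)
  interpret Z: zf_sets I.DD I.memp by (rule zf_sets)
  interpret N: founded_functions I.DD Z.vapp by (rule Z.vapp_founded)
  define prm where "prm ts = Z.vapp (ts ! 0) (ts ! 1) (ts ! 2)" for ts
  interpret J: expanded_model 2 M prm by unfold_locales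
  have app: "J.appp = Z.vapp" by (simp add: J.appp_def prm_def fun_eq_iff)
  have prim1: "sat M e (plug (primitive iota) ts) \<longleftrightarrow> prim J.M (map (\<lambda>i. ob (e Obj i)) ts)"
    if "length ts = 3" for e ts
    using list3[OF that] I.sat_iotaP[OF membership] unfolding self
    by (auto simp: iota_def sat_plug prm_def)
  have d: "domain iota = (\<^bold>\<not> \<^bold>\<bottom>)" "domain kappa = (\<^bold>\<not> \<^bold>\<bottom>)" by (simp_all add: iota_def kappa_def)
  have "henkin 3 J.M"
    by (rule henkin_translate[OF H(1) d(1) _ _ _ _ prim1])
      (use translation_iota H(2) in \<open>simp_all add: translation_def\<close>)
  moreover have "vals J.M s = vals M s" for s using H(2) by (cases s) simp_all
  then have "valid J.M e = valid M e" for e by (simp add: valid_def)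
  moreover have "sat J.M e a" if "a \<in> FLT_ZF" for e a
  proof -
    have "application I.DD J.appp" unfolding app by (rule Z.A.application_axioms)
    moreover have "stratified_functions I.DD J.appp" unfolding app
      by unfold_locales (rule N.strat)
    ultimately show ?thesis using J.sat_FLT_ZF that by blast
  qed
  moreover have "sat M e (translate iota p) \<longleftrightarrow> sat J.M e p" if "formula 3 p" for e p
    by (rule sat_translate[OF d(1) _ _ _ prim1 that]) (simp_all add: H(2))
  moreover have "sat J.M e (translate kappa p) \<longleftrightarrow> sat M e p" if "formula 2 p" for e p
  proof (rule sat_translate[OF d(2) _ _ _ _ that])
    fix e ts assume "length (ts :: nat list) = 2"
    moreover have "application I.DD J.appp" unfolding app by (rule Z.A.application_axioms)
    ultimately show "sat J.M e (plug (primitive kappa) ts) \<longleftrightarrow> prim M (map (\<lambda>i. ob (e Obj i)) ts)"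
      using list2[of ts] J.sat_kappaP[of _] Z.mem_vapp
      by (auto simp: kappa_def sat_plug app I.memp_def)
  qed (simp_all add: H(2))
  ultimately show ?thesis by (intro that[of J.M]) blast+
qed

lemma FLT_ZF_model:
  fixes M :: "'a model"
  assumes H: "henkin 3 M" "dom M = UNIV" and A: "\<And>e a. valid M e \<Longrightarrow> a \<in> FLT_ZF \<Longrightarrow> sat M e a"
  obtains M' where "henkin 2 M'" "\<forall>e. valid M' e = valid M e"
    "\<forall>e. \<forall>a\<in>ZF. sat M' e a"
    "\<forall>e p. formula 2 p \<longrightarrow> (sat M e (translate kappa p) \<longleftrightarrow> sat M' e p)"
    "\<forall>e p. formula 3 p \<longrightarrow> (sat M' e (translate iota p) \<longleftrightarrow> sat M e p)"
proof -
  interpret I: expanded_model 3 M "prim M" using H by unfold_locales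
  have self: "I.M = M" by (rule model.expand) (simp add: H(2))
  have application: "application I.DD I.appp"
  proof
    show "I.DD (\<lambda>e c. I.appp (e 0) (e 1) (e 2))"
      using I.DD_varr[of "Val 0 1 2"] by (simp add: I.asg_varr I.appp_def)
  qed
  obtain e0 where e0: "valid M e0" using H(1) by (auto simp: henkin_def)
  have stratified_functions: "stratified_functions I.DD I.appp" using I.sat_FLT_ZF[OF application, of e0] A[OF e0] by (simp add: self)
  interpret N: stratified_functions I.DD I.appp by (rule stratified_functions)
  interpret Z: zf_sets I.DD N.memf by (rule N.memf_zf)
  define prm where "prm ts = N.memf (ts ! 0) (ts ! 1)" for ts
  interpret J: expanded_model 3 M prm by unfold_locales
  have mem: "J.memp = N.memf" by (simp add: J.memp_def prm_def fun_eq_iff)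
  have prim1: "sat M e (plug (primitive kappa) ts) \<longleftrightarrow> prim J.M (map (\<lambda>i. ob (e Obj i)) ts)"
    if "length ts = 2" for e ts
    using list2[OF that] I.sat_kappaP[OF application] unfolding self
    by (auto simp: kappa_def sat_plug prm_def)
  have d: "domain iota = (\<^bold>\<not> \<^bold>\<bottom>)" "domain kappa = (\<^bold>\<not> \<^bold>\<bottom>)" by (simp_all add: iota_def kappa_def)
  have "henkin 2 J.M"
    by (rule henkin_translate[OF H(1) d(2) _ _ _ _ prim1])
      (use translation_kappa H(2) in \<open>simp_all add: translation_def\<close>)
  moreover have "vals J.M s = vals M s" for s using H(2) by (cases s) simp_all
  then have "valid J.M e = valid M e" for e by (simp add: valid_def)
  moreover have "sat J.M e a" if "a \<in> ZF" for e a
    using J.sat_ZF[of e] that unfolding mem using Z.membership_axioms Z.zf_sets_axioms by blast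
  moreover have "sat M e (translate kappa p) \<longleftrightarrow> sat J.M e p" if "formula 2 p" for e p
    by (rule sat_translate[OF d(2) _ _ _ prim1 that]) (simp_all add: H(2))
  moreover have "sat J.M e (translate iota p) \<longleftrightarrow> sat M e p" if "formula 3 p" for e p
  proof (rule sat_translate[OF d(1) _ _ _ _ that])
    fix e ts assume "length (ts :: nat list) = 3"
    moreover have "membership I.DD J.memp" unfolding mem by (rule Z.membership_axioms)
    ultimately show "sat J.M e (plug (primitive iota) ts) \<longleftrightarrow> prim M (map (\<lambda>i. ob (e Obj i)) ts)"
      using list3[of ts] J.sat_iotaP[of _] N.app_memf
      by (auto simp: iota_def sat_plug mem I.appp_def)
  qed (simp_all add: H(2))
  ultimately show ?thesis by (intro that[of J.M]) blast+
qed

lemma formula_iota: "formula 2 (translate iota p)" and formula_kappa: "formula 3 (translate kappa p)"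
  using translation_iota translation_kappa
  by (auto simp: translation_def iota_def kappa_def intro!: formula_translate)

lemma ZF_completeness:
  assumes "formula 2 p" "\<And>(M :: nat model) e. henkin 2 M \<Longrightarrow> dom M = UNIV \<Longrightarrow>
        (\<And>e a. valid M e \<Longrightarrow> a \<in> ZF \<Longrightarrow> sat M e a) \<Longrightarrow> valid M e \<Longrightarrow> sat M e p"
  shows "ZF \<turnstile>\<^bsub>2\<^esub> p"
  by (rule completeness[OF sentence_ZF assms(1) infinite_ZF assms(2)])

lemma FLT_ZF_completeness:
  assumes "formula 3 p" "\<And>(M :: nat model) e. henkin 3 M \<Longrightarrow> dom M = UNIV \<Longrightarrow>
        (\<And>e a. valid M e \<Longrightarrow> a \<in> FLT_ZF \<Longrightarrow> sat M e a) \<Longrightarrow> valid M e \<Longrightarrow> sat M e p"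
  shows "FLT_ZF \<turnstile>\<^bsub>3\<^esub> p"
  by (rule completeness[OF sentence_FLT_ZF assms(1) infinite_FLT_ZF assms(2)])

theorem mainTheorem1:
  shows "\<exists>\<iota> \<kappa>. translation 3 2 \<iota> \<and> translation 2 3 \<kappa> \<and>
    (\<forall>\<phi>. sentence 3 \<phi> \<longrightarrow> (FLT_ZF \<turnstile>\<^bsub>3\<^esub> \<phi>) \<longrightarrow> (ZF \<turnstile>\<^bsub>2\<^esub> translate \<iota> \<phi>)) \<and>
    (\<forall>\<phi>. sentence 2 \<phi> \<longrightarrow> (ZF \<turnstile>\<^bsub>2\<^esub> \<phi>) \<longrightarrow> (FLT_ZF \<turnstile>\<^bsub>3\<^esub> translate \<kappa> \<phi>)) \<and>
    (\<forall>\<phi>. formula 2 \<phi> \<longrightarrow> (ZF \<turnstile>\<^bsub>2\<^esub> \<phi> \<^bold>\<leftrightarrow> translate \<iota> (translate \<kappa> \<phi>))) \<and>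
    (\<forall>\<phi>. formula 3 \<phi> \<longrightarrow> (FLT_ZF \<turnstile>\<^bsub>3\<^esub> \<phi> \<^bold>\<leftrightarrow> translate \<kappa> (translate \<iota> \<phi>)))"
proof (rule exI[of _ iota], rule exI[of _ kappa], intro conjI allI impI translation_iota translation_kappa)
  fix \<phi> assume p: "FLT_ZF \<turnstile>\<^bsub>3\<^esub> \<phi>"
  have f: "formula 3 \<phi>" using p by (rule proves_formula)
  show "ZF \<turnstile>\<^bsub>2\<^esub> translate iota \<phi>"
  proof (rule ZF_completeness[OF formula_iota])
    fix M :: "nat model" and e
    assume M: "henkin 2 M" "dom M = UNIV" "\<And>e a. valid M e \<Longrightarrow> a \<in> ZF \<Longrightarrow> sat M e a"
      and e: "valid M e"
    from M obtain M' where M': "henkin 3 M'" "\<forall>e. valid M' e = valid M e"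
      "\<forall>e. \<forall>a\<in>FLT_ZF. sat M' e a"
      "\<forall>e p. formula 3 p \<longrightarrow> (sat M e (translate iota p) \<longleftrightarrow> sat M' e p)"
      "\<forall>e p. formula 2 p \<longrightarrow> (sat M' e (translate kappa p) \<longleftrightarrow> sat M e p)"
      by (rule ZF_model)
    have "sat M' e \<phi>" using sound[OF p M'(1)] M'(2,3) e by blast
    then show "sat M e (translate iota \<phi>)" using M'(4) f by blast
  qed
next
  fix \<phi> assume p: "ZF \<turnstile>\<^bsub>2\<^esub> \<phi>"
  have f: "formula 2 \<phi>" using p by (rule proves_formula)
  show "FLT_ZF \<turnstile>\<^bsub>3\<^esub> translate kappa \<phi>"
  proof (rule FLT_ZF_completeness[OF formula_kappa])
    fix M :: "nat model" and e
    assume M: "henkin 3 M" "dom M = UNIV" "\<And>e a. valid M e \<Longrightarrow> a \<in> FLT_ZF \<Longrightarrow> sat M e a"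
      and e: "valid M e"
    from M obtain M' where M': "henkin 2 M'" "\<forall>e. valid M' e = valid M e"
      "\<forall>e. \<forall>a\<in>ZF. sat M' e a"
      "\<forall>e p. formula 2 p \<longrightarrow> (sat M e (translate kappa p) \<longleftrightarrow> sat M' e p)"
      "\<forall>e p. formula 3 p \<longrightarrow> (sat M' e (translate iota p) \<longleftrightarrow> sat M e p)"
      by (rule FLT_ZF_model)
    have "sat M' e \<phi>" using sound[OF p M'(1)] M'(2,3) e by blast
    then show "sat M e (translate kappa \<phi>)" using M'(4) f by blast
  qed
next
  fix \<phi> assume f: "formula 2 \<phi>"
  show "ZF \<turnstile>\<^bsub>2\<^esub> \<phi> \<^bold>\<leftrightarrow> translate iota (translate kappa \<phi>)"
  proof (rule ZF_completeness)
    show "formula 2 (\<phi> \<^bold>\<leftrightarrow> translate iota (translate kappa \<phi>))" using f formula_iota by simp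
    fix M :: "nat model" and e
    assume M: "henkin 2 M" "dom M = UNIV" "\<And>e a. valid M e \<Longrightarrow> a \<in> ZF \<Longrightarrow> sat M e a"
    from M obtain M' where M': "henkin 3 M'" "\<forall>e. valid M' e = valid M e"
      "\<forall>e. \<forall>a\<in>FLT_ZF. sat M' e a"
      "\<forall>e p. formula 3 p \<longrightarrow> (sat M e (translate iota p) \<longleftrightarrow> sat M' e p)"
      "\<forall>e p. formula 2 p \<longrightarrow> (sat M' e (translate kappa p) \<longleftrightarrow> sat M e p)"
      by (rule ZF_model)
    show "sat M e (\<phi> \<^bold>\<leftrightarrow> translate iota (translate kappa \<phi>))" using M'(4,5) f formula_kappa by simp
  qed
next
  fix \<phi> assume f: "formula 3 \<phi>"
  show "FLT_ZF \<turnstile>\<^bsub>3\<^esub> \<phi> \<^bold>\<leftrightarrow> translate kappa (translate iota \<phi>)"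
  proof (rule FLT_ZF_completeness)
    show "formula 3 (\<phi> \<^bold>\<leftrightarrow> translate kappa (translate iota \<phi>))" using f formula_kappa by simp
    fix M :: "nat model" and e
    assume M: "henkin 3 M" "dom M = UNIV" "\<And>e a. valid M e \<Longrightarrow> a \<in> FLT_ZF \<Longrightarrow> sat M e a"
    from M obtain M' where M': "henkin 2 M'" "\<forall>e. valid M' e = valid M e"
      "\<forall>e. \<forall>a\<in>ZF. sat M' e a"
      "\<forall>e p. formula 2 p \<longrightarrow> (sat M e (translate kappa p) \<longleftrightarrow> sat M' e p)"
      "\<forall>e p. formula 3 p \<longrightarrow> (sat M' e (translate iota p) \<longleftrightarrow> sat M e p)"
      by (rule FLT_ZF_model)
    show "sat M e (\<phi> \<^bold>\<leftrightarrow> translate kappa (translate iota \<phi>))" using M'(4,5) f formula_iota by simp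
  qed
qed

end
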